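(* Consider the two-phase amplify-and-forward relay network with $N$ relays and $N_D$ destination antennas described in the context, and let $\mathcal{C}=\{\sum_{i=1}^K x_iA_i: x_i\in\mathcal{A}_i,\ i=1,\ldots,K\}\subset\mathbb{C}^{T_2\times N}$ be a DSTBC used in this network, where each $\mathcal{A}_i\subset\mathbb{R}$ is finite. If $\sum_{i=1}^K u_iA_i$ has rank $N$ for every $u=[u_1,\ldots,u_K]^T\in\mathbb{R}^K\setminus\{0\}$, then $\mathcal{C}$ achieves a diversity of $N\left(1-\frac{\log(\log P)}{\log P}\right)$ if $N_D=1$, and a diversity of $N$ if $N_D>1$, both with ZF decoding and with ZF-SIC decoding under any ordering of the symbols.
   Context: **Network and DSTBC.** $A^*$ denotes entrywise complex conjugate and $A^H$ conjugate transpose. Fix integers $N,N_D,K,T_1,T_2\ge 1$, a subset $\mathcal{S}\subset\{1,\ldots,N\}$, vectors $\nu_1,\ldots,\nu_K\in\mathbb{C}^{T_1}$ linearly independent over $\mathbb{R}$, matrices $B_1,\ldots,B_N\in\mathbb{C}^{T_2\times T_1}$, and a finite signal set $\mathcal{A}\subset\mathbb{R}^K$ (here $\mathcal{A}=\mathcal{A}_1\times\cdots\times\mathcal{A}_K$). For $j\in\{1,\ldots,N\}$ put $\kappa_j(C)=C^*$ if $j\in\mathcal{S}$ and $\kappa_j(C)=C$ otherwise. Constants $\pi_1,\pi_2>0$ are fixed with $\pi_1T_1+\pi_2RT_2=T_1+T_2$, where $R=\frac{K}{2(T_1+T_2)}$; $P>0$ is the average power. The channel gains $f_j$ (source to relay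 $j$) and $g_{j,l}$ (relay $j$ to destination antenna $l$), $1\le j\le N$, $1\le l\le N_D$, are independent circularly symmetric complex Gaussian variables of mean $0$ and variance $1$, constant during a transmission cycle and known to the destination. The noises $v_j\in\mathbb{C}^{T_1}$ (relays) and $w_l\in\mathbb{C}^{T_2}$ (destination antennas) are circularly symmetric complex Gaussian with zero mean and covariances $I_{T_1}$, $I_{T_2}$; all gains, noises and the information vector are mutually independent. The information vector $x=[x_1,\ldots,x_K]^T$ takes values in $\mathcal{A}$, $z=\sum_i x_i\nu_i$, and $\mathcal{A},\nu_i$ are chosen so that $\mathsf{E}\|z\|^2=T_1$. Relay $j$ receives $r_j=f_j\sqrt{\pi_1P}\,z+v_j$ and sends $t_j=\sqrt{\tfrac{\pi_2P}{\pi_1P+1}}\,\kappa_j(B_jr_j)$; antenna $l$ of the destination receives $y_l=\sum_j g_{j,l}t_j+w_l$. Hence $Y=[y_1\cdots y_{N_D}]=\sqrt{\tfrac{\pi_1\pi_2P^2}{\pi_1P+1}}\,XH+U$, where $X=[\kappa_1(B_1z)\cdots\kappa_N(B_Nz)]\in\mathbb{C}^{T_2\times N}$, $H\in\mathbb{C}^{N\times N_D}$ has $(j,l)$ entry $\kappa_j(f_j)g_{j,l}$, and $U$ has columns $u_l=\sum_j\sqrt{\tfrac{\pi_2P}{\pi_1P+1}}\,g_{j,l}\,\kappa_j(B_jv_j)+w_l$. The weight matrices are $A_i=[\kappa_1(B_1\nu_i)\cdots\kappa_N(B_N\nu_i)]\in\mathbb{C}^{T_2\times N}$, so $X=\sum_i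 x_iA_i$; the set $\mathcal{C}$ of all codewords $X$ is the distributed space-time block code (DSTBC). **ZF and ZF-SIC decoders.** For a complex matrix $A$, $\widetilde{vec}(A)=[vec(A_{Re})^T\ vec(A_{Im})^T]^T$. Let $G'=\sqrt{\tfrac{\pi_1\pi_2P^2}{\pi_1P+1}}\,[\widetilde{vec}(A_1H)\cdots\widetilde{vec}(A_KH)]$, let $\Gamma$ be the covariance matrix of $\widetilde{vec}(U)$ given the channel gains, $G=\Gamma^{-1/2}G'=[g_1\cdots g_K]$ (symmetric positive definite square root), and $y=\Gamma^{-1/2}\widetilde{vec}(Y)=Gx+n$. ZF decoding: for each $i$, with $P_i$ the orthogonal projection onto the orthogonal complement of $\mathrm{span}\{g_{i'}: i'\ne i\}$, output $\hat x_i\in\arg\min_{b\in\mathcal{A}_i}\|P_iy-P_ig_ib\|^2$. ZF-SIC decoding with ordering $\sigma$ (a permutation of $\{1,\ldots,K\}$): set $y_1=y$ and, successively for $k=1,\ldots,K$, with $\tilde P_k$ the orthogonal projection onto the orthogonal complement of $\mathrm{span}\{g_{\sigma(\ell)}:\ell>k\}$, output $\hat x_{\sigma(k)}\in\arg\min_{b\in\mathcal{A}_{\sigma(k)}}\|\tilde P_ky_k-\tilde P_kg_{\sigma(k)}b\|^2$ and set $y_{k+1}=y_k-g_{\sigma(k)}\hat x_{\sigma(k)}$. **Diversity.** A decoder achieves a diversity of $d=d(P)$ if there is a constant $c_0>0$ such that for all sufficiently large $P$ and every transmitted $x\in\mathcal{A}$, the probability (over channel gains and noises) that the decoded vector differs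 from $x$ is at most $c_0P^{-d(P)}$. *)

theory Defs
  imports "HOL-Probability.Probability"
begin

text \<open>
  The number of relays, destination antennas and real symbols and the lengths of the two phases are
  the cardinalities of the finite types \<open>'n\<close>, \<open>'d\<close>, \<open>'k\<close>, \<open>'t1\<close>, \<open>'t2\<close>.
  \<open>conj_relays\<close> is the set of conjugating relays, \<open>nu i\<close> the vector carrying symbol \<open>i\<close>,
  \<open>relay_mat j\<close> the matrix of relay \<open>j\<close>, \<open>alphabet i\<close> the signal set of symbol \<open>i\<close>,
  \<open>pi1\<close> and \<open>pi2\<close> the power allocation constants.
\<close>

record ('k, 'n, 't1::finite, 't2::finite) af_network =
  conj_relays :: "'n set"
  nu :: "'k \<Rightarrow> complex ^ 't1"
  relay_mat :: "'n \<Rightarrow> complex ^ 't1 ^ 't2"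
  alphabet :: "'k \<Rightarrow> real set"
  pi1 :: real
  pi2 :: real

definition signal_set :: "('k::finite, 'n::finite, 't1::finite, 't2::finite) af_network \<Rightarrow> (real ^ 'k) set" where
  "signal_set net = {x. \<forall>i. x $ i \<in> alphabet net i}"

definition source_vec :: "('k::finite, 'n::finite, 't1::finite, 't2::finite) af_network \<Rightarrow> real ^ 'k \<Rightarrow> complex ^ 't1" where
  "source_vec net x = (\<Sum>i\<in>UNIV. x $ i *\<^sub>R nu net i)"

definition rate :: "('k::finite, 'n::finite, 't1::finite, 't2::finite) af_network \<Rightarrow> real" where
  "rate net = CARD('k) / (2 * (CARD('t1) + CARD('t2)))"

text \<open>\<open>px\<close> is the distribution of the information vector.\<close>

definition valid_network ::
  "('k::finite, 'n::finite, 't1::finite, 't2::finite) af_network \<Rightarrow> (real ^ 'k) pmf \<Rightarrow> bool" where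
  "valid_network net px \<longleftrightarrow>
     inj (nu net) \<and> independent (range (nu net)) \<and>
     (\<forall>i. finite (alphabet net i)) \<and>
     set_pmf px \<subseteq> signal_set net \<and>
     measure_pmf.expectation px (\<lambda>x. (norm (source_vec net x))\<^sup>2) = CARD('t1) \<and>
     pi1 net > 0 \<and> pi2 net > 0 \<and>
     pi1 net * CARD('t1) + pi2 net * rate net * CARD('t2) = CARD('t1) + CARD('t2)"


definition kap :: "('k::finite, 'n::finite, 't1::finite, 't2::finite) af_network \<Rightarrow> 'n \<Rightarrow> complex \<Rightarrow> complex" where
  "kap net j c = (if j \<in> conj_relays net then cnj c else c)"

definition kap_vec ::
  "('k::finite, 'n::finite, 't1::finite, 't2::finite) af_network \<Rightarrow> 'n \<Rightarrow> complex ^ 't2 \<Rightarrow> complex ^ 't2" where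
  "kap_vec net j c = (\<chi> t. kap net j (c $ t))"

definition weight_mat ::
  "('k::finite, 'n::finite, 't1::finite, 't2::finite) af_network \<Rightarrow> 'k \<Rightarrow> complex ^ 'n ^ 't2" where
  "weight_mat net i = (\<chi> t j. kap_vec net j (relay_mat net j *v nu net i) $ t)"

definition codeword ::
  "('k::finite, 'n::finite, 't1::finite, 't2::finite) af_network \<Rightarrow> real ^ 'k \<Rightarrow> complex ^ 'n ^ 't2" where
  "codeword net x = (\<Sum>i\<in>UNIV. x $ i *\<^sub>R weight_mat net i)"


text \<open>
  In the following \<open>f $ j\<close> and \<open>g $ j $ l\<close> are channel gains, \<open>v $ j\<close> is the noise vector at
  relay \<open>j\<close> and \<open>w $ l\<close> the noise vector at destination antenna \<open>l\<close>. The column \<open>l\<close> of a matrix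
  of type \<open>complex ^ 'd ^ 't2\<close> belongs to antenna \<open>l\<close>.
\<close>

definition relay_gain :: "('k::finite, 'n::finite, 't1::finite, 't2::finite) af_network \<Rightarrow> real \<Rightarrow> real" where
  "relay_gain net P = sqrt (pi2 net * P / (pi1 net * P + 1))"

definition relay_received ::
  "('k::finite, 'n::finite, 't1::finite, 't2::finite) af_network \<Rightarrow> real \<Rightarrow> complex ^ 'n \<Rightarrow> complex ^ 't1 ^ 'n
     \<Rightarrow> real ^ 'k \<Rightarrow> 'n \<Rightarrow> complex ^ 't1" where
  "relay_received net P f v x j = f $ j *s (sqrt (pi1 net * P) *\<^sub>R source_vec net x) + v $ j"

definition relay_sent ::
  "('k::finite, 'n::finite, 't1::finite, 't2::finite) af_network \<Rightarrow> real \<Rightarrow> complex ^ 'n \<Rightarrow>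
     complex ^ 't1 ^ 'n \<Rightarrow> real ^ 'k \<Rightarrow> 'n \<Rightarrow> complex ^ 't2" where
  "relay_sent net P f v x j =
     relay_gain net P *\<^sub>R kap_vec net j (relay_mat net j *v relay_received net P f v x j)"

definition received ::
  "('k::finite, 'n::finite, 't1::finite, 't2::finite) af_network \<Rightarrow> real \<Rightarrow> complex ^ 'n \<Rightarrow>
     complex ^ 'd ^ 'n \<Rightarrow> complex ^ 't1 ^ 'n \<Rightarrow> complex ^ 't2 ^ 'd \<Rightarrow> real ^ 'k \<Rightarrow> complex ^ ('d::finite) ^ 't2"
  where
  "received net P f g v w x =
     (\<chi> t l. ((\<Sum>j\<in>UNIV. g $ j $ l *s relay_sent net P f v x j) + w $ l) $ t)"

definition total_gain :: "('k::finite, 'n::finite, 't1::finite, 't2::finite) af_network \<Rightarrow> real \<Rightarrow> real" where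
  "total_gain net P = sqrt (pi1 net * pi2 net * P\<^sup>2 / (pi1 net * P + 1))"

definition channel_mat ::
  "('k::finite, 'n::finite, 't1::finite, 't2::finite) af_network \<Rightarrow> complex ^ 'n \<Rightarrow> complex ^ 'd ^ 'n \<Rightarrow> complex ^ ('d::finite) ^ 'n"
  where
  "channel_mat net f g = (\<chi> j l. kap net j (f $ j) * g $ j $ l)"

definition total_noise ::
  "('k::finite, 'n::finite, 't1::finite, 't2::finite) af_network \<Rightarrow> real \<Rightarrow> complex ^ 'd ^ 'n \<Rightarrow>
     complex ^ 't1 ^ 'n \<Rightarrow> complex ^ 't2 ^ 'd \<Rightarrow> complex ^ ('d::finite) ^ 't2" where
  "total_noise net P g v w =
     (\<chi> t l. ((\<Sum>j\<in>UNIV. relay_gain net P *\<^sub>R (g $ j $ l *s kap_vec net j (relay_mat net j *v v $ j)))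
            + w $ l) $ t)"

lemma received_eq:
  "received net P f g v w x =
     total_gain net P *\<^sub>R (codeword net x ** channel_mat net f g) + total_noise net P g v w"
proof -
  have gain: "total_gain net P = relay_gain net P * sqrt (pi1 net * P)"
    unfolding total_gain_def relay_gain_def real_sqrt_mult[symmetric]
    by (simp add: power2_eq_square ac_simps)
  have lin: "kap net j (a + b) = kap net j a + kap net j b"
    "kap net j (a * b) = kap net j a * kap net j b"
    "kap net j (r *\<^sub>R a) = r *\<^sub>R kap net j a"
    "kap net j (complex_of_real r) = complex_of_real r"
    "kap net j (sum h A) = (\<Sum>i\<in>A. kap net j (h i))" for j a b r h and A :: "'z set"
    by (simp_all add: kap_def)
  have cw: "codeword net x $ t $ j = kap net j ((relay_mat net j *v source_vec net x) $ t)" for t j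
  proof -
    have "relay_mat net j *v source_vec net x = (\<Sum>i\<in>UNIV. x $ i *\<^sub>R (relay_mat net j *v nu net i))"
      by (simp add: source_vec_def vec_eq_iff matrix_vector_mult_def sum_distrib_left
          scaleR_sum_right mult_scaleR_right) (intro allI, rule sum.swap)
    then show ?thesis
      by (simp add: codeword_def weight_mat_def kap_vec_def lin)
  qed
  have sent: "relay_sent net P f v x j $ t =
      total_gain net P *\<^sub>R (codeword net x $ t $ j * kap net j (f $ j))
      + relay_gain net P *\<^sub>R kap net j ((relay_mat net j *v v $ j) $ t)" for j t
  proof -
    have "relay_mat net j *v relay_received net P f v x j =
        f $ j *s (sqrt (pi1 net * P) *\<^sub>R (relay_mat net j *v source_vec net x)) + relay_mat net j *v v $ j"
      by (simp add: relay_received_def vec_eq_iff matrix_vector_mult_def sum_distrib_left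
          scaleR_sum_right sum.distrib algebra_simps)
    then show ?thesis
      by (simp add: relay_sent_def kap_vec_def lin cw gain algebra_simps)
  qed
  show ?thesis
    by (simp add: vec_eq_iff received_def total_noise_def matrix_matrix_mult_def channel_mat_def
        kap_vec_def sent sum.distrib scaleR_sum_right algebra_simps)
qed


text \<open>
  Mean zero, unit variance and circular symmetry: real and imaginary part are independent normal
  variables of variance \<open>1/2\<close>.
\<close>

definition std_complex_gaussian :: "'w measure \<Rightarrow> ('w \<Rightarrow> complex) \<Rightarrow> bool" where
  "std_complex_gaussian M X \<longleftrightarrow>
     prob_space.indep_var M borel (\<lambda>\<omega>. Re (X \<omega>)) borel (\<lambda>\<omega>. Im (X \<omega>)) \<and>
     distributed M lborel (\<lambda>\<omega>. Re (X \<omega>)) (normal_density 0 (sqrt (1 / 2))) \<and>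
     distributed M lborel (\<lambda>\<omega>. Im (X \<omega>)) (normal_density 0 (sqrt (1 / 2)))"

datatype ('n, 'd, 't1, 't2) source =
  Source_Gain 'n | Dest_Gain 'n 'd | Relay_Noise 'n 't1 | Dest_Noise 'd 't2

primrec source_var ::
  "('w \<Rightarrow> complex ^ 'n) \<Rightarrow> ('w \<Rightarrow> complex ^ 'd ^ 'n) \<Rightarrow> ('w \<Rightarrow> complex ^ 't1 ^ 'n) \<Rightarrow>
     ('w \<Rightarrow> complex ^ 't2 ^ 'd) \<Rightarrow>
     ('n::finite, 'd::finite, 't1::finite, 't2::finite) source \<Rightarrow> 'w \<Rightarrow> complex" where
  "source_var f g v w (Source_Gain j) = (\<lambda>\<omega>. f \<omega> $ j)"
| "source_var f g v w (Dest_Gain j l) = (\<lambda>\<omega>. g \<omega> $ j $ l)"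
| "source_var f g v w (Relay_Noise j t) = (\<lambda>\<omega>. v \<omega> $ j $ t)"
| "source_var f g v w (Dest_Noise l t) = (\<lambda>\<omega>. w \<omega> $ l $ t)"

text \<open>
  Independence of the entries of each noise vector, part of the joint independence below, expresses
  that its covariance matrix is the identity.
\<close>

definition channel_model ::
  "'w measure \<Rightarrow> ('w \<Rightarrow> complex ^ 'n::finite) \<Rightarrow> ('w \<Rightarrow> complex ^ 'd::finite ^ 'n) \<Rightarrow>
     ('w \<Rightarrow> complex ^ 't1::finite ^ 'n) \<Rightarrow> ('w \<Rightarrow> complex ^ 't2::finite ^ 'd) \<Rightarrow> bool" where
  "channel_model M f g v w \<longleftrightarrow>
     prob_space M \<and>
     prob_space.indep_vars M (\<lambda>_. borel) (source_var f g v w) UNIV \<and>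
     (\<forall>s. std_complex_gaussian M (source_var f g v w s))"


definition vec_tilde :: "complex ^ 'd ^ 't2 \<Rightarrow> real ^ (('d::finite \<times> 't2::finite) + ('d \<times> 't2))" where
  "vec_tilde A = (\<chi> a. case a of Inl (l, t) \<Rightarrow> Re (A $ t $ l) | Inr (l, t) \<Rightarrow> Im (A $ t $ l))"

text \<open>
  Since gains and noises are independent, the covariance matrix given the gains is obtained by
  freezing the gains and averaging over the noises.
\<close>

definition noise_cov ::
  "('k::finite, 'n::finite, 't1::finite, 't2::finite) af_network \<Rightarrow> 'w measure \<Rightarrow>
     ('w \<Rightarrow> complex ^ 't1 ^ 'n) \<Rightarrow> ('w \<Rightarrow> complex ^ 't2 ^ 'd) \<Rightarrow> real \<Rightarrow> complex ^ ('d::finite) ^ 'n \<Rightarrow>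
     real ^ (('d \<times> 't2) + ('d \<times> 't2)) ^ (('d \<times> 't2) + ('d \<times> 't2))" where
  "noise_cov net M v w P g =
     (let u = (\<lambda>a \<omega>. vec_tilde (total_noise net P g (v \<omega>) (w \<omega>)) $ a);
          mean = (\<lambda>a. \<integral>\<omega>. u a \<omega> \<partial>M)
      in (\<chi> a b. \<integral>\<omega>. (u a \<omega> - mean a) * (u b \<omega> - mean b) \<partial>M))"

definition sym_pos_def :: "real ^ 'a ^ 'a \<Rightarrow> bool" where
  "sym_pos_def A \<longleftrightarrow> transpose A = A \<and> (\<forall>x. x \<noteq> 0 \<longrightarrow> x \<bullet> (A *v x) > 0)"

text \<open>The symmetric positive definite square root of the inverse, which is unique if \<open>A\<close> is positive definite.\<close>

definition inv_sqrt_mat :: "real ^ 'a ^ 'a \<Rightarrow> real ^ 'a ^ ('a::finite)" where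
  "inv_sqrt_mat A = (SOME S. sym_pos_def S \<and> S ** S = matrix_inv A)"

definition eq_channel_raw ::
  "('k::finite, 'n::finite, 't1::finite, 't2::finite) af_network \<Rightarrow> real \<Rightarrow> complex ^ 'n \<Rightarrow> complex ^ 'd ^ 'n \<Rightarrow>
     real ^ ('k::finite) ^ (('d::finite \<times> 't2) + ('d \<times> 't2))" where
  "eq_channel_raw net P f g =
     (\<chi> a i. total_gain net P * vec_tilde (weight_mat net i ** channel_mat net f g) $ a)"

definition eq_channel ::
  "('k::finite, 'n::finite, 't1::finite, 't2::finite) af_network \<Rightarrow> 'w measure \<Rightarrow>
     ('w \<Rightarrow> complex ^ 't1 ^ 'n) \<Rightarrow> ('w \<Rightarrow> complex ^ 't2 ^ 'd) \<Rightarrow> real \<Rightarrow> complex ^ 'n \<Rightarrow> complex ^ 'd ^ 'n \<Rightarrow>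
     real ^ ('k::finite) ^ (('d::finite \<times> 't2) + ('d \<times> 't2))" where
  "eq_channel net M v w P f g = inv_sqrt_mat (noise_cov net M v w P g) ** eq_channel_raw net P f g"

definition eq_received ::
  "('k::finite, 'n::finite, 't1::finite, 't2::finite) af_network \<Rightarrow> 'w measure \<Rightarrow>
     ('w \<Rightarrow> complex ^ 't1 ^ 'n) \<Rightarrow> ('w \<Rightarrow> complex ^ 't2 ^ 'd) \<Rightarrow> real \<Rightarrow> complex ^ 'd ^ 'n \<Rightarrow>
     complex ^ 'd ^ 't2 \<Rightarrow> real ^ (('d::finite \<times> 't2) + ('d \<times> 't2))" where
  "eq_received net M v w P g Y = inv_sqrt_mat (noise_cov net M v w P g) *v vec_tilde Y"


definition orth_proj :: "'a::euclidean_space set \<Rightarrow> 'a \<Rightarrow> 'a" where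
  "orth_proj V y = (THE p. p \<in> V \<and> y - p \<in> orthogonal_comp V)"

definition zf_proj :: "real ^ 'k ^ 'm \<Rightarrow> 'k \<Rightarrow> real ^ 'm \<Rightarrow> real ^ ('m::finite)" where
  "zf_proj G i = orth_proj (orthogonal_comp (span {column i' G | i'. i' \<noteq> i}))"

definition zf_output ::
  "('k \<Rightarrow> real set) \<Rightarrow> real ^ 'k ^ 'm \<Rightarrow> real ^ ('m::finite) \<Rightarrow> real ^ ('k::finite) \<Rightarrow> bool" where
  "zf_output \<A> G y xh \<longleftrightarrow>
     (\<forall>i. is_arg_min (\<lambda>b. (norm (zf_proj G i y - b *\<^sub>R zf_proj G i (column i G)))\<^sup>2)
            (\<lambda>b. b \<in> \<A> i) (xh $ i))"

text \<open>Orderings of the symbols are bijections from \<open>{..<CARD('k)}\<close> to \<open>'k\<close>; stages are counted from \<open>0\<close>.\<close>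

primrec sic_residual ::
  "real ^ 'k ^ 'm \<Rightarrow> (nat \<Rightarrow> 'k) \<Rightarrow> real ^ 'm \<Rightarrow> real ^ 'k \<Rightarrow> nat \<Rightarrow> real ^ ('m::finite)" where
  "sic_residual G \<sigma> y xh 0 = y"
| "sic_residual G \<sigma> y xh (Suc k) = sic_residual G \<sigma> y xh k - (xh $ \<sigma> k) *\<^sub>R column (\<sigma> k) G"

definition sic_proj :: "real ^ ('k::finite) ^ 'm \<Rightarrow> (nat \<Rightarrow> 'k) \<Rightarrow> nat \<Rightarrow> real ^ 'm \<Rightarrow> real ^ ('m::finite)" where
  "sic_proj G \<sigma> k = orth_proj (orthogonal_comp (span {column (\<sigma> m) G | m. k < m \<and> m < CARD('k)}))"

definition zf_sic_output ::
  "(nat \<Rightarrow> 'k) \<Rightarrow> ('k \<Rightarrow> real set) \<Rightarrow> real ^ 'k ^ 'm \<Rightarrow> real ^ ('m::finite) \<Rightarrow> real ^ ('k::finite) \<Rightarrow> bool" where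
  "zf_sic_output \<sigma> \<A> G y xh \<longleftrightarrow>
     (\<forall>k<CARD('k). is_arg_min
        (\<lambda>b. (norm (sic_proj G \<sigma> k (sic_residual G \<sigma> y xh k) - b *\<^sub>R sic_proj G \<sigma> k (column (\<sigma> k) G)))\<^sup>2)
        (\<lambda>b. b \<in> \<A> (\<sigma> k)) (xh $ \<sigma> k))"

text \<open>
  A decoder maps the power, the gains and the received matrix to the decoded vector. The decoding
  rules leave ties open; any measurable way of breaking them is allowed.
\<close>

type_synonym ('k, 'n, 'd, 't2) decoder =
  "real \<Rightarrow> complex ^ 'n \<Rightarrow> complex ^ 'd ^ 'n \<Rightarrow> complex ^ 'd ^ 't2 \<Rightarrow> real ^ 'k"

definition measurable_decoder ::
  "('k::finite, 'n::finite, 'd::finite, 't2::finite) decoder \<Rightarrow> bool" where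
  "measurable_decoder dec \<longleftrightarrow> (\<forall>P>0. (\<lambda>(f, g, Y). dec P f g Y) \<in> borel_measurable borel)"

definition zf_decoder ::
  "('k::finite, 'n::finite, 't1::finite, 't2::finite) af_network \<Rightarrow> 'w measure \<Rightarrow>
     ('w \<Rightarrow> complex ^ 't1 ^ 'n) \<Rightarrow> ('w \<Rightarrow> complex ^ 't2 ^ 'd) \<Rightarrow> ('k, 'n, 'd::finite, 't2) decoder \<Rightarrow> bool" where
  "zf_decoder net M v w dec \<longleftrightarrow> measurable_decoder dec \<and>
     (\<forall>P>0. \<forall>f g Y. zf_output (alphabet net) (eq_channel net M v w P f g)
        (eq_received net M v w P g Y) (dec P f g Y))"

definition zf_sic_decoder ::
  "('k::finite, 'n::finite, 't1::finite, 't2::finite) af_network \<Rightarrow> 'w measure \<Rightarrow>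
     ('w \<Rightarrow> complex ^ 't1 ^ 'n) \<Rightarrow> ('w \<Rightarrow> complex ^ 't2 ^ 'd) \<Rightarrow> (nat \<Rightarrow> 'k) \<Rightarrow>
     ('k, 'n, 'd::finite, 't2) decoder \<Rightarrow> bool" where
  "zf_sic_decoder net M v w \<sigma> dec \<longleftrightarrow> measurable_decoder dec \<and>
     (\<forall>P>0. \<forall>f g Y. zf_sic_output \<sigma> (alphabet net) (eq_channel net M v w P f g)
        (eq_received net M v w P g Y) (dec P f g Y))"

definition error_prob ::
  "('k::finite, 'n::finite, 't1::finite, 't2::finite) af_network \<Rightarrow> 'w measure \<Rightarrow>
     ('w \<Rightarrow> complex ^ 'n) \<Rightarrow> ('w \<Rightarrow> complex ^ 'd ^ 'n) \<Rightarrow> ('w \<Rightarrow> complex ^ 't1 ^ 'n) \<Rightarrow>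
     ('w \<Rightarrow> complex ^ 't2 ^ 'd) \<Rightarrow> ('k, 'n, 'd::finite, 't2) decoder \<Rightarrow> real \<Rightarrow> real ^ 'k \<Rightarrow> real" where
  "error_prob net M f g v w dec P x =
     measure M {\<omega> \<in> space M.
       dec P (f \<omega>) (g \<omega>) (received net P (f \<omega>) (g \<omega>) (v \<omega>) (w \<omega>) x) \<noteq> x}"

definition achieves_diversity ::
  "('k::finite, 'n::finite, 't1::finite, 't2::finite) af_network \<Rightarrow> 'w measure \<Rightarrow>
     ('w \<Rightarrow> complex ^ 'n) \<Rightarrow> ('w \<Rightarrow> complex ^ 'd ^ 'n) \<Rightarrow> ('w \<Rightarrow> complex ^ 't1 ^ 'n) \<Rightarrow>
     ('w \<Rightarrow> complex ^ 't2 ^ 'd) \<Rightarrow> ('k, 'n, 'd::finite, 't2) decoder \<Rightarrow> (real \<Rightarrow> real) \<Rightarrow> bool" where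
  "achieves_diversity net M f g v w dec d \<longleftrightarrow>
     (\<exists>c\<^sub>0>0. \<forall>\<^sub>F P in at_top. \<forall>x\<in>signal_set net.
        error_prob net M f g v w dec P x \<le> c\<^sub>0 * P powr (- d P))"

definition zf_diversity ::
  "('k::finite, 'n::finite, 't1::finite, 't2::finite) af_network \<Rightarrow> 'w measure \<Rightarrow>
     ('w \<Rightarrow> complex ^ 'n) \<Rightarrow> ('w \<Rightarrow> complex ^ ('d::finite) ^ 'n) \<Rightarrow> ('w \<Rightarrow> complex ^ 't1 ^ 'n) \<Rightarrow>
     ('w \<Rightarrow> complex ^ 't2 ^ 'd) \<Rightarrow> (real \<Rightarrow> real) \<Rightarrow> bool" where
  "zf_diversity net M f g v w d \<longleftrightarrow>
     (\<forall>dec. zf_decoder net M v w dec \<longrightarrow> achieves_diversity net M f g v w dec d)"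

definition zf_sic_diversity ::
  "('k::finite, 'n::finite, 't1::finite, 't2::finite) af_network \<Rightarrow> 'w measure \<Rightarrow>
     ('w \<Rightarrow> complex ^ 'n) \<Rightarrow> ('w \<Rightarrow> complex ^ ('d::finite) ^ 'n) \<Rightarrow> ('w \<Rightarrow> complex ^ 't1 ^ 'n) \<Rightarrow>
     ('w \<Rightarrow> complex ^ 't2 ^ 'd) \<Rightarrow> (nat \<Rightarrow> 'k) \<Rightarrow> (real \<Rightarrow> real) \<Rightarrow> bool" where
  "zf_sic_diversity net M f g v w \<sigma> d \<longleftrightarrow>
     (\<forall>dec. zf_sic_decoder net M v w \<sigma> dec \<longrightarrow> achieves_diversity net M f g v w dec d)"

end

theory Submission
  imports Defs
begin

text \<open>
  If a symbol is decoded wrongly, then for some column \<open>i\<close> the whitened noise \<open>n\<close> has a component of size at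
  least \<open>\<delta> / 2 * norm q\<close> along the projected column \<open>q = G *v u\<close> with \<open>u $ i = 1\<close>, where \<open>\<delta>\<close> is the
  smallest distance in the alphabets. Given the gains, \<open>q \<bullet> n\<close> is Gaussian with variance \<open>(norm q)\<^sup>2\<close>,
  so this has probability at most \<open>2 * exp (- \<delta>\<^sup>2 * (norm q)\<^sup>2 / 8)\<close>. The rank condition and compactness
  of the unit spheres, together with a bound on the noise covariance that is uniform in \<open>P\<close>, give
  \<open>(norm q)\<^sup>2 \<ge> \<kappa> * P * (\<Sum>j. |f j|\<^sup>2 * x j) / (1 + (\<Sum>j. x j))\<close> with \<open>x j = (\<Sum>l. |g j l|\<^sup>2)\<close>.
  Averaging over \<open>f\<close> yields a product of factors \<open>1 / (1 + a j)\<close>, which up to a constant is at most the product of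
  \<open>exp (x j / 2) / (1 + \<kappa> * P * x j)\<close>. Writing \<open>1 / (1 + c)\<close> as the Laplace transform of the
  exponential distribution turns the average over \<open>g\<close> into Gaussian integrals again, and each of the
  \<open>N\<close> factors becomes the mean of \<open>1 / (1 / 2 + \<kappa> * P * s) ^ N\<^sub>D\<close>, which is of order \<open>ln P / P\<close> for
  \<open>N\<^sub>D = 1\<close> and \<open>1 / P\<close> otherwise.
\<close>

section \<open>Symmetric matrices\<close>

text \<open>The lower bound on \<open>norm q\<close> uses only that one coordinate of
  \<open>u\<close> equals 1, not which columns were projected out; hence ZF and all SIC orderings
  share one estimate. For SIC, looking at the first wrong stage avoids error propagation. The noise
  covariance depends on the destination gains alone, so for frozen \<open>g\<close> the exponent is
  linear in the independent squares of the moduli of \<open>f\<close>, and averaging over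
  \<open>f\<close> comes first. What remains couples the relays through the common denominator
  \<open>1 + sum x\<close>. Uncoupling them costs its N-th power, a polynomial that the weights
  \<open>exp (x j / 2)\<close> absorb. The rate 1/2 stays below 1, where the mean of
  \<open>exp (t * x j)\<close> becomes infinite, and it is what leaves 1/2 instead of 1 in the final
  integrand. For one antenna that integrand decays only like 1/s, so the exponential weight has to
  cut it off, at the price of a logarithm; for two or more antennas it is integrable by itself. For
  \<open>P > 1\<close>, the bound \<open>P powr (- (N * (1 - ln (ln P) / ln P)))\<close> is exactly
  \<open>(ln P / P) ^ N\<close>.\<close>

lemma symmetric_matrix_adjoint:
  fixes A :: "real ^ 'a ^ 'a"
  assumes "transpose A = A"
  shows "x \<bullet> (A *v y) = (A *v x) \<bullet> y"
  by (metis assms dot_lmul_matrix vector_transpose_matrix)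

lemma symmetric_matrixI:
  fixes A :: "real ^ 'a ^ 'a"
  assumes "\<And>x y. x \<bullet> (A *v y) = (A *v x) \<bullet> y"
  shows "transpose A = A"
proof -
  have "x \<bullet> (transpose A *v y) = x \<bullet> (A *v y)" for x y
    using assms[of x y] dot_lmul_matrix[of y A x] by (simp add: inner_commute)
  then have "transpose A *v y = A *v y" for y
    using vector_eq_ldot by blast
  then show ?thesis
    by (simp add: matrix_eq)
qed

lemma matrix_inv_cancel:
  assumes "invertible A"
  shows "A ** matrix_inv A = mat 1" "matrix_inv A ** A = mat 1"
  using someI_ex[OF assms[unfolded invertible_def]] unfolding matrix_inv_def by auto

text \<open>A maximiser of the quadratic form on the unit sphere of \<open>V\<close> is an
  eigenvector: otherwise moving it towards the residual \<open>r\<close> would increase the Rayleigh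
  quotient. Working inside an invariant subspace lets the eigenbasis be built by induction.\<close>

lemma symmetric_matrix_eigenvector:
  fixes A :: "real ^ 'a ^ 'a"
  assumes sym: "transpose A = A" and V: "subspace V" "V \<noteq> {0}"
    and inv: "\<And>x. x \<in> V \<Longrightarrow> A *v x \<in> V"
  obtains v \<mu> where "v \<in> V" "norm v = 1" "A *v v = \<mu> *\<^sub>R v"
proof -
  let ?K = "V \<inter> sphere 0 1" and ?q = "\<lambda>x. x \<bullet> (A *v x)"
  have "compact ?K"
    using V by (simp add: closed_subspace closed_Int_compact)
  moreover have "?K \<noteq> {}"
  proof -
    obtain x where "x \<in> V" "x \<noteq> 0"
      using V subspace_0 by blast
    then have "x /\<^sub>R norm x \<in> ?K"
      using V by (simp add: subspace_scale)
    then show ?thesis by blast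
  qed
  moreover have "continuous_on ?K ?q"
    by (intro continuous_intros linear_continuous_on matrix_vector_mul_linear_gen)
      (simp add: linear_linear)
  ultimately obtain v where v: "v \<in> ?K" and max: "\<And>y. y \<in> ?K \<Longrightarrow> ?q y \<le> ?q v"
    using continuous_attains_sup[of ?K ?q] by blast
  have nv: "v \<in> V" "norm v = 1" "v \<bullet> v = 1"
    using v by (auto simp: norm_eq_1)
  define \<mu> where "\<mu> = ?q v"
  have bound: "?q y \<le> \<mu> * (y \<bullet> y)" if "y \<in> V" for y
  proof (cases "y = 0")
    case False
    have "y /\<^sub>R norm y \<in> ?K"
      using that False V by (simp add: subspace_scale)
    then have "?q (y /\<^sub>R norm y) \<le> \<mu>"
      using max unfolding \<mu>_def by blast
    then have "?q y / (norm y)\<^sup>2 \<le> \<mu>"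
      by (simp add: matrix_vector_mult_scaleR power2_eq_square divide_simps)
    then show ?thesis
      using False by (simp add: divide_simps power2_norm_eq_inner split: if_splits)
  qed simp
  define r where "r = A *v v - \<mu> *\<^sub>R v"
  have rV: "r \<in> V"
    unfolding r_def using V inv nv by (simp add: subspace_diff subspace_scale)
  have rv: "r \<bullet> v = 0"
    unfolding r_def inner_diff_left inner_scaleR_left nv by (simp add: \<mu>_def inner_commute)
  have rA: "r \<bullet> (A *v v) = r \<bullet> r"
    by (simp add: r_def inner_diff_right inner_diff_left \<mu>_def nv inner_commute)
  define c where "c = \<mu> * (r \<bullet> r) - ?q r"
  \<comment> \<open>This is maximality at the perturbed vector \<open>v + t *\<^sub>R r\<close>: the
    term linear in \<open>t\<close> is bounded by the quadratic one, which for small positive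
    \<open>t\<close> forces \<open>r\<close> to vanish.\<close>
  have *: "2 * t * (r \<bullet> r) \<le> t\<^sup>2 * c" for t
  proof -
    have "v + t *\<^sub>R r \<in> V"
      using V nv rV by (simp add: subspace_add subspace_scale)
    from bound[OF this] have "\<mu> + t * (v \<bullet> (A *v r)) + t * (r \<bullet> (A *v v)) + t * t * ?q r
        \<le> \<mu> * (1 + t * t * (r \<bullet> r))"
      using rv by (simp add: matrix_vector_right_distrib matrix_vector_mult_scaleR inner_add_left
          inner_add_right \<mu>_def[symmetric] nv inner_commute[of v r] algebra_simps)
    moreover have "v \<bullet> (A *v r) = r \<bullet> r"
      using rA by (simp add: symmetric_matrix_adjoint[OF sym, of v r] inner_commute)
    ultimately show ?thesis
      unfolding rA c_def by (simp add: power2_eq_square algebra_simps)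
  qed
  have "r = 0"
  proof (rule ccontr)
    assume "r \<noteq> 0"
    then have R: "r \<bullet> r > 0" by simp
    have "2 * (r \<bullet> r) \<le> t * c" if "t > 0" for t
      using *[of t] that by (simp add: power2_eq_square)
    \<comment> \<open>After division by \<open>t\<close> the bound reads
      \<open>2 * (r \<bullet> r) \<le> t * c\<close>; this \<open>t\<close> is small enough that the
      right side is at most \<open>r \<bullet> r\<close>.\<close>
    moreover define t where "t = (r \<bullet> r) / (\<bar>c\<bar> + 1)"
    have t: "t > 0" "t * (\<bar>c\<bar> + 1) = r \<bullet> r"
      using R by (auto simp: t_def intro!: divide_pos_pos)
    moreover have "t * c \<le> t * (\<bar>c\<bar> + 1)"
      using t by (intro mult_left_mono) auto
    ultimately have "2 * (r \<bullet> r) \<le> r \<bullet> r" by fastforce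
    then show False
      using R by linarith
  qed
  then show ?thesis
    using that nv by (simp add: r_def)
qed

text \<open>By symmetry the orthogonal complement of an eigenvector inside \<open>V\<close> is again
  invariant, so one eigenvector can be split off and the dimension drops.\<close>

lemma symmetric_matrix_eigenbasis:
  fixes A :: "real ^ 'a ^ 'a"
  assumes sym: "transpose A = A" and V: "subspace V"
    and inv: "\<And>x. x \<in> V \<Longrightarrow> A *v x \<in> V"
  shows "\<exists>B. finite B \<and> B \<subseteq> V \<and> pairwise orthogonal B \<and> (\<forall>b\<in>B. norm b = 1) \<and> span B = V \<and>
    (\<forall>b\<in>B. \<exists>\<mu>. A *v b = \<mu> *\<^sub>R b)"
  using V inv
proof (induction "dim V" arbitrary: V rule: less_induct)
  case less
  show ?case
  proof (cases "V = {0}")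
    case True
    then show ?thesis by (intro exI[of _ "{}"]) auto
  next
    case False
    obtain v \<mu> where v: "v \<in> V" "norm v = 1" "A *v v = \<mu> *\<^sub>R v"
      using symmetric_matrix_eigenvector[OF sym less.prems(1) False less.prems(2)] by blast
    have vv: "v \<bullet> v = 1" using v by (simp add: norm_eq_1)
    define W where "W = {x \<in> V. v \<bullet> x = 0}"
    have W: "subspace W"
      using less.prems(1) unfolding W_def subspace_def by (auto simp: inner_add_right)
    have WV: "W \<subset> V"
    proof -
      have "v \<notin> W" using vv by (simp add: W_def)
      then show ?thesis using v(1) unfolding W_def by blast
    qed
    have "dim W < dim V"
      using W WV less.prems(1) by (metis psubset_eq dim_subset le_neq_implies_less subspace_dim_equal order.refl)
    moreover have "A *v x \<in> W" if "x \<in> W" for x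
      using that less.prems(2) v symmetric_matrix_adjoint[OF sym, of v x] by (auto simp: W_def)
    ultimately obtain B where B: "finite B" "B \<subseteq> W" "pairwise orthogonal B" "\<forall>b\<in>B. norm b = 1"
      "span B = W" "\<forall>b\<in>B. \<exists>\<mu>. A *v b = \<mu> *\<^sub>R b"
      using less.hyps W by blast
    have "span (insert v B) = V"
    proof
      show "span (insert v B) \<subseteq> V"
        using B(2) WV v(1) less.prems(1) by (intro span_minimal) auto
      show "V \<subseteq> span (insert v B)"
      proof
        fix x assume x: "x \<in> V"
        have "x - (v \<bullet> x) *\<^sub>R v \<in> W"
          using x v less.prems(1) vv
          by (auto simp: W_def subspace_diff subspace_scale inner_diff_right)
        then have "x - (v \<bullet> x) *\<^sub>R v \<in> span B" using B by simp
        then show "x \<in> span (insert v B)" using span_insert by blast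
      qed
    qed
    then show ?thesis
      using B v WV by (intro exI[of _ "insert v B"])
        (auto simp: pairwise_insert orthogonal_def W_def inner_commute)
  qed
qed

text \<open>In an orthonormal eigenbasis the root is diagonal, with the square roots of the
  eigenvalues as entries; positivity of the eigenvalues makes it positive definite.\<close>

lemma sym_pos_def_sqrt_exists:
  fixes A :: "real ^ 'a ^ 'a"
  assumes A: "sym_pos_def A"
  shows "\<exists>S. sym_pos_def S \<and> S ** S = A"
proof -
  have sym: "transpose A = A" and pos: "\<And>x. x \<noteq> 0 \<Longrightarrow> x \<bullet> (A *v x) > 0"
    using A by (auto simp: sym_pos_def_def)
  obtain B where B: "finite B" "pairwise orthogonal B" "\<And>b. b \<in> B \<Longrightarrow> norm b = 1"
      "span B = UNIV" and ev: "\<forall>b\<in>B. \<exists>\<mu>. A *v b = \<mu> *\<^sub>R b"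
    using symmetric_matrix_eigenbasis[OF sym subspace_UNIV] by auto
  from ev obtain \<mu> where \<mu>: "\<And>b. b \<in> B \<Longrightarrow> A *v b = \<mu> b *\<^sub>R b"
    by metis
  have orth: "b \<bullet> b' = (if b = b' then 1 else 0)" if "b \<in> B" "b' \<in> B" for b b'
    using that B(2,3) by (auto simp: pairwise_def orthogonal_def norm_eq_1)
  have \<mu>pos: "\<mu> b > 0" if "b \<in> B" for b
  proof -
    have "b \<noteq> 0" using B(3)[OF that] by auto
    from pos[OF this] show ?thesis using \<mu>[OF that] orth[OF that that] by simp
  qed
  \<comment> \<open>The difference is orthogonal to every basis vector, hence to the whole space and
    to itself.\<close>
  have expand: "x = (\<Sum>b\<in>B. (b \<bullet> x) *\<^sub>R b)" for x
  proof -
    have "x - (\<Sum>b\<in>B. (b \<bullet> x) *\<^sub>R b) = 0"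
    proof -
      have "orthogonal (x - (\<Sum>b\<in>B. (b \<bullet> x) *\<^sub>R b)) y" for y
      proof (rule orthogonal_to_span[of y B])
        show "y \<in> span B" using B by simp
        show "orthogonal (x - (\<Sum>b\<in>B. (b \<bullet> x) *\<^sub>R b)) b'" if "b' \<in> B" for b'
          using that B(1) by (simp add: orthogonal_def inner_diff_left inner_sum_left orth if_distrib
              cong: if_cong) (simp add: inner_commute)
      qed
      then show ?thesis by (simp add: orthogonal_self[symmetric])
    qed
    then show ?thesis by simp
  qed
  define s where "s = (\<lambda>x. \<Sum>b\<in>B. (sqrt (\<mu> b) * (b \<bullet> x)) *\<^sub>R b)"
  have lin: "linear s"
    unfolding s_def by (intro linear_compose_sum ballI)
      (auto intro!: linearI simp: inner_add_right algebra_simps)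
  have sv: "matrix s *v x = s x" for x
    using lin by (simp add: matrix_works)
  have bs: "b \<bullet> s x = sqrt (\<mu> b) * (b \<bullet> x)" if "b \<in> B" for b x
    using that B(1) by (simp add: s_def inner_sum_right orth if_distrib cong: if_cong)
  have xs: "y \<bullet> s x = (\<Sum>b\<in>B. sqrt (\<mu> b) * (b \<bullet> x) * (b \<bullet> y))" for x y
    by (simp add: s_def inner_sum_right inner_commute)
  have "transpose (matrix s) = matrix s"
    by (rule symmetric_matrixI) (subst (2) inner_commute, simp add: sv xs mult.commute mult.left_commute)
  moreover have "x \<bullet> (matrix s *v x) > 0" if "x \<noteq> 0" for x
  proof -
    have nn: "sqrt (\<mu> b) * (b \<bullet> x) * (b \<bullet> x) \<ge> 0" if "b \<in> B" for b
      using \<mu>pos[OF that] by (simp add: mult.assoc)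
    obtain b where "b \<in> B" "b \<bullet> x \<noteq> 0"
      using expand[of x] \<open>x \<noteq> 0\<close> by (metis (no_types, lifting) scaleR_eq_0_iff sum.neutral)
    then have "sqrt (\<mu> b) * (b \<bullet> x) * (b \<bullet> x) > 0"
      using \<mu>pos by (auto simp: mult.assoc zero_less_mult_iff linorder_neq_iff)
    then show ?thesis
      unfolding sv xs using \<open>b \<in> B\<close> B(1) nn by (intro sum_pos2[of B b]) auto
  qed
  moreover have "matrix s ** matrix s = A"
  proof -
    have "s (s x) = A *v x" for x
    proof -
      have "A *v x = (\<Sum>b\<in>B. (b \<bullet> x) *\<^sub>R (A *v b))"
        by (subst expand[of x]) (simp add: matrix_vector_mult_scaleR
            linear_sum[OF matrix_vector_mul_linear])
      also have "\<dots> = s (s x)"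
        by (subst (1) s_def) (intro sum.cong, auto simp: bs \<mu> \<mu>pos less_imp_le)
      finally show ?thesis by simp
    qed
    then have "(matrix s ** matrix s) *v x = A *v x" for x
      by (simp only: sv matrix_vector_mul_assoc[symmetric])
    then show ?thesis
      by (simp add: matrix_eq)
  qed
  ultimately show ?thesis
    unfolding sym_pos_def_def by blast
qed

lemma sym_pos_def_matrix_inv:
  fixes A :: "real ^ 'a ^ 'a"
  assumes A: "sym_pos_def A"
  shows "invertible A" "sym_pos_def (matrix_inv A)"
proof -
  have sym: "transpose A = A" and pos: "\<And>x. x \<noteq> 0 \<Longrightarrow> x \<bullet> (A *v x) > 0"
    using A by (auto simp: sym_pos_def_def)
  have "x = 0" if "A *v x = 0" for x
    using pos[of x] that by force
  then show inv: "invertible A"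
    using invertible_left_inverse matrix_left_invertible_ker by blast
  have AA: "A *v (matrix_inv A *v x) = x" for x
    by (simp only: matrix_vector_mul_assoc matrix_inv_cancel(1)[OF inv] matrix_vector_mul_lid)
  have "transpose (matrix_inv A) = matrix_inv A"
  proof (rule symmetric_matrixI)
    show "x \<bullet> (matrix_inv A *v y) = (matrix_inv A *v x) \<bullet> y" for x y
      using symmetric_matrix_adjoint[OF sym, of "matrix_inv A *v x" "matrix_inv A *v y"]
      by (simp add: AA)
  qed
  moreover have "x \<bullet> (matrix_inv A *v x) > 0" if "x \<noteq> 0" for x
  proof -
    have "matrix_inv A *v x \<noteq> 0" using AA[of x] that by auto
    from pos[OF this] show ?thesis by (simp add: AA inner_commute)
  qed
  ultimately show "sym_pos_def (matrix_inv A)"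
    by (simp add: sym_pos_def_def)
qed

text \<open>Existence of a root of the inverse makes the choice in \<open>inv_sqrt_mat\<close>
  meaningful. Everything said later about whitening goes through these two properties.\<close>

lemma inv_sqrt_mat:
  fixes A :: "real ^ 'a ^ 'a"
  assumes A: "sym_pos_def A"
  shows "sym_pos_def (inv_sqrt_mat A)" "inv_sqrt_mat A ** inv_sqrt_mat A = matrix_inv A"
  using someI_ex[OF sym_pos_def_sqrt_exists[OF sym_pos_def_matrix_inv(2)[OF A]]]
  unfolding inv_sqrt_mat_def by auto

section \<open>Projection decoders\<close>

text \<open>\<open>orth_proj\<close> is a definite description, so the orthogonal decomposition has
  to be shown to exist and to be unique. In finite dimension the double complement of a subspace is
  the subspace itself, which places the residual in \<open>W\<close>.\<close>

lemma orth_proj_orthogonal_comp: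
  fixes W :: "'a::euclidean_space set"
  assumes "subspace W"
  shows "orth_proj (orthogonal_comp W) y \<in> orthogonal_comp W"
    "y - orth_proj (orthogonal_comp W) y \<in> W"
proof -
  have "\<exists>!p. p \<in> orthogonal_comp W \<and> y - p \<in> orthogonal_comp (orthogonal_comp W)"
  proof (rule ex_ex1I)
    obtain a b where "a \<in> span W" "\<And>w. w \<in> span W \<Longrightarrow> orthogonal b w" "y = a + b"
      using orthogonal_subspace_decomp_exists[of W y] by blast
    then show "\<exists>p. p \<in> orthogonal_comp W \<and> y - p \<in> orthogonal_comp (orthogonal_comp W)"
      using assms by (intro exI[of _ b])
        (auto simp: orthogonal_comp_self orthogonal_comp_def span_eq_iff[THEN iffD2] orthogonal_commute)
  next
    fix p q
    assume p: "p \<in> orthogonal_comp W \<and> y - p \<in> orthogonal_comp (orthogonal_comp W)"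
      and q: "q \<in> orthogonal_comp W \<and> y - q \<in> orthogonal_comp (orthogonal_comp W)"
    \<comment> \<open>The vector \<open>p - q\<close> lies in the complement and, written as a
      difference of residuals, in the double complement; it is therefore orthogonal to
      itself.\<close>
    have *: "p - q \<in> orthogonal_comp W" "(y - q) - (y - p) \<in> orthogonal_comp (orthogonal_comp W)"
      by (rule subspace_diff[OF subspace_orthogonal_comp]; use p q in blast)+
    then have "orthogonal (p - q) (p - q)"
      by (auto simp: orthogonal_comp_def[of "orthogonal_comp W"])
    then show "p = q" by (simp add: orthogonal_self)
  qed
  from theI'[OF this] show "orth_proj (orthogonal_comp W) y \<in> orthogonal_comp W"
    "y - orth_proj (orthogonal_comp W) y \<in> W"
    unfolding orth_proj_def using assms by (auto simp: orthogonal_comp_self)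
qed

lemma span_columns_eq:
  fixes G :: "real ^ 'k ^ 'm"
  assumes "w \<in> span {column i G | i. Q i}"
  obtains u where "\<And>i. \<not> Q i \<Longrightarrow> u $ i = 0" "w = G *v u"
proof -
  have "\<exists>u. (\<forall>i. \<not> Q i \<longrightarrow> u $ i = 0) \<and> w = G *v u"
    using assms
  proof (induction rule: span_induct_alt)
    case base
    show ?case by (intro exI[of _ 0]) auto
  next
    case (step c x y)
    then obtain i u where "x = column i G" "Q i" "\<forall>i. \<not> Q i \<longrightarrow> u $ i = 0" "y = G *v u"
      by auto
    then have "c *\<^sub>R x + y = G *v (c *\<^sub>R axis i 1 + u)"
      by (simp add: matrix_vector_right_distrib matrix_vector_mult_scaleR matrix_vector_mult_basis)
    moreover have "\<not> Q i' \<longrightarrow> (c *\<^sub>R axis i 1 + u) $ i' = 0" for i'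
      using \<open>Q i\<close> \<open>\<forall>i. \<not> Q i \<longrightarrow> u $ i = 0\<close> by (auto simp: axis_def)
    ultimately show ?case by blast
  qed
  then show ?thesis using that by blast
qed

text \<open>Projecting subtracts a combination of columns from \<open>Q\<close> only, so the
  coefficient of column \<open>i\<close> remains 1. This yields \<open>norm u \<ge> 1\<close>
  whatever \<open>Q\<close> is, which is the form in which the rank condition is applied.\<close>

lemma projected_column:
  fixes G :: "real ^ 'k ^ 'm" and Q :: "'k \<Rightarrow> bool"
  assumes i: "\<not> Q i"
  obtains u where "u $ i = 1"
    "orth_proj (orthogonal_comp (span {column i' G | i'. Q i'})) (column i G) = G *v u"
proof -
  let ?q = "orth_proj (orthogonal_comp (span {column i' G | i'. Q i'})) (column i G)"
  obtain u where u: "\<And>i. \<not> Q i \<Longrightarrow> u $ i = 0" "column i G - ?q = G *v u"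
    using span_columns_eq[of "column i G - ?q" G Q] orth_proj_orthogonal_comp(2)[OF subspace_span] by blast
  have "?q = G *v (axis i 1 - u)" "(axis i 1 - u) $ i = 1"
    using u(1)[OF i] u(2)
    by (auto simp: matrix_vector_mult_diff_distrib matrix_vector_mult_basis algebra_simps)
  then show ?thesis using that by blast
qed

text \<open>Replacing the true symbol \<open>x\<close> by \<open>b\<close> changes the squared
  distance by a linear term in \<open>q \<bullet> e\<close> and the quadratic term
  \<open>(x - b)\<^sup>2 * (norm q)\<^sup>2\<close>. If \<open>b\<close> is at least as good, the
  noise must compensate the quadratic term. The vector \<open>w\<close> is interference that the
  projection removes. The conclusion is not divided by \<open>norm q\<close>, so the degenerate
  direction \<open>q = 0\<close> is covered.\<close>

lemma projected_decision_error:
  fixes G :: "real ^ 'k ^ 'm" and n :: "real ^ 'm" and Q :: "'k \<Rightarrow> bool"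
  defines "W \<equiv> span {column i' G | i'. Q i'}"
  defines "p \<equiv> orth_proj (orthogonal_comp W)"
  assumes w: "w \<in> W" and \<delta>: "0 \<le> \<delta>" "\<delta> \<le> \<bar>x - b\<bar>"
    and le: "(norm (p (x *\<^sub>R column i G + w + n) - b *\<^sub>R p (column i G)))\<^sup>2
          \<le> (norm (p (x *\<^sub>R column i G + w + n) - x *\<^sub>R p (column i G)))\<^sup>2"
    and "b \<noteq> x"
  shows "\<delta> / 2 * (norm (p (column i G)))\<^sup>2 \<le> \<bar>p (column i G) \<bullet> n\<bar>"
proof -
  have W: "subspace W" by (simp add: W_def)
  define q where "q = p (column i G)"
  define y where "y = x *\<^sub>R column i G + w + n"
  define e where "e = p y - x *\<^sub>R q"
  have q: "q \<in> orthogonal_comp W" "column i G - q \<in> W"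
    and y: "p y \<in> orthogonal_comp W" "y - p y \<in> W"
    unfolding q_def p_def using orth_proj_orthogonal_comp[OF W] by auto
  \<comment> \<open>All three vectors lie in \<open>W\<close>, and their combination is
    \<open>n - e\<close>. Since \<open>q\<close> is orthogonal to \<open>W\<close>, the residual
    \<open>e\<close> and the noise \<open>n\<close> have the same component along
    \<open>q\<close>.\<close>
  have "(y - p y) - x *\<^sub>R (column i G - q) - w \<in> W"
    using W q y w by (blast intro: subspace_diff subspace_scale)
  then have "n - e \<in> W"
    by (simp add: y_def e_def algebra_simps)
  then have "q \<bullet> (n - e) = 0"
    using q by (auto simp: orthogonal_comp_def orthogonal_def inner_commute)
  then have qn: "q \<bullet> n = q \<bullet> e"
    by (simp add: inner_diff_right)
  have "(norm (e + (x - b) *\<^sub>R q))\<^sup>2 \<le> (norm e)\<^sup>2"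
    using le unfolding y_def[symmetric] q_def[symmetric] by (simp add: e_def algebra_simps)
  moreover have "(norm (e + c *\<^sub>R q))\<^sup>2 = (norm e)\<^sup>2 + 2 * c * (q \<bullet> e) + c\<^sup>2 * (norm q)\<^sup>2" for c
    unfolding power2_norm_eq_inner
    by (simp add: inner_add_left inner_add_right inner_commute[of e q] power2_eq_square
        algebra_simps)
  ultimately have "(x - b)\<^sup>2 * (norm q)\<^sup>2 \<le> - (2 * (x - b) * (q \<bullet> e))"
    by simp
  also have "\<dots> \<le> \<bar>2 * (x - b) * (q \<bullet> e)\<bar>"
    by linarith
  also have "\<dots> = 2 * \<bar>x - b\<bar> * \<bar>q \<bullet> n\<bar>"
    unfolding qn abs_mult by simp
  also have "(x - b)\<^sup>2 = \<bar>x - b\<bar> * \<bar>x - b\<bar>"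
    by (simp add: power2_eq_square)
  finally have "\<bar>x - b\<bar> * (\<bar>x - b\<bar> * (norm q)\<^sup>2) \<le> \<bar>x - b\<bar> * (2 * \<bar>q \<bullet> n\<bar>)"
    by (simp add: mult_ac)
  then have "\<bar>x - b\<bar> * (norm q)\<^sup>2 \<le> 2 * \<bar>q \<bullet> n\<bar>"
    using \<open>b \<noteq> x\<close> by (simp add: mult_le_cancel_left_pos)
  moreover have "\<delta> * (norm q)\<^sup>2 \<le> \<bar>x - b\<bar> * (norm q)\<^sup>2"
    using \<delta> by (intro mult_right_mono) auto
  ultimately show ?thesis unfolding q_def[symmetric] by simp
qed

section \<open>Error events of zero forcing and of successive cancellation\<close>

lemma matrix_vector_mult_split_column:
  fixes G :: "real ^ 'k ^ 'm"
  shows "G *v x = x $ i *\<^sub>R column i G + (\<Sum>j\<in>-{i}. x $ j *\<^sub>R column j G)"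
  by (simp add: matrix_mult_sum scalar_mult_eq_scaleR sum.remove[of UNIV i] Compl_eq_Diff_UNIV)

text \<open>Any wrongly decoded symbol \<open>i\<close> serves: all other columns lie in the
  subspace that is projected out, so the decision on \<open>i\<close> is unaffected by the other
  symbols.\<close>

lemma zf_error:
  fixes G :: "real ^ 'k ^ 'm"
  assumes dec: "zf_output \<A> G (G *v x + n) xh" and x: "\<And>i. x $ i \<in> \<A> i" and "xh \<noteq> x"
    and \<delta>: "0 \<le> \<delta>" "\<And>i a b. a \<in> \<A> i \<Longrightarrow> b \<in> \<A> i \<Longrightarrow> a \<noteq> b \<Longrightarrow> \<delta> \<le> \<bar>a - b\<bar>"
  shows "\<exists>i. \<delta> / 2 * (norm (zf_proj G i (column i G)))\<^sup>2 \<le> \<bar>zf_proj G i (column i G) \<bullet> n\<bar>"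
proof -
  obtain i where i: "xh $ i \<noteq> x $ i"
    using \<open>xh \<noteq> x\<close> by (auto simp: vec_eq_iff)
  let ?w = "\<Sum>j\<in>-{i}. x $ j *\<^sub>R column j G"
  have min: "xh $ i \<in> \<A> i"
    "\<not> (norm (zf_proj G i (G *v x + n) - x $ i *\<^sub>R zf_proj G i (column i G)))\<^sup>2
      < (norm (zf_proj G i (G *v x + n) - xh $ i *\<^sub>R zf_proj G i (column i G)))\<^sup>2"
    using dec x[of i] unfolding zf_output_def is_arg_min_def by blast+
  have "?w \<in> span {column i' G | i'. i' \<noteq> i}"
    by (intro span_sum span_scale span_base) auto
  then show ?thesis
    using projected_decision_error[of ?w G "\<lambda>i'. i' \<noteq> i" \<delta> "x $ i" "xh $ i" i n] i min x[of i] \<delta>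
    unfolding matrix_vector_mult_split_column[of G x i] zf_proj_def by (auto simp: not_less)
qed

text \<open>Each correct decision removes one summand from the column expansion of
  \<open>G *v x\<close>; injectivity of \<open>\<sigma>\<close> ensures that this summand is still
  present at its stage.\<close>

lemma sic_residual_correct:
  fixes G :: "real ^ 'k ^ 'm"
  assumes "inj_on \<sigma> {..<k}" and "\<And>m. m < k \<Longrightarrow> xh $ \<sigma> m = x $ \<sigma> m"
  shows "sic_residual G \<sigma> (G *v x + n) xh k = (\<Sum>j\<in>-\<sigma> ` {..<k}. x $ j *\<^sub>R column j G) + n"
  using assms
proof (induction k)
  case 0
  show ?case by (simp add: matrix_mult_sum scalar_mult_eq_scaleR)
next
  case (Suc k)
  have "\<sigma> k \<notin> \<sigma> ` {..<k}"
    using inj_on_image_mem_iff[OF Suc.prems(1), of k "{..<k}"] by auto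
  then have "(\<Sum>j\<in>-\<sigma> ` {..<k}. x $ j *\<^sub>R column j G) =
      x $ \<sigma> k *\<^sub>R column (\<sigma> k) G + (\<Sum>j\<in>-\<sigma> ` {..<k} - {\<sigma> k}. x $ j *\<^sub>R column j G)"
    by (intro sum.remove) auto
  moreover have "-\<sigma> ` {..<k} - {\<sigma> k} = -\<sigma> ` {..<Suc k}"
    by (auto simp: lessThan_Suc)
  moreover have "sic_residual G \<sigma> (G *v x + n) xh k = (\<Sum>j\<in>-\<sigma> ` {..<k}. x $ j *\<^sub>R column j G) + n"
    using Suc.prems by (intro Suc.IH) (auto simp: lessThan_Suc)
  ultimately show ?case
    using Suc.prems(2)[of k] by simp
qed

text \<open>At the first wrong stage all earlier cancellations were exact, so the residual contains
  no propagated error. The remaining interference comes from later stages, and exactly their columns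
  are projected out.\<close>

lemma zf_sic_error:
  fixes G :: "real ^ 'k ^ 'm"
  assumes dec: "zf_sic_output \<sigma> \<A> G (G *v x + n) xh" and \<sigma>: "bij_betw \<sigma> {..<CARD('k)} UNIV"
    and x: "\<And>i. x $ i \<in> \<A> i" and "xh \<noteq> x"
    and \<delta>: "0 \<le> \<delta>" "\<And>i a b. a \<in> \<A> i \<Longrightarrow> b \<in> \<A> i \<Longrightarrow> a \<noteq> b \<Longrightarrow> \<delta> \<le> \<bar>a - b\<bar>"
  shows "\<exists>k<CARD('k). \<delta> / 2 * (norm (sic_proj G \<sigma> k (column (\<sigma> k) G)))\<^sup>2
    \<le> \<bar>sic_proj G \<sigma> k (column (\<sigma> k) G) \<bullet> n\<bar>"
proof -
  let ?wrong = "\<lambda>k. k < CARD('k) \<and> xh $ \<sigma> k \<noteq> x $ \<sigma> k"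
  obtain j where "xh $ j \<noteq> x $ j"
    using \<open>xh \<noteq> x\<close> by (auto simp: vec_eq_iff)
  moreover obtain k' where "k' < CARD('k)" "\<sigma> k' = j"
    using \<sigma> by (metis UNIV_I bij_betw_iff_bijections lessThan_iff)
  ultimately have "?wrong k'" by auto
  define k where "k = (LEAST k. ?wrong k)"
  have k: "k < CARD('k)" "xh $ \<sigma> k \<noteq> x $ \<sigma> k"
    using LeastI[of ?wrong, OF \<open>?wrong k'\<close>] by (auto simp: k_def)
  have before: "xh $ \<sigma> m = x $ \<sigma> m" if "m < k" for m
    using not_less_Least[of m ?wrong] that k by (auto simp: k_def)
  have inj: "inj_on \<sigma> {..<CARD('k)}" using \<sigma> by (simp add: bij_betw_def)
  let ?Q = "\<lambda>j. \<exists>m. j = \<sigma> m \<and> k < m \<and> m < CARD('k)"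
  let ?w = "\<Sum>j\<in>-\<sigma> ` {..<Suc k}. x $ j *\<^sub>R column j G"
  let ?y = "sic_residual G \<sigma> (G *v x + n) xh k"
  have res: "?y = x $ \<sigma> k *\<^sub>R column (\<sigma> k) G + ?w + n"
  proof -
    have "?y = (\<Sum>j\<in>-\<sigma> ` {..<k}. x $ j *\<^sub>R column j G) + n"
      using before inj k by (intro sic_residual_correct) (auto intro: inj_on_subset)
    also have "(\<Sum>j\<in>-\<sigma> ` {..<k}. x $ j *\<^sub>R column j G) =
        x $ \<sigma> k *\<^sub>R column (\<sigma> k) G + (\<Sum>j\<in>-\<sigma> ` {..<k} - {\<sigma> k}. x $ j *\<^sub>R column j G)"
      using inj_on_image_mem_iff[OF inj, of k "{..<k}"] k by (intro sum.remove) auto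
    also have "-\<sigma> ` {..<k} - {\<sigma> k} = -\<sigma> ` {..<Suc k}"
      by (auto simp: lessThan_Suc)
    finally show ?thesis .
  qed
  have set: "{column (\<sigma> m) G | m. k < m \<and> m < CARD('k)} = {column j G | j. ?Q j}"
    by blast
  have "?Q j" if "j \<in> -\<sigma> ` {..<Suc k}" for j
  proof -
    obtain m where "m < CARD('k)" "\<sigma> m = j"
      using \<sigma> by (metis UNIV_I bij_betw_iff_bijections lessThan_iff)
    then show ?thesis using that by (intro exI[of _ m]) auto
  qed
  then have w: "?w \<in> span {column j G | j. ?Q j}"
    by (intro span_sum span_scale span_base) blast
  have min: "xh $ \<sigma> k \<in> \<A> (\<sigma> k)"
    "\<not> (norm (sic_proj G \<sigma> k ?y - x $ \<sigma> k *\<^sub>R sic_proj G \<sigma> k (column (\<sigma> k) G)))\<^sup>2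
      < (norm (sic_proj G \<sigma> k ?y - xh $ \<sigma> k *\<^sub>R sic_proj G \<sigma> k (column (\<sigma> k) G)))\<^sup>2"
    using dec x[of "\<sigma> k"] k unfolding zf_sic_output_def is_arg_min_def by blast+
  have "\<delta> / 2 * (norm (sic_proj G \<sigma> k (column (\<sigma> k) G)))\<^sup>2
      \<le> \<bar>sic_proj G \<sigma> k (column (\<sigma> k) G) \<bullet> n\<bar>"
    using min unfolding sic_proj_def set res not_less
    by (intro projected_decision_error[OF w \<delta>(1) \<delta>(2)[OF x]]) (use k in auto)
  then show ?thesis using k by blast
qed

text \<open>
  The directions \<open>G *v U i\<close> may depend on the channel but not on the noise, so that given the gains
  the noise components along them are Gaussian.
\<close>

definition noise_directed :: "('k \<Rightarrow> real set) \<Rightarrow> (real ^ 'k ^ 'm \<Rightarrow> real ^ 'm \<Rightarrow> real ^ 'k \<Rightarrow> bool) \<Rightarrow> bool" where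
  "noise_directed \<A> out \<longleftrightarrow> (\<forall>\<delta>\<ge>0. (\<forall>i. \<forall>a\<in>\<A> i. \<forall>b\<in>\<A> i. a \<noteq> b \<longrightarrow> \<delta> \<le> \<bar>a - b\<bar>) \<longrightarrow>
     (\<forall>G. \<exists>U. (\<forall>i. U i $ i = 1) \<and>
       (\<forall>x n xh. (\<forall>i. x $ i \<in> \<A> i) \<longrightarrow> out G (G *v x + n) xh \<longrightarrow> xh \<noteq> x \<longrightarrow>
         (\<exists>i. \<delta> / 2 * (norm (G *v U i))\<^sup>2 \<le> \<bar>(G *v U i) \<bullet> n\<bar>))))"

lemma noise_directed_zf: "noise_directed \<A> (zf_output \<A>)"
  unfolding noise_directed_def
proof (intro allI impI)
  fix \<delta> :: real and G :: "real ^ 'a ^ 'b"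
  assume \<delta>: "0 \<le> \<delta>" "\<forall>i. \<forall>a\<in>\<A> i. \<forall>b\<in>\<A> i. a \<noteq> b \<longrightarrow> \<delta> \<le> \<bar>a - b\<bar>"
  have "\<forall>i. \<exists>u. u $ i = 1 \<and> zf_proj G i (column i G) = G *v u"
  proof
    fix i
    show "\<exists>u. u $ i = 1 \<and> zf_proj G i (column i G) = G *v u"
      using projected_column[of "\<lambda>i'. i' \<noteq> i" i G] unfolding zf_proj_def by blast
  qed
  from choice[OF this] obtain U where U: "\<And>i. U i $ i = 1" "\<And>i. zf_proj G i (column i G) = G *v U i"
    by blast
  show "\<exists>U. (\<forall>i. U i $ i = 1) \<and>
       (\<forall>x n xh. (\<forall>i. x $ i \<in> \<A> i) \<longrightarrow> zf_output \<A> G (G *v x + n) xh \<longrightarrow> xh \<noteq> x \<longrightarrow>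
         (\<exists>i. \<delta> / 2 * (norm (G *v U i))\<^sup>2 \<le> \<bar>(G *v U i) \<bullet> n\<bar>))"
    using zf_error[where \<A>=\<A> and G=G and \<delta>=\<delta>] \<delta> U by (intro exI[of _ U]) simp
qed

lemma noise_directed_zf_sic:
  fixes \<A> :: "'k::finite \<Rightarrow> real set"
  assumes \<sigma>: "bij_betw \<sigma> {..<CARD('k)} (UNIV :: 'k set)"
  shows "noise_directed \<A> (zf_sic_output \<sigma> \<A>)"
  unfolding noise_directed_def
proof (intro allI impI)
  fix \<delta> :: real and G :: "real ^ 'k ^ 'b"
  assume \<delta>: "0 \<le> \<delta>" "\<forall>i. \<forall>a\<in>\<A> i. \<forall>b\<in>\<A> i. a \<noteq> b \<longrightarrow> \<delta> \<le> \<bar>a - b\<bar>"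
  \<comment> \<open>Directions are indexed by symbols, whereas SIC is indexed by stages. Quantifying
    over the stages that decode symbol \<open>i\<close>, of which there is one, makes the statement
    fit for a choice over \<open>i\<close>.\<close>
  have "\<forall>i. \<exists>u. u $ i = 1 \<and> (\<forall>k<CARD('k). \<sigma> k = i \<longrightarrow> sic_proj G \<sigma> k (column i G) = G *v u)"
  proof
    fix i
    obtain k where k: "k < CARD('k)" "\<sigma> k = i"
      using \<sigma> by (metis UNIV_I bij_betw_iff_bijections lessThan_iff)
    have inj: "inj_on \<sigma> {..<CARD('k)}" using \<sigma> by (simp add: bij_betw_def)
    let ?Q = "\<lambda>j. \<exists>m. j = \<sigma> m \<and> k < m \<and> m < CARD('k)"
    have "\<not> ?Q i"
      using inj_onD[OF inj, of k] k by auto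
    from projected_column[of ?Q i G, OF this] obtain u where "u $ i = 1"
      "orth_proj (orthogonal_comp (span {column i' G | i'. ?Q i'})) (column i G) = G *v u" by blast
    moreover have "{column (\<sigma> m) G | m. k < m \<and> m < CARD('k)} = {column i' G | i'. ?Q i'}"
      by blast
    ultimately have "sic_proj G \<sigma> k (column i G) = G *v u"
      by (simp add: sic_proj_def)
    then show "\<exists>u. u $ i = 1 \<and> (\<forall>k<CARD('k). \<sigma> k = i \<longrightarrow> sic_proj G \<sigma> k (column i G) = G *v u)"
      using \<open>u $ i = 1\<close> inj_onD[OF inj] k by (metis lessThan_iff)
  qed
  from choice[OF this] obtain U where U: "\<And>i. U i $ i = 1"
    "\<And>k. k < CARD('k) \<Longrightarrow> sic_proj G \<sigma> k (column (\<sigma> k) G) = G *v U (\<sigma> k)"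
    by blast
  show "\<exists>U. (\<forall>i. U i $ i = 1) \<and>
       (\<forall>x n xh. (\<forall>i. x $ i \<in> \<A> i) \<longrightarrow> zf_sic_output \<sigma> \<A> G (G *v x + n) xh \<longrightarrow> xh \<noteq> x \<longrightarrow>
         (\<exists>i. \<delta> / 2 * (norm (G *v U i))\<^sup>2 \<le> \<bar>(G *v U i) \<bullet> n\<bar>))"
  proof (intro exI[of _ U] conjI allI impI U)
    fix x n xh
    assume "\<forall>i. x $ i \<in> \<A> i" "zf_sic_output \<sigma> \<A> G (G *v x + n) xh" "xh \<noteq> x"
    then obtain k where "k < CARD('k)" "\<delta> / 2 * (norm (sic_proj G \<sigma> k (column (\<sigma> k) G)))\<^sup>2
        \<le> \<bar>sic_proj G \<sigma> k (column (\<sigma> k) G) \<bullet> n\<bar>"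
      using zf_sic_error[of \<sigma> \<A> G x n xh \<delta>] \<sigma> \<delta> by auto
    then show "\<exists>i. \<delta> / 2 * (norm (G *v U i))\<^sup>2 \<le> \<bar>(G *v U i) \<bullet> n\<bar>"
      using U(2) by auto
  qed
qed

section \<open>Complex Gaussian families\<close>

text \<open>Independence turns the joint law into a product, and Tonelli applies. The inner integral
  over a second sample point plays the part of a conditional expectation given
  \<open>X\<close>.\<close>

lemma (in prob_space) nn_integral_indep_var:
  assumes ind: "indep_var S X T Y" and F [measurable]: "F \<in> borel_measurable (S \<Otimes>\<^sub>M T)"
  shows "(\<integral>\<^sup>+\<omega>. F (X \<omega>, Y \<omega>) \<partial>M) = (\<integral>\<^sup>+\<omega>. (\<integral>\<^sup>+\<omega>'. F (X \<omega>, Y \<omega>') \<partial>M) \<partial>M)"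
proof -
  have [measurable]: "random_variable S X" "random_variable T Y"
    and distr: "distr M S X \<Otimes>\<^sub>M distr M T Y = distr M (S \<Otimes>\<^sub>M T) (\<lambda>x. (X x, Y x))"
    using ind unfolding indep_var_distribution_eq by auto
  interpret Y: prob_space "distr M T Y" by (rule prob_space_distr) simp
  have "(\<integral>\<^sup>+\<omega>. F (X \<omega>, Y \<omega>) \<partial>M) = (\<integral>\<^sup>+z. F z \<partial>(distr M S X \<Otimes>\<^sub>M distr M T Y))"
    unfolding distr by (subst nn_integral_distr) auto
  also have "\<dots> = (\<integral>\<^sup>+x. \<integral>\<^sup>+y. F (x, y) \<partial>distr M T Y \<partial>distr M S X)"
    by (subst Y.nn_integral_fst[symmetric]) auto
  also have "\<dots> = (\<integral>\<^sup>+\<omega>. \<integral>\<^sup>+y. F (X \<omega>, y) \<partial>distr M T Y \<partial>M)"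
    by (subst nn_integral_distr) auto
  also have "\<dots> = (\<integral>\<^sup>+\<omega>. (\<integral>\<^sup>+\<omega>'. F (X \<omega>, Y \<omega>') \<partial>M) \<partial>M)"
    by (intro nn_integral_cong, subst nn_integral_distr) (auto dest: measurable_space)
  finally show ?thesis .
qed

text \<open>This is conditioning on the variables in \<open>A\<close>: they are frozen at
  \<open>\<omega>\<close> while the others are drawn afresh at \<open>\<omega>'\<close>. It is
  applied twice below, with different \<open>A\<close>: once to separate gains from noises, once to
  separate the two hops.\<close>

lemma (in prob_space) nn_integral_resample:
  assumes ind: "indep_vars (\<lambda>_. N) X UNIV" and F: "F \<in> borel_measurable (PiM UNIV (\<lambda>_. N))"
  shows "(\<integral>\<^sup>+\<omega>. F (\<lambda>s. X s \<omega>) \<partial>M) =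
    (\<integral>\<^sup>+\<omega>. (\<integral>\<^sup>+\<omega>'. F (\<lambda>s. if s \<in> A then X s \<omega> else X s \<omega>') \<partial>M) \<partial>M)"
proof -
  let ?G = "\<lambda>z. F (merge A (-A) z)"
  have "merge A (-A) \<in> measurable (PiM A (\<lambda>_. N) \<Otimes>\<^sub>M PiM (-A) (\<lambda>_. N)) (PiM UNIV (\<lambda>_. N))"
    using measurable_merge[of A "-A" "\<lambda>_. N"] by (simp add: Compl_partition)
  from measurable_compose[OF this F]
  have "?G \<in> borel_measurable (PiM A (\<lambda>_. N) \<Otimes>\<^sub>M PiM (-A) (\<lambda>_. N))" .
  from nn_integral_indep_var[OF indep_var_restrict[OF ind, of A "-A"] this]
  show ?thesis
    by (simp add: merge_def if_distrib cong: if_cong)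
qed

text \<open>Completing the square against the density, which is proportional to
  \<open>exp (- x\<^sup>2)\<close>, leaves another normal density; \<open>a > -1\<close> is the
  range of convergence. The case \<open>a = 0\<close> serves the tail bound, \<open>t = 0\<close>
  serves the averages over the gains, and negative \<open>a\<close> arises there from the weights
  \<open>exp (x j / 2)\<close>.\<close>

lemma (in prob_space) nn_integral_exp_normal:
  assumes X: "distributed M lborel X (normal_density 0 (sqrt (1 / 2)))" and a: "a > -1"
  shows "(\<integral>\<^sup>+\<omega>. ennreal (exp (t * X \<omega> - a * (X \<omega>)\<^sup>2)) \<partial>M) =
    ennreal (exp (t\<^sup>2 / (4 * (1 + a))) / sqrt (1 + a))"
proof -
  define b where "b = 1 + a"
  have b: "b > 0" "1 + a = b" "a = b - 1" using a by (auto simp: b_def)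
  \<comment> \<open>With \<open>b = 1 + a\<close> the exponent is
    \<open>t * x - b * x\<^sup>2\<close>, so the new density has centre \<open>?m\<close> and
    variance \<open>1 / (2 * b)\<close>; \<open>?C\<close> collects the constant of the completed
    square and the ratio of the normalisations.\<close>
  let ?m = "t / (2 * b)" and ?s = "1 / sqrt (2 * b)" and ?C = "exp (t\<^sup>2 / (4 * b)) / sqrt b"
  have s2: "2 * ?s\<^sup>2 = 1 / b"
    using b by (simp add: power_divide)
  have eq: "normal_density 0 (sqrt (1 / 2)) x * exp (t * x - a * x\<^sup>2) = ?C * normal_density ?m ?s x" for x
  proof -
    have ex: "- x\<^sup>2 + (t * x - a * x\<^sup>2) = t\<^sup>2 / (4 * b) + - (x - ?m)\<^sup>2 / (2 * ?s\<^sup>2)"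
      using b(1) unfolding s2 b(3) by (simp add: field_simps power2_eq_square)
    have "normal_density 0 (sqrt (1 / 2)) x * exp (t * x - a * x\<^sup>2)
        = 1 / sqrt pi * exp (- x\<^sup>2 + (t * x - a * x\<^sup>2))"
      by (simp add: normal_density_def power_divide mult_exp_exp)
    also have "\<dots> = 1 / sqrt pi * (exp (t\<^sup>2 / (4 * b)) * exp (- (x - ?m)\<^sup>2 / (2 * ?s\<^sup>2)))"
      unfolding ex exp_add ..
    also have "1 / sqrt pi = 1 / sqrt b * (1 / sqrt (2 * pi * ?s\<^sup>2))"
    proof -
      have "2 * pi * ?s\<^sup>2 = pi / b" using b(1) by (simp add: power_divide)
      then show ?thesis using b(1) by (simp add: real_sqrt_divide)
    qed
    finally show ?thesis
      by (simp add: normal_density_def)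
  qed
  have "(\<integral>\<^sup>+\<omega>. ennreal (exp (t * X \<omega> - a * (X \<omega>)\<^sup>2)) \<partial>M) =
      (\<integral>\<^sup>+x. ennreal (normal_density 0 (sqrt (1 / 2)) x) * ennreal (exp (t * x - a * x\<^sup>2)) \<partial>lborel)"
    by (rule distributed_nn_integral[OF X, symmetric]) measurable
  also have "\<dots> = (\<integral>\<^sup>+x. ennreal ?C * ennreal (normal_density ?m ?s x) \<partial>lborel)"
    using a by (intro nn_integral_cong) (simp add: ennreal_mult[symmetric] eq less_imp_le[OF b(1)])
  also have "\<dots> = ennreal ?C * (\<integral>\<^sup>+x. ennreal (normal_density ?m ?s x) \<partial>lborel)"
    by (rule nn_integral_cmult) measurable
  also have "(\<integral>\<^sup>+x. ennreal (normal_density ?m ?s x) \<partial>lborel) = 1"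
    using b(1) by (subst nn_integral_eq_integral) auto
  finally show ?thesis unfolding b(2) by simp
qed

text \<open>Real and imaginary part contribute one factor each; the two square roots multiply to
  \<open>1 / (1 + a)\<close>. For \<open>c = 0\<close> this is the Laplace transform of the
  exponential law of the squared modulus.\<close>

lemma (in prob_space) nn_integral_exp_complex_gaussian:
  assumes X: "std_complex_gaussian M X" and a: "a > -1"
  shows "(\<integral>\<^sup>+\<omega>. ennreal (exp (c \<bullet> X \<omega> - a * (norm (X \<omega>))\<^sup>2)) \<partial>M) =
    ennreal (exp ((norm c)\<^sup>2 / (4 * (1 + a))) / (1 + a))"
proof -
  have ind: "indep_var borel (\<lambda>\<omega>. Re (X \<omega>)) borel (\<lambda>\<omega>. Im (X \<omega>))"
    and Re: "distributed M lborel (\<lambda>\<omega>. Re (X \<omega>)) (normal_density 0 (sqrt (1 / 2)))"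
    and Im: "distributed M lborel (\<lambda>\<omega>. Im (X \<omega>)) (normal_density 0 (sqrt (1 / 2)))"
    using X by (auto simp: std_complex_gaussian_def)
  have [measurable]: "random_variable borel (\<lambda>\<omega>. Re (X \<omega>))" "random_variable borel (\<lambda>\<omega>. Im (X \<omega>))"
    using indep_var_rv1[OF ind] indep_var_rv2[OF ind] by auto
  let ?e = "\<lambda>t x. ennreal (exp (t * x - a * x\<^sup>2))"
  have "(\<integral>\<^sup>+\<omega>. ennreal (exp (c \<bullet> X \<omega> - a * (norm (X \<omega>))\<^sup>2)) \<partial>M) =
      (\<integral>\<^sup>+\<omega>. (\<lambda>(x, y). ?e (Re c) x * ?e (Im c) y) (Re (X \<omega>), Im (X \<omega>)) \<partial>M)"
    by (intro nn_integral_cong)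
      (simp add: inner_complex_def cmod_power2 ennreal_mult[symmetric] exp_add[symmetric] algebra_simps)
  also have "\<dots> = (\<integral>\<^sup>+\<omega>. (\<integral>\<^sup>+\<omega>'. ?e (Re c) (Re (X \<omega>)) * ?e (Im c) (Im (X \<omega>')) \<partial>M) \<partial>M)"
    by (subst nn_integral_indep_var[OF ind]) auto
  also have "\<dots> = (\<integral>\<^sup>+\<omega>. ?e (Re c) (Re (X \<omega>)) \<partial>M) * (\<integral>\<^sup>+\<omega>. ?e (Im c) (Im (X \<omega>)) \<partial>M)"
    by (subst nn_integral_cmult, measurable, subst nn_integral_multc) auto
  also have "\<dots> = ennreal (exp ((Re c)\<^sup>2 / (4 * (1 + a))) / sqrt (1 + a) *
      (exp ((Im c)\<^sup>2 / (4 * (1 + a))) / sqrt (1 + a)))"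
    using a unfolding nn_integral_exp_normal[OF Re a] nn_integral_exp_normal[OF Im a]
    by (simp add: ennreal_mult[symmetric])
  also have "\<dots> = ennreal (exp ((norm c)\<^sup>2 / (4 * (1 + a))) / (1 + a))"
    using a by (simp add: cmod_power2 add_divide_distrib exp_add)
  finally show ?thesis .
qed

lemma (in prob_space) nn_integral_exp_gaussian_family:
  assumes I: "finite I" and ind: "indep_vars (\<lambda>_. borel) X I"
    and X: "\<And>i. i \<in> I \<Longrightarrow> std_complex_gaussian M (X i)" and a: "\<And>i. i \<in> I \<Longrightarrow> a i > -1"
  shows "(\<integral>\<^sup>+\<omega>. ennreal (exp (\<Sum>i\<in>I. c i \<bullet> X i \<omega> - a i * (norm (X i \<omega>))\<^sup>2)) \<partial>M) =
    ennreal (\<Prod>i\<in>I. exp ((norm (c i))\<^sup>2 / (4 * (1 + a i))) / (1 + a i))"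
proof -
  let ?e = "\<lambda>i x. ennreal (exp (c i \<bullet> x - a i * (norm x)\<^sup>2))"
  have "indep_vars (\<lambda>_. borel) (\<lambda>i \<omega>. ?e i (X i \<omega>)) I"
    by (rule indep_vars_compose2[OF ind]) auto
  then have "(\<integral>\<^sup>+\<omega>. (\<Prod>i\<in>I. ?e i (X i \<omega>)) \<partial>M) = (\<Prod>i\<in>I. \<integral>\<^sup>+\<omega>. ?e i (X i \<omega>) \<partial>M)"
    by (rule indep_vars_nn_integral[OF I]) auto
  also have "\<dots> = (\<Prod>i\<in>I. ennreal (exp ((norm (c i))\<^sup>2 / (4 * (1 + a i))) / (1 + a i)))"
    using X a by (intro prod.cong refl nn_integral_exp_complex_gaussian)
  also have "\<dots> = ennreal (\<Prod>i\<in>I. exp ((norm (c i))\<^sup>2 / (4 * (1 + a i))) / (1 + a i))"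
    using a by (intro prod_ennreal divide_nonneg_pos) (auto simp: less_diff_eq[of "-1" _ 0] add_pos_pos dest!: a)
  finally show ?thesis
    by (simp add: prod_ennreal exp_sum[OF I])
qed

text \<open>The mixed term vanishes by independence of real and imaginary part, and the factor 1/2
  is their common variance.\<close>

lemma (in prob_space) complex_gaussian_inner:
  assumes X: "std_complex_gaussian M X"
  shows "integrable M (\<lambda>\<omega>. c \<bullet> X \<omega>)" "expectation (\<lambda>\<omega>. c \<bullet> X \<omega>) = 0"
    "integrable M (\<lambda>\<omega>. (c \<bullet> X \<omega>) * (d \<bullet> X \<omega>))"
    "expectation (\<lambda>\<omega>. (c \<bullet> X \<omega>) * (d \<bullet> X \<omega>)) = c \<bullet> d / 2"
proof -
  have ind: "indep_var borel (\<lambda>\<omega>. Re (X \<omega>)) borel (\<lambda>\<omega>. Im (X \<omega>))"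
    and Re: "distributed M lborel (\<lambda>\<omega>. Re (X \<omega>)) (normal_density 0 (sqrt (1 / 2)))"
    and Im: "distributed M lborel (\<lambda>\<omega>. Im (X \<omega>)) (normal_density 0 (sqrt (1 / 2)))"
    using X by (auto simp: std_complex_gaussian_def)
  have normal: "integrable M Y" "expectation Y = 0" "integrable M (\<lambda>\<omega>. (Y \<omega>)\<^sup>2)"
      "expectation (\<lambda>\<omega>. (Y \<omega>)\<^sup>2) = 1 / 2"
    if Y: "distributed M lborel Y (normal_density 0 (sqrt (1 / 2)))" for Y
  proof -
    have s: "0 < sqrt (1 / 2 :: real)" by simp
    show "integrable M Y"
      using integrable_normal_moment_nz_1[OF s, of 0] distributed_integrable_var[OF Y] by auto
    show Y0: "expectation Y = 0"
      by (rule normal_distributed_expectation[OF s Y])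
    show "integrable M (\<lambda>\<omega>. (Y \<omega>)\<^sup>2)"
      using integrable_normal_moment[OF s, of 0 2] distributed_integrable[OF Y, of "\<lambda>x. x\<^sup>2"] by auto
    show "expectation (\<lambda>\<omega>. (Y \<omega>)\<^sup>2) = 1 / 2"
      using normal_distributed_variance[OF s Y] Y0 by simp
  qed
  note R = normal[OF Re] and I = normal[OF Im]
  have RI: "integrable M (\<lambda>\<omega>. Re (X \<omega>) * Im (X \<omega>))"
    "expectation (\<lambda>\<omega>. Re (X \<omega>) * Im (X \<omega>)) = 0"
    using indep_var_integrable[OF ind R(1) I(1)] indep_var_lebesgue_integral[OF ind R(1) I(1)] R(2)
    by auto
  show "integrable M (\<lambda>\<omega>. c \<bullet> X \<omega>)" "expectation (\<lambda>\<omega>. c \<bullet> X \<omega>) = 0"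
    using R I by (auto simp: inner_complex_def)
  have eq: "(c \<bullet> X \<omega>) * (d \<bullet> X \<omega>) = Re c * Re d * (Re (X \<omega>))\<^sup>2 + Im c * Im d * (Im (X \<omega>))\<^sup>2
      + (Re c * Im d + Im c * Re d) * (Re (X \<omega>) * Im (X \<omega>))" for \<omega>
    by (simp add: inner_complex_def power2_eq_square algebra_simps)
  show "integrable M (\<lambda>\<omega>. (c \<bullet> X \<omega>) * (d \<bullet> X \<omega>))"
    unfolding eq using R I RI by auto
  show "expectation (\<lambda>\<omega>. (c \<bullet> X \<omega>) * (d \<bullet> X \<omega>)) = c \<bullet> d / 2"
    unfolding eq by (simp add: inner_complex_def R I RI)
qed

lemma (in prob_space) gaussian_family_inner:
  fixes X :: "'s \<Rightarrow> 'a \<Rightarrow> complex"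
  assumes fin: "finite (UNIV :: 's set)" and ind: "indep_vars (\<lambda>_. borel) X UNIV"
    and X: "\<And>s. std_complex_gaussian M (X s)"
  defines "Z \<equiv> \<lambda>c \<omega>. \<Sum>s\<in>UNIV. c s \<bullet> X s \<omega>"
  shows "integrable M (Z c)" "expectation (Z c) = 0" "integrable M (\<lambda>\<omega>. Z c \<omega> * Z d \<omega>)"
    "expectation (\<lambda>\<omega>. Z c \<omega> * Z d \<omega>) = (\<Sum>s\<in>UNIV. c s \<bullet> d s) / 2"
proof -
  note G = complex_gaussian_inner[OF X]
  show "integrable M (Z c)" "expectation (Z c) = 0"
    unfolding Z_def using G(1,2) by auto
  have st: "integrable M (\<lambda>\<omega>. (c s \<bullet> X s \<omega>) * (d t \<bullet> X t \<omega>)) \<and>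
      expectation (\<lambda>\<omega>. (c s \<bullet> X s \<omega>) * (d t \<bullet> X t \<omega>)) = (if s = t then c s \<bullet> d s / 2 else 0)" for s t
  proof (cases "s = t")
    case True
    then show ?thesis using G(3,4)[of "c s" s "d s"] by simp
  next
    case False
    \<comment> \<open>Independence of a single pair is read off from independence of the
      restrictions of the family to two singletons.\<close>
    have "indep_var borel (\<lambda>\<omega>. (\<lambda>h. c s \<bullet> h s) (restrict (\<lambda>i. X i \<omega>) {s})) borel
      (\<lambda>\<omega>. (\<lambda>h. d t \<bullet> h t) (restrict (\<lambda>i. X i \<omega>) {t}))"
      using False by (intro indep_var_compose[unfolded comp_def,
            OF indep_var_restrict[OF ind, of "{s}" "{t}"]]) auto
    then have "indep_var borel (\<lambda>\<omega>. c s \<bullet> X s \<omega>) borel (\<lambda>\<omega>. d t \<bullet> X t \<omega>)" by simp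
    from indep_var_integrable[OF this G(1) G(1)] indep_var_lebesgue_integral[OF this G(1) G(1)]
    show ?thesis using False G(2) by auto
  qed
  have eq: "Z c \<omega> * Z d \<omega> = (\<Sum>s\<in>UNIV. \<Sum>t\<in>UNIV. (c s \<bullet> X s \<omega>) * (d t \<bullet> X t \<omega>))" for \<omega>
    by (simp add: Z_def sum_product)
  show "integrable M (\<lambda>\<omega>. Z c \<omega> * Z d \<omega>)"
    unfolding eq using st by auto
  show "expectation (\<lambda>\<omega>. Z c \<omega> * Z d \<omega>) = (\<Sum>s\<in>UNIV. c s \<bullet> d s) / 2"
    unfolding eq using st fin by (simp add: sum_divide_distrib)
qed

text \<open>\<open>V\<close> is the variance of the sum, and the threshold is proportional to
  \<open>V\<close> because the decision inequality has \<open>(norm q)\<^sup>2\<close> on its left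
  side. The factor 2 pays for the two signs.\<close>

lemma (in prob_space) gaussian_tail:
  fixes X :: "'s \<Rightarrow> 'a \<Rightarrow> complex" and c :: "'s \<Rightarrow> complex"
  assumes fin: "finite (UNIV :: 's set)" and ind: "indep_vars (\<lambda>_. borel) X UNIV"
    and X: "\<And>s. std_complex_gaussian M (X s)" and \<delta>: "\<delta> \<ge> 0"
  defines "V \<equiv> (\<Sum>s\<in>UNIV. (norm (c s))\<^sup>2) / 2"
  shows "emeasure M {\<omega>\<in>space M. \<delta> / 2 * V \<le> \<bar>\<Sum>s\<in>UNIV. c s \<bullet> X s \<omega>\<bar>} \<le> ennreal (2 * exp (- \<delta>\<^sup>2 * V / 8))"
proof -
  have [measurable]: "random_variable borel (X s)" for s
    using ind by (auto simp: indep_vars_def)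
  define Z where "Z = (\<lambda>\<omega>. \<Sum>s\<in>UNIV. c s \<bullet> X s \<omega>)"
  have [measurable]: "random_variable borel Z" unfolding Z_def by measurable
  \<comment> \<open>Both tails are treated at once, with \<open>r\<close> equal to 1 or to
    -1.\<close>
  have chernoff: "emeasure M {\<omega>\<in>space M. \<delta> / 2 * V \<le> r * Z \<omega>} \<le> ennreal (exp (- \<delta>\<^sup>2 * V / 8))"
    if r: "r\<^sup>2 = 1" for r
  proof -
    \<comment> \<open>This is the optimal Chernoff parameter:
      \<open>k\<^sup>2 * V / 2 - k * (\<delta> / 2 * V)\<close> is minimal at
      \<open>k = \<delta> / 2\<close>, with value \<open>- \<delta>\<^sup>2 * V / 8\<close>.\<close>
    let ?k = "\<delta> / 2"
    have "emeasure M {\<omega>\<in>space M. \<delta> / 2 * V \<le> r * Z \<omega>} =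
        (\<integral>\<^sup>+\<omega>. indicator {\<omega>\<in>space M. \<delta> / 2 * V \<le> r * Z \<omega>} \<omega> \<partial>M)"
      by (subst nn_integral_indicator) auto
    also have "\<dots> \<le> (\<integral>\<^sup>+\<omega>. ennreal (exp (- ?k * (?k * V))) *
        ennreal (exp (\<Sum>s\<in>UNIV. ((?k * r) *\<^sub>R c s) \<bullet> X s \<omega> - 0 * (norm (X s \<omega>))\<^sup>2)) \<partial>M)"
    proof (rule nn_integral_mono)
      fix \<omega>
      have "exp (- ?k * (?k * V)) * exp (\<Sum>s\<in>UNIV. ((?k * r) *\<^sub>R c s) \<bullet> X s \<omega> - 0 * (norm (X s \<omega>))\<^sup>2)
          = exp (?k * (r * Z \<omega> - \<delta> / 2 * V))"
        by (simp add: Z_def exp_add[symmetric] sum_distrib_left algebra_simps)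
      moreover have "1 \<le> exp (?k * (r * Z \<omega> - \<delta> / 2 * V))" if "\<delta> / 2 * V \<le> r * Z \<omega>"
        using that \<delta> by simp
      ultimately show "indicator {\<omega>\<in>space M. \<delta> / 2 * V \<le> r * Z \<omega>} \<omega> \<le> ennreal (exp (- ?k * (?k * V))) *
          ennreal (exp (\<Sum>s\<in>UNIV. ((?k * r) *\<^sub>R c s) \<bullet> X s \<omega> - 0 * (norm (X s \<omega>))\<^sup>2))"
        by (auto simp: ennreal_mult[symmetric] split: split_indicator)
    qed
    also have "\<dots> = ennreal (exp (- ?k * (?k * V))) *
        ennreal (\<Prod>s\<in>UNIV. exp ((norm ((?k * r) *\<^sub>R c s))\<^sup>2 / (4 * (1 + 0))) / (1 + 0))"
      by (subst nn_integral_cmult, measurable,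
          subst nn_integral_exp_gaussian_family[OF fin ind X]) auto
    also have "(\<Prod>s\<in>UNIV. exp ((norm ((?k * r) *\<^sub>R c s))\<^sup>2 / (4 * (1 + 0))) / (1 + 0)) = exp (?k\<^sup>2 * V / 2)"
    proof -
      have "(norm ((?k * r) *\<^sub>R c s))\<^sup>2 = ?k\<^sup>2 * (norm (c s))\<^sup>2" for s
        unfolding norm_scaleR power_mult_distrib power2_abs r by simp
      then show ?thesis
        using fin by (simp add: exp_sum[symmetric] V_def sum_distrib_left sum_divide_distrib)
    qed
    also have "ennreal (exp (- ?k * (?k * V))) * ennreal (exp (?k\<^sup>2 * V / 2)) = ennreal (exp (- \<delta>\<^sup>2 * V / 8))"
      by (simp add: ennreal_mult[symmetric] exp_add[symmetric] power2_eq_square)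
    finally show ?thesis .
  qed
  have "emeasure M {\<omega>\<in>space M. \<delta> / 2 * V \<le> \<bar>Z \<omega>\<bar>} \<le>
      emeasure M ({\<omega>\<in>space M. \<delta> / 2 * V \<le> 1 * Z \<omega>} \<union> {\<omega>\<in>space M. \<delta> / 2 * V \<le> -1 * Z \<omega>})"
    by (intro emeasure_mono) auto
  also have "\<dots> \<le> emeasure M {\<omega>\<in>space M. \<delta> / 2 * V \<le> 1 * Z \<omega>} + emeasure M {\<omega>\<in>space M. \<delta> / 2 * V \<le> -1 * Z \<omega>}"
    by (intro emeasure_subadditive) auto
  also have "\<dots> \<le> ennreal (exp (- \<delta>\<^sup>2 * V / 8)) + ennreal (exp (- \<delta>\<^sup>2 * V / 8))"
    by (intro add_mono chernoff) auto
  also have "\<dots> = ennreal (2 * exp (- \<delta>\<^sup>2 * V / 8))"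
    by (simp add: ennreal_plus[symmetric] del: ennreal_plus)
  finally show ?thesis unfolding Z_def .
qed

section \<open>Relay noise\<close>

lemma UNIV_source:
  "(UNIV :: ('n::finite, 'd::finite, 't1::finite, 't2::finite) source set) =
    range Source_Gain \<union> range (case_prod Dest_Gain) \<union> range (case_prod Relay_Noise) \<union>
    range (case_prod Dest_Noise)"
proof -
  have "s \<in> range Source_Gain \<union> range (case_prod Dest_Gain) \<union> range (case_prod Relay_Noise) \<union>
      range (case_prod Dest_Noise)" for s :: "('n, 'd, 't1, 't2) source"
    by (cases s) (auto intro: image_eqI[of _ _ "(_, _)"])
  then show ?thesis by blast
qed

lemma finite_source: "finite (UNIV :: ('n::finite, 'd::finite, 't1::finite, 't2::finite) source set)"
  unfolding UNIV_source by simp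

lemma (in comm_monoid_set) range_case_prod:
  fixes c :: "'i::finite \<Rightarrow> 'j::finite \<Rightarrow> 's"
  assumes "inj (case_prod c)"
  shows "F h (range (case_prod c)) = F (\<lambda>i. F (\<lambda>j. h (c i j)) UNIV) UNIV"
  using assms by (simp add: reindex cartesian_product comp_def case_prod_unfold)

text \<open>Stated for commutative monoids so that it serves sums, in exponents and variances, as
  well as products, in Gaussian integrals.\<close>

lemma (in comm_monoid_set) over_source:
  fixes h :: "('n::finite, 'd::finite, 't1::finite, 't2::finite) source \<Rightarrow> 'a"
  shows "F h UNIV = F (\<lambda>j. h (Source_Gain j)) UNIV \<^bold>* F (\<lambda>j. F (\<lambda>l. h (Dest_Gain j l)) UNIV) UNIV \<^bold>*
    F (\<lambda>j. F (\<lambda>t. h (Relay_Noise j t)) UNIV) UNIV \<^bold>* F (\<lambda>l. F (\<lambda>t. h (Dest_Noise l t)) UNIV) UNIV"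
proof -
  have "F h UNIV = F h (range Source_Gain) \<^bold>* F h (range (case_prod Dest_Gain)) \<^bold>*
      F h (range (case_prod Relay_Noise)) \<^bold>* F h (range (case_prod Dest_Noise))"
    unfolding UNIV_source by (subst union_disjoint; (subst union_disjoint)?; (subst union_disjoint)?; fastforce)
  moreover have "F h (range (case_prod Dest_Gain)) = F (\<lambda>j. F (\<lambda>l. h (Dest_Gain j l)) UNIV) UNIV"
    "F h (range (case_prod Relay_Noise)) = F (\<lambda>j. F (\<lambda>t. h (Relay_Noise j t)) UNIV) UNIV"
    "F h (range (case_prod Dest_Noise)) = F (\<lambda>l. F (\<lambda>t. h (Dest_Noise l t)) UNIV) UNIV"
    by (rule range_case_prod, auto simp: inj_def)+
  moreover have "F h (range Source_Gain) = F (\<lambda>j. h (Source_Gain j)) UNIV"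
    by (subst reindex) (auto simp: inj_def comp_def)
  ultimately show ?thesis
    by (simp only:)
qed

text \<open>These are the coefficients of the real linear form that maps the elementary noises to
  the component of the total noise along \<open>a\<close>, that is, the adjoint of the noise map.
  Adjoints are taken for the real inner product on the complex numbers, hence the conjugates. The
  gains have coefficient 0 because they are frozen in \<open>g\<close>.\<close>

primrec noise_coeff ::
  "('k::finite, 'n::finite, 't1::finite, 't2::finite) af_network \<Rightarrow> real \<Rightarrow> complex ^ 'd ^ 'n \<Rightarrow>
     real ^ (('d::finite \<times> 't2) + ('d \<times> 't2)) \<Rightarrow> ('n, 'd, 't1, 't2) source \<Rightarrow> complex" where
  "noise_coeff net P g a (Source_Gain j) = 0"
| "noise_coeff net P g a (Dest_Gain j l) = 0"
| "noise_coeff net P g a (Relay_Noise j s) = relay_gain net P *\<^sub>R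
     (\<Sum>l\<in>UNIV. \<Sum>t\<in>UNIV. cnj (relay_mat net j $ t $ s) *
        kap net j (cnj (g $ j $ l) * Complex (a $ Inl (l, t)) (a $ Inr (l, t))))"
| "noise_coeff net P g a (Dest_Noise l t) = Complex (a $ Inl (l, t)) (a $ Inr (l, t))"

lemma inner_vec_tilde:
  "a \<bullet> vec_tilde A = (\<Sum>l\<in>UNIV. \<Sum>t\<in>UNIV. Complex (a $ Inl (l, t)) (a $ Inr (l, t)) \<bullet> (A $ t $ l))"
proof -
  have "a \<bullet> vec_tilde A = (\<Sum>p\<in>UNIV. a $ Inl p * vec_tilde A $ Inl p) + (\<Sum>p\<in>UNIV. a $ Inr p * vec_tilde A $ Inr p)"
    by (simp add: inner_vec_def UNIV_Plus_UNIV[symmetric] sum.Plus del: UNIV_Plus_UNIV)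
  also have "\<dots> = (\<Sum>p\<in>UNIV \<times> UNIV. Complex (a $ Inl p) (a $ Inr p) \<bullet> (A $ snd p $ fst p))"
    by (simp add: sum.distrib[symmetric] vec_tilde_def inner_complex_def case_prod_unfold)
  finally show ?thesis
    by (simp add: sum.cartesian_product case_prod_unfold)
qed

text \<open>For the real inner product, conjugation is its own adjoint and multiplication by
  \<open>c\<close> has adjoint multiplication by \<open>cnj c\<close>; so \<open>kap\<close>
  reappears unchanged on the other side.\<close>

lemma inner_kap_mult:
  "x \<bullet> (c * kap net j (b * y)) = (cnj b * kap net j (cnj c * x)) \<bullet> y"
  by (simp add: kap_def inner_complex_def algebra_simps)

lemma inner_total_noise:
  "a \<bullet> vec_tilde (total_noise net P g (v \<omega>) (w \<omega>)) =
    (\<Sum>s\<in>UNIV. noise_coeff net P g a s \<bullet> source_var f h v w s \<omega>)"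
proof -
  define \<alpha> where "\<alpha> = (\<lambda>l t. Complex (a $ Inl (l, t)) (a $ Inr (l, t)))"
  have kap_sum: "kap net j (\<Sum>s\<in>A. z s) = (\<Sum>s\<in>A. kap net j (z s))" for j z and A :: "'t1 set"
    by (simp add: kap_def)
  let ?c = "\<lambda>l t j s. relay_gain net P *\<^sub>R (cnj (relay_mat net j $ t $ s) * kap net j (cnj (g $ j $ l) * \<alpha> l t))"
  have "a \<bullet> vec_tilde (total_noise net P g (v \<omega>) (w \<omega>)) =
      (\<Sum>l\<in>UNIV. \<Sum>t\<in>UNIV. (\<Sum>j\<in>UNIV. \<Sum>s\<in>UNIV. ?c l t j s \<bullet> (v \<omega> $ j $ s)) + \<alpha> l t \<bullet> (w \<omega> $ l $ t))"
    unfolding inner_vec_tilde \<alpha>_def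
    by (simp add: total_noise_def kap_vec_def matrix_vector_mult_def kap_sum inner_add_right inner_sum_right
        sum_distrib_left inner_kap_mult)
  also have "\<dots> = (\<Sum>l\<in>UNIV. \<Sum>t\<in>UNIV. \<Sum>j\<in>UNIV. \<Sum>s\<in>UNIV. ?c l t j s \<bullet> (v \<omega> $ j $ s)) +
      (\<Sum>l\<in>UNIV. \<Sum>t\<in>UNIV. \<alpha> l t \<bullet> (w \<omega> $ l $ t))"
    by (simp add: sum.distrib)
  also have "(\<Sum>l\<in>UNIV. \<Sum>t\<in>UNIV. \<Sum>j\<in>UNIV. \<Sum>s\<in>UNIV. ?c l t j s \<bullet> (v \<omega> $ j $ s)) =
      (\<Sum>j\<in>UNIV. \<Sum>s\<in>UNIV. \<Sum>l\<in>UNIV. \<Sum>t\<in>UNIV. ?c l t j s \<bullet> (v \<omega> $ j $ s))"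
  proof -
    let ?F = "\<lambda>l t j s. ?c l t j s \<bullet> (v \<omega> $ j $ s)"
    have "(\<Sum>l\<in>UNIV. \<Sum>t\<in>UNIV. \<Sum>j\<in>UNIV. \<Sum>s\<in>UNIV. ?F l t j s) =
        (\<Sum>l\<in>UNIV. \<Sum>j\<in>UNIV. \<Sum>t\<in>UNIV. \<Sum>s\<in>UNIV. ?F l t j s)"
      by (intro sum.cong refl sum.swap)
    also have "\<dots> = (\<Sum>j\<in>UNIV. \<Sum>l\<in>UNIV. \<Sum>t\<in>UNIV. \<Sum>s\<in>UNIV. ?F l t j s)"
      by (rule sum.swap)
    also have "\<dots> = (\<Sum>j\<in>UNIV. \<Sum>l\<in>UNIV. \<Sum>s\<in>UNIV. \<Sum>t\<in>UNIV. ?F l t j s)"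
      by (intro sum.cong refl sum.swap)
    also have "\<dots> = (\<Sum>j\<in>UNIV. \<Sum>s\<in>UNIV. \<Sum>l\<in>UNIV. \<Sum>t\<in>UNIV. ?F l t j s)"
      by (intro sum.cong refl sum.swap)
    finally show ?thesis .
  qed
  finally show ?thesis
    unfolding sum.over_source by (simp add: \<alpha>_def inner_sum_left scaleR_sum_right)
qed

text \<open>The covariance is half the Gram form of the coefficient vectors, the half being the
  variance of each real component. Symmetry, positive definiteness and the upper bound of the
  covariance are all read off from this formula.\<close>

lemma noise_cov_inner:
  assumes "channel_model M f h v w"
  shows "x \<bullet> (noise_cov net M v w P g *v y) =
    (\<Sum>s\<in>UNIV. noise_coeff net P g x s \<bullet> noise_coeff net P g y s) / 2"
proof -
  interpret prob_space M using assms by (simp add: channel_model_def)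
  note G = gaussian_family_inner[OF finite_source, of "source_var f h v w"]
  have ind: "indep_vars (\<lambda>_. borel) (source_var f h v w) UNIV"
    and std: "\<And>s. std_complex_gaussian M (source_var f h v w s)"
    using assms by (auto simp: channel_model_def)
  define u where "u = (\<lambda>a \<omega>. vec_tilde (total_noise net P g (v \<omega>) (w \<omega>)) $ a)"
  have inner: "x \<bullet> vec_tilde (total_noise net P g (v \<omega>) (w \<omega>)) = (\<Sum>a\<in>UNIV. x $ a * u a \<omega>)" for x \<omega>
    by (simp add: inner_vec_def u_def)
  \<comment> \<open>A coordinate is the component along an axis vector, so the entries of the
    covariance are instances of the same linear forms.\<close>
  have u: "u a = (\<lambda>\<omega>. \<Sum>s\<in>UNIV. noise_coeff net P g (axis a 1) s \<bullet> source_var f h v w s \<omega>)" for a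
    unfolding inner_total_noise[symmetric] by (simp add: u_def inner_axis' fun_eq_iff)
  have mean: "expectation (u a) = 0" and int: "integrable M (\<lambda>\<omega>. u a \<omega> * u b \<omega>)" for a b
    unfolding u by (intro G ind std)+
  have "x \<bullet> (noise_cov net M v w P g *v y) =
      (\<Sum>a\<in>UNIV. \<Sum>b\<in>UNIV. x $ a * y $ b * expectation (\<lambda>\<omega>. u a \<omega> * u b \<omega>))"
    unfolding noise_cov_def u_def[symmetric] Let_def
    by (simp add: mean inner_vec_def matrix_vector_mult_def sum_distrib_left mult_ac)
  also have "\<dots> = expectation (\<lambda>\<omega>. \<Sum>a\<in>UNIV. \<Sum>b\<in>UNIV. x $ a * y $ b * (u a \<omega> * u b \<omega>))"
    using int by simp
  also have "\<dots> = expectation (\<lambda>\<omega>. (\<Sum>a\<in>UNIV. x $ a * u a \<omega>) * (\<Sum>b\<in>UNIV. y $ b * u b \<omega>))"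
    by (simp add: sum_product mult_ac)
  also have "\<dots> = (\<Sum>s\<in>UNIV. noise_coeff net P g x s \<bullet> noise_coeff net P g y s) / 2"
    unfolding inner[symmetric] inner_total_noise[where f=f and h=h] by (intro G ind std)
  finally show ?thesis .
qed

lemma sum_norm_Complex:
  fixes a :: "real ^ (('d::finite \<times> 't::finite) + ('d \<times> 't))"
  shows "(\<Sum>l\<in>UNIV. \<Sum>t\<in>UNIV. (norm (Complex (a $ Inl (l, t)) (a $ Inr (l, t))))\<^sup>2) = (norm a)\<^sup>2"
proof -
  have "a = vec_tilde (\<chi> t l. Complex (a $ Inl (l, t)) (a $ Inr (l, t)))"
    by (simp add: vec_tilde_def vec_eq_iff split: sum.split)
  then have "(norm a)\<^sup>2 = a \<bullet> vec_tilde (\<chi> t l. Complex (a $ Inl (l, t)) (a $ Inr (l, t)))"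
    by (simp add: power2_norm_eq_inner)
  then show ?thesis
    by (simp add: inner_vec_tilde power2_norm_eq_inner)
qed

text \<open>The destination noise alone already contributes \<open>(norm a)\<^sup>2\<close>. This
  makes the covariance positive definite for all gains.\<close>

lemma noise_coeff_lower: "(norm a)\<^sup>2 \<le> (\<Sum>s\<in>UNIV. (norm (noise_coeff net P g a s))\<^sup>2)"
  unfolding sum.over_source sum_norm_Complex[of a, symmetric] by (simp add: sum_nonneg)

text \<open>The relays normalise their transmit power, so the squared amplification stays below its
  limit for large \<open>P\<close>. This is the source of uniformity in \<open>P\<close> of the
  noise bound.\<close>

lemma relay_gain_le:
  assumes "pi1 net > 0" "pi2 net > 0" "P > 0"
  shows "0 \<le> relay_gain net P" "(relay_gain net P)\<^sup>2 \<le> pi2 net / pi1 net"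
proof -
  have "pi2 net * P / (pi1 net * P + 1) \<le> pi2 net / pi1 net"
    using assms by (simp add: field_simps add_pos_pos)
  moreover have "0 \<le> pi2 net * P / (pi1 net * P + 1)"
    using assms by simp
  ultimately show "0 \<le> relay_gain net P" "(relay_gain net P)\<^sup>2 \<le> pi2 net / pi1 net"
    unfolding relay_gain_def by auto
qed

lemma noise_coeff_upper:
  fixes net :: "('k::finite, 'n::finite, 't1::finite, 't2::finite) af_network"
  assumes "pi1 net > 0" "pi2 net > 0"
  obtains C where "C > 0" "\<And>P a (g :: complex ^ ('d::finite) ^ 'n). P > 0 \<Longrightarrow>
    (\<Sum>s\<in>UNIV. (norm (noise_coeff net P g a s))\<^sup>2) \<le> C * (1 + (norm g)\<^sup>2) * (norm a)\<^sup>2"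
proof -
  \<comment> \<open>\<open>\<beta>\<close> dominates every entry of every relay matrix, and
    \<open>D\<close> counts the terms of the double sum over antennas and time slots.
    \<open>C\<close> consists of 1 for the destination noise and one share for each entry of the
    relay noise.\<close>
  define \<beta> where "\<beta> = (\<Sum>j\<in>UNIV. norm (relay_mat net j))"
  define D where "D = real (CARD('d)) * real (CARD('t2)) * \<beta>"
  define C where "C = 1 + real (CARD('n)) * real (CARD('t1)) * (pi2 net / pi1 net * D\<^sup>2)"
  have D: "D \<ge> 0" by (simp add: D_def \<beta>_def sum_nonneg)
  have C: "C > 0" using assms by (simp add: C_def add_pos_nonneg)
  have "(\<Sum>s\<in>UNIV. (norm (noise_coeff net P g a s))\<^sup>2) \<le> C * (1 + (norm g)\<^sup>2) * (norm a)\<^sup>2"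
    if P: "P > 0" for P a and g :: "complex ^ 'd ^ 'n"
  proof -
    have entry: "norm (cnj (relay_mat net j $ t $ s) *
        kap net j (cnj (g $ j $ l) * Complex (a $ Inl (l, t)) (a $ Inr (l, t)))) \<le> \<beta> * (norm g * norm a)" for j s l t
    proof -
      have "norm (relay_mat net j $ t $ s) \<le> norm (relay_mat net j)"
        by (rule order_trans[OF Finite_Cartesian_Product.norm_nth_le Finite_Cartesian_Product.norm_nth_le])
      also have "\<dots> \<le> \<beta>"
        unfolding \<beta>_def by (rule member_le_sum) auto
      finally have 1: "norm (relay_mat net j $ t $ s) \<le> \<beta>" .
      have 2: "norm (g $ j $ l) \<le> norm g"
        by (rule order_trans[OF Finite_Cartesian_Product.norm_nth_le Finite_Cartesian_Product.norm_nth_le])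
      have "(norm (Complex (a $ Inl (l, t)) (a $ Inr (l, t))))\<^sup>2 \<le>
          (\<Sum>t\<in>UNIV. (norm (Complex (a $ Inl (l, t)) (a $ Inr (l, t))))\<^sup>2)"
        by (rule member_le_sum) auto
      also have "\<dots> \<le> (\<Sum>l\<in>UNIV. \<Sum>t\<in>UNIV. (norm (Complex (a $ Inl (l, t)) (a $ Inr (l, t))))\<^sup>2)"
        by (rule member_le_sum) (auto intro: sum_nonneg)
      finally have 3: "norm (Complex (a $ Inl (l, t)) (a $ Inr (l, t))) \<le> norm a"
        unfolding sum_norm_Complex by (rule power2_le_imp_le) simp
      have "norm (kap net j z) = norm z" for z
        by (simp add: kap_def)
      then show ?thesis
        using 1 2 3 order_trans[OF norm_ge_zero 1] by (auto simp: norm_mult intro!: mult_mono)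
    qed
    have "(norm (noise_coeff net P g a (Relay_Noise j s)))\<^sup>2 \<le> pi2 net / pi1 net * D\<^sup>2 * ((norm g)\<^sup>2 * (norm a)\<^sup>2)"
      for j s
    proof -
      have "norm (noise_coeff net P g a (Relay_Noise j s)) \<le> relay_gain net P *
          (\<Sum>l\<in>(UNIV::'d set). \<Sum>t\<in>(UNIV::'t2 set). \<beta> * (norm g * norm a))"
        using relay_gain_le(1)[OF assms P]
        by (simp only: noise_coeff.simps norm_scaleR abs_of_nonneg)
          (intro mult_left_mono sum_norm_le entry)
      then have "norm (noise_coeff net P g a (Relay_Noise j s)) \<le> relay_gain net P * (D * (norm g * norm a))"
        by (simp add: D_def mult_ac)
      then have "(norm (noise_coeff net P g a (Relay_Noise j s)))\<^sup>2 \<le> (relay_gain net P * (D * (norm g * norm a)))\<^sup>2"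
        by (intro power_mono) auto
      also have "\<dots> = (relay_gain net P)\<^sup>2 * (D\<^sup>2 * ((norm g)\<^sup>2 * (norm a)\<^sup>2))"
        by (simp only: power_mult_distrib)
      also have "\<dots> \<le> pi2 net / pi1 net * (D\<^sup>2 * ((norm g)\<^sup>2 * (norm a)\<^sup>2))"
        using relay_gain_le(2)[OF assms P] by (intro mult_right_mono) auto
      finally show ?thesis by (simp only: mult.assoc)
    qed
    then have "(\<Sum>j\<in>UNIV. \<Sum>s\<in>UNIV. (norm (noise_coeff net P g a (Relay_Noise j s)))\<^sup>2) \<le>
        (\<Sum>j\<in>(UNIV::'n set). \<Sum>s\<in>(UNIV::'t1 set). pi2 net / pi1 net * D\<^sup>2 * ((norm g)\<^sup>2 * (norm a)\<^sup>2))"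
      by (intro sum_mono)
    also have "\<dots> = (C - 1) * ((norm g)\<^sup>2 * (norm a)\<^sup>2)"
      by (simp add: C_def mult_ac)
    finally have "(\<Sum>s\<in>UNIV. (norm (noise_coeff net P g a s))\<^sup>2) \<le>
        (C - 1) * ((norm g)\<^sup>2 * (norm a)\<^sup>2) + (norm a)\<^sup>2"
      unfolding sum.over_source using sum_norm_Complex[of a] by simp
    also have "\<dots> \<le> C * (1 + (norm g)\<^sup>2) * (norm a)\<^sup>2"
    proof -
      have "0 \<le> (C - 1) * (norm a)\<^sup>2 + (norm g)\<^sup>2 * (norm a)\<^sup>2"
        using assms by (simp add: C_def)
      then show ?thesis by (simp add: algebra_simps)
    qed
    finally show ?thesis .
  qed
  then show ?thesis using that C by blast
qed

section \<open>Error probability for fixed gains\<close>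

lemma inv_sqrt_mat_inner:
  fixes A :: "real ^ 'a ^ 'a"
  assumes A: "sym_pos_def A"
  shows "(inv_sqrt_mat A *v x) \<bullet> (inv_sqrt_mat A *v y) = (matrix_inv A *v x) \<bullet> y"
proof -
  have "transpose (inv_sqrt_mat A) = inv_sqrt_mat A"
    using inv_sqrt_mat(1)[OF A] by (simp add: sym_pos_def_def)
  from symmetric_matrix_adjoint[OF this, of "inv_sqrt_mat A *v x" y] show ?thesis
    by (simp add: matrix_vector_mul_assoc inv_sqrt_mat(2)[OF A])
qed

text \<open>Cauchy-Schwarz for \<open>S *v (A *v z)\<close> and \<open>S *v z\<close>, with
  \<open>S\<close> the inverse root: their inner product is \<open>(norm z)\<^sup>2\<close>, and the
  first has squared norm \<open>z \<bullet> (A *v z)\<close>. Whitening therefore shrinks a vector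
  by no more than the noise level allows.\<close>

lemma inv_sqrt_mat_lower:
  fixes A :: "real ^ 'a ^ 'a"
  assumes A: "sym_pos_def A" and le: "\<And>x. x \<bullet> (A *v x) \<le> c * (norm x)\<^sup>2"
  shows "(norm z)\<^sup>2 \<le> c * (norm (inv_sqrt_mat A *v z))\<^sup>2"
proof (cases "z = 0")
  case False
  let ?S = "inv_sqrt_mat A"
  have inv: "matrix_inv A *v (A *v x) = x" for x
    by (simp only: matrix_vector_mul_assoc matrix_inv_cancel(2)[OF sym_pos_def_matrix_inv(1)[OF A]]
        matrix_vector_mul_lid)
  have "(norm z)\<^sup>2 = (?S *v (A *v z)) \<bullet> (?S *v z)"
    by (simp add: inv_sqrt_mat_inner[OF A] inv power2_norm_eq_inner)
  also have "\<dots> \<le> norm (?S *v (A *v z)) * norm (?S *v z)"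
    by (rule norm_cauchy_schwarz)
  finally have "((norm z)\<^sup>2)\<^sup>2 \<le> (norm (?S *v (A *v z)) * norm (?S *v z))\<^sup>2"
    by (intro power_mono) auto
  also have "\<dots> = (z \<bullet> (A *v z)) * (norm (?S *v z))\<^sup>2"
    unfolding power_mult_distrib power2_norm_eq_inner[of "?S *v (A *v z)"]
    by (simp add: inv_sqrt_mat_inner[OF A] inv)
  also have "\<dots> \<le> c * (norm z)\<^sup>2 * (norm (?S *v z))\<^sup>2"
    using le by (intro mult_right_mono) auto
  finally have "(norm z)\<^sup>2 * (norm z)\<^sup>2 \<le> (norm z)\<^sup>2 * (c * (norm (?S *v z))\<^sup>2)"
    by (simp only: power2_eq_square mult_ac)
  from mult_left_le_imp_le[OF this] show ?thesis
    using False by simp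
qed simp

lemma noise_cov_sym_pos_def:
  assumes "channel_model M f h v w"
  shows "sym_pos_def (noise_cov net M v w P g)"
  unfolding sym_pos_def_def
proof (intro conjI allI impI)
  note inner = noise_cov_inner[OF assms, of _ net P g]
  show "transpose (noise_cov net M v w P g) = noise_cov net M v w P g"
  proof (rule symmetric_matrixI)
    show "x \<bullet> (noise_cov net M v w P g *v y) = (noise_cov net M v w P g *v x) \<bullet> y" for x y
      unfolding inner_commute[of "_ *v x" y] inner by (simp add: inner_commute)
  qed
  show "0 < x \<bullet> (noise_cov net M v w P g *v x)" if "x \<noteq> 0" for x
  proof -
    have "0 < (norm x)\<^sup>2" using that by simp
    also have "\<dots> \<le> (\<Sum>s\<in>UNIV. (norm (noise_coeff net P g x s))\<^sup>2)"
      by (rule noise_coeff_lower)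
    finally show ?thesis by (simp add: inner power2_norm_eq_inner)
  qed
qed

section \<open>The real equivalent channel and its smallest gain\<close>

lemma vec_tilde_add: "vec_tilde (A + B) = vec_tilde A + vec_tilde B"
  and vec_tilde_scaleR: "vec_tilde (r *\<^sub>R A) = r *\<^sub>R vec_tilde A"
  by (auto simp: vec_tilde_def vec_eq_iff split: sum.split)

lemma norm_vec_tilde: "(norm (vec_tilde A))\<^sup>2 = (\<Sum>l\<in>UNIV. \<Sum>t\<in>UNIV. (norm (A $ t $ l))\<^sup>2)"
  unfolding sum_norm_Complex[symmetric] by (simp add: vec_tilde_def)

lemma norm_vec_tilde_mult: "(norm (vec_tilde (A ** B)))\<^sup>2 = (\<Sum>l\<in>UNIV. (norm (A *v column l B))\<^sup>2)"
proof -
  have "(A ** B) $ t $ l = (A *v column l B) $ t" for t l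
    by (simp add: matrix_matrix_mult_def matrix_vector_mult_def column_def)
  then show ?thesis
    unfolding norm_vec_tilde by (simp add: norm_vec_def L2_set_def sum_nonneg)
qed

text \<open>By linearity a combination of the channel columns is the image of a codeword with
  arbitrary real coefficients. This is why the rank condition is imposed for all real
  \<open>u\<close> and not only for differences of signal points.\<close>

lemma eq_channel_raw_mult:
  "eq_channel_raw net P f g *v u = total_gain net P *\<^sub>R vec_tilde (codeword net u ** channel_mat net f g)"
proof -
  let ?H = "channel_mat net f g"
  have mult: "(A + B) ** ?H = A ** ?H + B ** ?H" "(r *\<^sub>R A) ** ?H = r *\<^sub>R (A ** ?H)" for A B r
    by (simp_all add: matrix_matrix_mult_def vec_eq_iff algebra_simps sum.distrib scaleR_sum_right)
  have lin: "linear (\<lambda>A. vec_tilde (A ** ?H))"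
    by (rule linearI) (simp_all add: mult vec_tilde_add vec_tilde_scaleR)
  have "vec_tilde (codeword net u ** ?H) = (\<Sum>i\<in>UNIV. u $ i *\<^sub>R vec_tilde (weight_mat net i ** ?H))"
    unfolding codeword_def linear_sum[OF lin] linear_scale[OF lin] ..
  then show ?thesis
    by (simp add: eq_channel_raw_def vec_eq_iff matrix_vector_mult_def sum_distrib_left mult_ac)
qed

lemma eq_received_received:
  "eq_received net M v w P g (received net P f g v0 w0 x) =
    eq_channel net M v w P f g *v x +
    inv_sqrt_mat (noise_cov net M v w P g) *v vec_tilde (total_noise net P g v0 w0)"
  unfolding eq_received_def eq_channel_def received_eq
  by (simp add: vec_tilde_add vec_tilde_scaleR matrix_vector_right_distrib eq_channel_raw_mult
      matrix_vector_mul_assoc[symmetric])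

lemma full_rank_imp_inj:
  fixes A :: "'a::field ^ 'n ^ 'm"
  assumes "rank A = CARD('n)"
  shows "inj ((*v) A)"
  using assms by (simp add: matrix_left_invertible_injective[symmetric] row_rank_def_gen
      matrix_left_invertible_span_rows_gen vec.dim_eq_full[symmetric] card_cart_basis vec.dimension_def)

text \<open>The expression is homogeneous in \<open>u\<close> and in \<open>h\<close> separately, so
  it suffices to minimise over the product of the two unit spheres. There the minimum is attained,
  and it is positive because full column rank excludes kernel vectors.\<close>

lemma codeword_mult_lower:
  fixes net :: "('k::finite, 'n::finite, 't1::finite, 't2::finite) af_network"
  assumes full_rank: "\<forall>u :: real ^ 'k. u \<noteq> 0 \<longrightarrow>
           rank (\<Sum>i\<in>UNIV. u $ i *\<^sub>R weight_mat net i) = CARD('n)"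
  obtains m where "m > 0" "\<And>u h. m * norm u * norm h \<le> norm (codeword net u *v h)"
proof -
  let ?K = "sphere (0 :: real ^ 'k) 1 \<times> sphere (0 :: complex ^ 'n) 1"
  let ?F = "\<lambda>z. norm (codeword net (fst z) *v snd z)"
  have "compact ?K" by (intro compact_Times) auto
  moreover have "?K \<noteq> {}" by simp
  moreover have "continuous_on ?K ?F"
    unfolding codeword_def matrix_vector_mult_def sum_component vector_scaleR_component
    by (intro continuous_intros continuous_on_vec_lambda)
  ultimately obtain z where z: "z \<in> ?K" and min: "\<And>y. y \<in> ?K \<Longrightarrow> ?F z \<le> ?F y"
    using continuous_attains_inf[of ?K ?F] by blast
  have "norm (fst z) = 1" "norm (snd z) = 1"
    using z by auto
  then have "fst z \<noteq> 0" "snd z \<noteq> 0"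
    by force+
  then have "rank (codeword net (fst z)) = CARD('n)"
    using full_rank unfolding codeword_def by simp
  then have "inj ((*v) (codeword net (fst z)))"
    by (rule full_rank_imp_inj)
  then have "codeword net (fst z) *v snd z \<noteq> 0"
    using \<open>snd z \<noteq> 0\<close> by (metis injD matrix_vector_mult_0_right)
  then have pos: "?F z > 0" by simp
  have "?F z * norm u * norm h \<le> norm (codeword net u *v h)" for u h
  proof (cases "u = 0 \<or> h = 0")
    case False
    have "codeword net (r *\<^sub>R u) = r *\<^sub>R codeword net u" for r
      by (simp add: codeword_def scaleR_sum_right)
    then have "codeword net (r *\<^sub>R u) *v (s *\<^sub>R h) = (r * s) *\<^sub>R (codeword net u *v h)" for r s
      by (simp add: matrix_vector_mult_def vec_eq_iff scaleR_sum_right mult.commute[of r s])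
    moreover have "(u /\<^sub>R norm u, h /\<^sub>R norm h) \<in> ?K"
      using False by simp
    ultimately have "?F z \<le> norm ((inverse (norm u) * inverse (norm h)) *\<^sub>R (codeword net u *v h))"
      using min[of "(u /\<^sub>R norm u, h /\<^sub>R norm h)"] by simp
    then show ?thesis
      using False by (simp add: field_simps)
  qed auto
  then show ?thesis using that pos by blast
qed

text \<open>For \<open>P \<ge> 1\<close> the denominator is at most
  \<open>(pi1 net + 1) * P\<close>, so one power of \<open>P\<close> survives.\<close>

lemma total_gain_lower:
  assumes "pi1 net > 0" "pi2 net > 0" "P \<ge> 1"
  shows "pi1 net * pi2 net / (pi1 net + 1) * P \<le> (total_gain net P)\<^sup>2"
proof -
  have "(pi1 net + 1) * P \<ge> pi1 net * P + 1"
    using assms by (simp add: algebra_simps)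
  then have "pi1 net * pi2 net * P\<^sup>2 / ((pi1 net + 1) * P) \<le> pi1 net * pi2 net * P\<^sup>2 / (pi1 net * P + 1)"
    using assms by (intro divide_left_mono) (auto intro!: mult_pos_pos add_pos_pos)
  moreover have "pi1 net * pi2 net * P\<^sup>2 / ((pi1 net + 1) * P) = pi1 net * pi2 net / (pi1 net + 1) * P"
    using assms by (simp add: power2_eq_square)
  moreover have "(total_gain net P)\<^sup>2 = pi1 net * pi2 net * P\<^sup>2 / (pi1 net * P + 1)"
    using assms by (simp add: total_gain_def)
  ultimately show ?thesis by simp
qed

lemma eq_channel_lower:
  fixes net :: "('k::finite, 'n::finite, 't1::finite, 't2::finite) af_network"
    and v :: "'w \<Rightarrow> complex ^ 't1 ^ 'n" and w :: "'w \<Rightarrow> complex ^ 't2 ^ ('d::finite)"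
  assumes pi: "pi1 net > 0" "pi2 net > 0" and channel: "channel_model M f0 g0 v w"
    and full_rank: "\<forall>u :: real ^ 'k. u \<noteq> 0 \<longrightarrow>
           rank (\<Sum>i\<in>UNIV. u $ i *\<^sub>R weight_mat net i) = CARD('n)"
  obtains \<kappa> where "\<kappa> > 0"
    "\<And>P f (g :: complex ^ 'd ^ 'n) u i. P \<ge> 1 \<Longrightarrow> u $ i = 1 \<Longrightarrow>
      \<kappa> * P * (\<Sum>j\<in>UNIV. (norm (f $ j))\<^sup>2 * (norm (g $ j))\<^sup>2) / (1 + (norm g)\<^sup>2)
        \<le> (norm (eq_channel net M v w P f g *v u))\<^sup>2"
proof -
  obtain m where m: "m > 0" "\<And>u h. m * norm u * norm h \<le> norm (codeword net u *v h)"
    using codeword_mult_lower[OF full_rank] by blast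
  obtain C where C: "C > 0" "\<And>P a (g :: complex ^ 'd ^ 'n). P > 0 \<Longrightarrow>
    (\<Sum>s\<in>UNIV. (norm (noise_coeff net P g a s))\<^sup>2) \<le> C * (1 + (norm g)\<^sup>2) * (norm a)\<^sup>2"
    using noise_coeff_upper[OF pi] by blast
  define \<rho> where "\<rho> = pi1 net * pi2 net / (pi1 net + 1)"
  have \<rho>: "\<rho> > 0" using pi by (simp add: \<rho>_def)
  \<comment> \<open>The signal energy is at least \<open>\<rho> * P * m\<^sup>2\<close> times the
    energy of the channel matrix, and the noise covariance is at most \<open>C / 2\<close> times
    \<open>1 + (norm g)\<^sup>2\<close>; \<open>\<kappa>\<close> is the quotient of the
    constants.\<close>
  define \<kappa> where "\<kappa> = 2 * \<rho> * m\<^sup>2 / C"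
  have "\<kappa> * P * (\<Sum>j\<in>UNIV. (norm (f $ j))\<^sup>2 * (norm (g $ j))\<^sup>2) / (1 + (norm g)\<^sup>2)
        \<le> (norm (eq_channel net M v w P f g *v u))\<^sup>2"
    if P: "P \<ge> 1" and u: "u $ i = 1" for P f u i and g :: "complex ^ 'd ^ 'n"
  proof -
    let ?H = "channel_mat net f g" and ?s = "\<Sum>j\<in>UNIV. (norm (f $ j))\<^sup>2 * (norm (g $ j))\<^sup>2"
    let ?q = "eq_channel net M v w P f g *v u" and ?N = "1 + (norm g)\<^sup>2"
    have N: "?N > 0" by (simp add: add_pos_nonneg)
    \<comment> \<open>The unit coordinate left by the projection enters here.\<close>
    have "norm u \<ge> 1" using component_le_norm_cart[of u i] u by simp
    have "norm (kap net j z) = norm z" for j z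
      by (simp add: kap_def)
    then have col: "(norm (column l ?H))\<^sup>2 = (\<Sum>j\<in>UNIV. (norm (f $ j))\<^sup>2 * (norm (g $ j $ l))\<^sup>2)" for l
      by (simp add: norm_vec_def L2_set_def sum_nonneg column_def channel_mat_def norm_mult
          power_mult_distrib)
    \<comment> \<open>Conjugation at a relay preserves moduli, so the columns of the channel matrix
      have total energy \<open>?s\<close>, whichever relays conjugate.\<close>
    have "?s = (\<Sum>l\<in>UNIV. (norm (column l ?H))\<^sup>2)"
      unfolding col by (subst sum.swap) (simp add: norm_vec_def L2_set_def sum_nonneg sum_distrib_left)
    then have "m\<^sup>2 * ?s = (\<Sum>l\<in>UNIV. (m * 1 * norm (column l ?H))\<^sup>2)"
      by (simp add: sum_distrib_left power_mult_distrib)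
    also have "\<dots> \<le> (\<Sum>l\<in>UNIV. (norm (codeword net u *v column l ?H))\<^sup>2)"
    proof (intro sum_mono power_mono)
      show "m * 1 * norm (column l ?H) \<le> norm (codeword net u *v column l ?H)" for l
        using m(1) \<open>norm u \<ge> 1\<close> by (intro order_trans[OF _ m(2)] mult_right_mono mult_left_mono) auto
    qed (use m(1) in auto)
    also have "\<dots> = (norm (vec_tilde (codeword net u ** ?H)))\<^sup>2"
      by (simp add: norm_vec_tilde_mult)
    finally have "(\<rho> * P) * (m\<^sup>2 * ?s) \<le> (total_gain net P)\<^sup>2 * (norm (vec_tilde (codeword net u ** ?H)))\<^sup>2"
      using total_gain_lower[OF pi P] m(1) \<rho> P
      by (intro mult_mono) (auto simp: \<rho>_def intro!: sum_nonneg mult_nonneg_nonneg)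
    also have "\<dots> = (norm (eq_channel_raw net P f g *v u))\<^sup>2"
      by (simp add: eq_channel_raw_mult power_mult_distrib)
    also have "\<dots> \<le> (C * ?N / 2) * (norm ?q)\<^sup>2"
    proof -
      have "x \<bullet> (noise_cov net M v w P g *v x) \<le> C * ?N / 2 * (norm x)\<^sup>2" for x
        using C(2)[of P g x] P by (simp add: noise_cov_inner[OF channel] power2_norm_eq_inner)
      from inv_sqrt_mat_lower[OF noise_cov_sym_pos_def[OF channel] this] show ?thesis
        by (simp add: eq_channel_def matrix_vector_mul_assoc[symmetric])
    qed
    finally have "\<rho> * P * (m\<^sup>2 * ?s) \<le> C * ?N / 2 * (norm ?q)\<^sup>2" .
    moreover have "\<kappa> * P * ?s / ?N = (\<rho> * P * (m\<^sup>2 * ?s)) / (C * ?N / 2)"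
      unfolding \<kappa>_def by (simp add: mult_ac)
    ultimately show ?thesis
      using C(1) N by (simp add: pos_divide_le_eq mult_ac)
  qed
  moreover have "\<kappa> > 0" using m(1) C(1) \<rho> by (simp add: \<kappa>_def)
  ultimately show ?thesis using that by blast
qed

lemma alphabet_separation:
  assumes "\<And>i::'k::finite. finite (\<A> i)"
  obtains \<delta> :: real where "\<delta> > 0" "\<forall>i. \<forall>a\<in>\<A> i. \<forall>b\<in>\<A> i. a \<noteq> b \<longrightarrow> \<delta> \<le> \<bar>a - b\<bar>"
proof -
  \<comment> \<open>The element 1 keeps the set nonempty when no alphabet offers two distinct
    values; distances between different alphabets are included and can only lower the
    minimum.\<close>
  define D where "D = insert 1 ((\<lambda>(a, b). \<bar>a - b\<bar>) ` ((\<Union>i. \<A> i) \<times> (\<Union>i. \<A> i)) - {0})"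
  have D: "finite D" "D \<noteq> {}" "\<And>x. x \<in> D \<Longrightarrow> x > 0"
    using assms by (auto simp: D_def)
  have "Min D > 0" using D by simp
  moreover have "\<forall>i. \<forall>a\<in>\<A> i. \<forall>b\<in>\<A> i. a \<noteq> b \<longrightarrow> Min D \<le> \<bar>a - b\<bar>"
  proof (intro allI ballI impI Min_le D(1))
    show "\<bar>a - b\<bar> \<in> D" if "a \<in> \<A> i" "b \<in> \<A> i" "a \<noteq> b" for i a b
      unfolding D_def using that by (intro insertI2 DiffI rev_image_eqI[of "(a, b)"]) auto
  qed
  ultimately show ?thesis using that by blast
qed

text \<open>With the gains fixed, the error event lies in the union over the symbols
  \<open>i\<close> of the Gaussian tail events along \<open>G *v U i\<close>. The union bound gives
  the factor \<open>CARD('k)\<close>, and \<open>\<delta>\<^sup>2 / 8\<close> from the tail estimate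
  is merged into \<open>\<kappa>\<close>.\<close>

lemma conditional_error:
  fixes net :: "('k::finite, 'n::finite, 't1::finite, 't2::finite) af_network"
    and v :: "'w \<Rightarrow> complex ^ 't1 ^ 'n" and w :: "'w \<Rightarrow> complex ^ 't2 ^ ('d::finite)"
    and dec :: "('k, 'n, 'd, 't2) decoder"
  assumes pi: "pi1 net > 0" "pi2 net > 0" and fin: "\<And>i. finite (alphabet net i)"
    and channel: "channel_model M f0 g0 v w"
    and full_rank: "\<forall>u :: real ^ 'k. u \<noteq> 0 \<longrightarrow>
           rank (\<Sum>i\<in>UNIV. u $ i *\<^sub>R weight_mat net i) = CARD('n)"
    and out: "noise_directed (alphabet net) out"
    and dec: "\<And>P f g Y. P > 0 \<Longrightarrow>
      out (eq_channel net M v w P f g) (eq_received net M v w P g Y) (dec P f g Y)"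
  obtains \<kappa> where "\<kappa> > 0"
    "\<And>P f g x. P \<ge> 1 \<Longrightarrow> x \<in> signal_set net \<Longrightarrow>
      emeasure M {\<omega> \<in> space M. dec P f g (received net P f g (v \<omega>) (w \<omega>) x) \<noteq> x} \<le>
        ennreal (2 * CARD('k) * exp (- (\<kappa> * P * (\<Sum>j\<in>UNIV. (norm (f $ j))\<^sup>2 * (norm (g $ j))\<^sup>2) / (1 + (norm g)\<^sup>2))))"
proof -
  interpret prob_space M using channel by (simp add: channel_model_def)
  have ind: "indep_vars (\<lambda>_. borel) (source_var f0 g0 v w) UNIV"
    and std: "\<And>s. std_complex_gaussian M (source_var f0 g0 v w s)"
    using channel by (auto simp: channel_model_def)
  have [measurable]: "random_variable borel (source_var f0 g0 v w s)" for s
    using ind by (auto simp: indep_vars_def)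
  obtain \<kappa> where \<kappa>: "\<kappa> > 0" "\<And>P f (g :: complex ^ 'd ^ 'n) u i. P \<ge> 1 \<Longrightarrow> u $ i = 1 \<Longrightarrow>
      \<kappa> * P * (\<Sum>j\<in>UNIV. (norm (f $ j))\<^sup>2 * (norm (g $ j))\<^sup>2) / (1 + (norm g)\<^sup>2)
        \<le> (norm (eq_channel net M v w P f g *v u))\<^sup>2"
    using eq_channel_lower[OF pi channel full_rank] by blast
  obtain \<delta> where \<delta>: "\<delta> > 0" "\<forall>i. \<forall>a\<in>alphabet net i. \<forall>b\<in>alphabet net i. a \<noteq> b \<longrightarrow> \<delta> \<le> \<bar>a - b\<bar>"
    using alphabet_separation[of "alphabet net"] fin by blast
  have "emeasure M {\<omega> \<in> space M. dec P f g (received net P f g (v \<omega>) (w \<omega>) x) \<noteq> x} \<le>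
        ennreal (2 * CARD('k) * exp (- (\<delta>\<^sup>2 * \<kappa> / 8 * P * (\<Sum>j\<in>UNIV. (norm (f $ j))\<^sup>2 * (norm (g $ j))\<^sup>2) / (1 + (norm g)\<^sup>2))))"
    if P: "P \<ge> 1" and x: "x \<in> signal_set net" for P f g x
  proof -
    let ?G = "eq_channel net M v w P f g" and ?\<Gamma> = "noise_cov net M v w P g"
    let ?r = "\<kappa> * P * (\<Sum>j\<in>UNIV. (norm (f $ j))\<^sup>2 * (norm (g $ j))\<^sup>2) / (1 + (norm g)\<^sup>2)"
    define n where "n = (\<lambda>\<omega>. inv_sqrt_mat ?\<Gamma> *v vec_tilde (total_noise net P g (v \<omega>) (w \<omega>)))"
    \<comment> \<open>The directions are fixed here for the given gains, before any noise sample;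
      this makes the components below linear in the noise.\<close>
    obtain U where U: "\<And>i. U i $ i = 1"
      "\<And>x n xh. (\<forall>i. x $ i \<in> alphabet net i) \<Longrightarrow> out ?G (?G *v x + n) xh \<Longrightarrow> xh \<noteq> x \<Longrightarrow>
         \<exists>i. \<delta> / 2 * (norm (?G *v U i))\<^sup>2 \<le> \<bar>(?G *v U i) \<bullet> n\<bar>"
      using out[unfolded noise_directed_def, THEN spec, THEN mp, OF less_imp_le[OF \<delta>(1)], THEN mp,
          OF \<delta>(2), THEN spec, of ?G] by blast
    \<comment> \<open>Applying the inverse root on both sides of an inner product amounts to
      applying the inverse covariance on one side, so \<open>c i\<close> represents the whitened
      noise along direction \<open>i\<close> in terms of the original sources.\<close>
    define c where "c = (\<lambda>i. noise_coeff net P g (matrix_inv ?\<Gamma> *v (eq_channel_raw net P f g *v U i)))"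
    let ?Z = "\<lambda>i \<omega>. \<Sum>s\<in>UNIV. c i s \<bullet> source_var f0 g0 v w s \<omega>"
    note spd = noise_cov_sym_pos_def[OF channel, of net P g]
    have q: "?G *v u = inv_sqrt_mat ?\<Gamma> *v (eq_channel_raw net P f g *v u)" for u
      by (simp add: eq_channel_def matrix_vector_mul_assoc)
    have qn: "(?G *v U i) \<bullet> n \<omega> = ?Z i \<omega>" for i \<omega>
      unfolding q n_def inv_sqrt_mat_inner[OF spd] c_def by (rule inner_total_noise)
    \<comment> \<open>This is whiteness of the noise: its component along a vector has the squared
      norm of that vector as variance.\<close>
    have qq: "(norm (?G *v U i))\<^sup>2 = (\<Sum>s\<in>UNIV. (norm (c i s))\<^sup>2) / 2" for i
    proof -
      have cancel: "?\<Gamma> *v (matrix_inv ?\<Gamma> *v y) = y" for y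
        by (simp only: matrix_vector_mul_assoc matrix_inv_cancel(1)[OF sym_pos_def_matrix_inv(1)[OF spd]]
            matrix_vector_mul_lid)
      have "(norm (?G *v U i))\<^sup>2 = (matrix_inv ?\<Gamma> *v (eq_channel_raw net P f g *v U i)) \<bullet>
          (?\<Gamma> *v (matrix_inv ?\<Gamma> *v (eq_channel_raw net P f g *v U i)))"
        unfolding q power2_norm_eq_inner inv_sqrt_mat_inner[OF spd] cancel ..
      then show ?thesis
        unfolding noise_cov_inner[OF channel] c_def by (simp add: power2_norm_eq_inner)
    qed
    have sub: "{\<omega> \<in> space M. dec P f g (received net P f g (v \<omega>) (w \<omega>) x) \<noteq> x} \<subseteq>
      (\<Union>i. {\<omega> \<in> space M. \<delta> / 2 * ((\<Sum>s\<in>UNIV. (norm (c i s))\<^sup>2) / 2) \<le> \<bar>?Z i \<omega>\<bar>})"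
    proof safe
      fix \<omega> assume "\<omega> \<in> space M" and err: "dec P f g (received net P f g (v \<omega>) (w \<omega>) x) \<noteq> x"
      have "out ?G (?G *v x + n \<omega>) (dec P f g (received net P f g (v \<omega>) (w \<omega>) x))"
        using dec[of P f g "received net P f g (v \<omega>) (w \<omega>) x"] P by (simp add: eq_received_received n_def)
      moreover have "\<forall>i. x $ i \<in> alphabet net i"
        using x by (simp add: signal_set_def)
      ultimately obtain i where "\<delta> / 2 * (norm (?G *v U i))\<^sup>2 \<le> \<bar>(?G *v U i) \<bullet> n \<omega>\<bar>"
        using U(2) err by blast
      then show "\<omega> \<in> (\<Union>i. {\<omega> \<in> space M. \<delta> / 2 * ((\<Sum>s\<in>UNIV. (norm (c i s))\<^sup>2) / 2) \<le> \<bar>?Z i \<omega>\<bar>})"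
        using \<open>\<omega> \<in> space M\<close> unfolding qq qn by blast
    qed
    have "emeasure M {\<omega> \<in> space M. dec P f g (received net P f g (v \<omega>) (w \<omega>) x) \<noteq> x} \<le>
        emeasure M (\<Union>i. {\<omega> \<in> space M. \<delta> / 2 * ((\<Sum>s\<in>UNIV. (norm (c i s))\<^sup>2) / 2) \<le> \<bar>?Z i \<omega>\<bar>})"
      by (rule emeasure_mono[OF sub]) measurable
    also have "\<dots> \<le> (\<Sum>i\<in>UNIV. emeasure M {\<omega> \<in> space M. \<delta> / 2 * ((\<Sum>s\<in>UNIV. (norm (c i s))\<^sup>2) / 2) \<le> \<bar>?Z i \<omega>\<bar>})"
      by (intro emeasure_subadditive_finite) auto
    also have "\<dots> \<le> (\<Sum>i\<in>(UNIV::'k set). ennreal (2 * exp (- \<delta>\<^sup>2 * ?r / 8)))"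
    proof (rule sum_mono)
      fix i
      have "emeasure M {\<omega> \<in> space M. \<delta> / 2 * ((\<Sum>s\<in>UNIV. (norm (c i s))\<^sup>2) / 2) \<le> \<bar>?Z i \<omega>\<bar>} \<le>
          ennreal (2 * exp (- \<delta>\<^sup>2 * ((\<Sum>s\<in>UNIV. (norm (c i s))\<^sup>2) / 2) / 8))"
        using \<delta>(1) by (intro gaussian_tail finite_source ind std) auto
      also have "\<dots> \<le> ennreal (2 * exp (- \<delta>\<^sup>2 * ?r / 8))"
      proof -
        have "exp (- \<delta>\<^sup>2 * b / 8) \<le> exp (- \<delta>\<^sup>2 * a / 8)" if "a \<le> b" for a b :: real
          using that by (simp add: mult_left_mono)
        from this[OF \<kappa>(2)[OF P U(1), of f g]] show ?thesis
          unfolding qq[symmetric] by (intro ennreal_leI mult_left_mono) auto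
      qed
      finally show "emeasure M {\<omega> \<in> space M. \<delta> / 2 * ((\<Sum>s\<in>UNIV. (norm (c i s))\<^sup>2) / 2) \<le> \<bar>?Z i \<omega>\<bar>} \<le>
          ennreal (2 * exp (- \<delta>\<^sup>2 * ?r / 8))" .
    qed
    also have "\<dots> = ennreal (2 * CARD('k) * exp (- (\<delta>\<^sup>2 * \<kappa> / 8 * P *
        (\<Sum>j\<in>UNIV. (norm (f $ j))\<^sup>2 * (norm (g $ j))\<^sup>2) / (1 + (norm g)\<^sup>2))))"
      by (simp add: sum_ennreal ennreal_of_nat_eq_real_of_nat ennreal_mult[symmetric] mult_ac)
    finally show ?thesis .
  qed
  moreover have "\<delta>\<^sup>2 * \<kappa> / 8 > 0" using \<kappa>(1) \<delta>(1) by simp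
  ultimately show ?thesis using that by blast
qed

section \<open>Outage integrals\<close>

definition exp_dist :: "real measure" where
  "exp_dist = density lborel (exponential_density 1)"

lemma prob_space_exp_dist: "prob_space exp_dist"
  unfolding exp_dist_def by (rule prob_space_exponential_density) simp

lemma sets_exp_dist [measurable_cong, simp]: "sets exp_dist = sets borel"
  by (simp add: exp_dist_def)

lemma nn_integral_exp_dist:
  assumes [measurable]: "F \<in> borel_measurable borel"
  shows "(\<integral>\<^sup>+s. F s \<partial>exp_dist) = (\<integral>\<^sup>+s. ennreal (exp (- s)) * F s * indicator {0..} s \<partial>lborel)"
proof -
  have "(\<integral>\<^sup>+s. F s \<partial>exp_dist) = (\<integral>\<^sup>+s. ennreal (exponential_density 1 s) * F s \<partial>lborel)"
    unfolding exp_dist_def by (rule nn_integral_density) auto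
  also have "\<dots> = (\<integral>\<^sup>+s. ennreal (exp (- s)) * F s * indicator {0..} s \<partial>lborel)"
    by (intro nn_integral_cong) (auto simp: exponential_density_def split: split_indicator)
  finally show ?thesis .
qed

text \<open>
  The distribution lives on \<open>s \<ge> 0\<close>; the absolute value keeps the Gaussian integrals convergent for
  all \<open>s\<close> when the order of integration is exchanged.
\<close>

lemma laplace_exp_dist:
  assumes "c \<ge> 0"
  shows "(\<integral>\<^sup>+s. ennreal (exp (- (c * \<bar>s\<bar>))) \<partial>exp_dist) = ennreal (1 / (1 + c))"
proof -
  have "(\<integral>\<^sup>+s. ennreal (exp (- (c * \<bar>s\<bar>))) \<partial>exp_dist) =
      (\<integral>\<^sup>+s. ennreal (exp (- ((1 + c) * s))) * indicator {0..} s \<partial>lborel)"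
    by (subst nn_integral_exp_dist)
      (auto intro!: nn_integral_cong simp: ennreal_mult[symmetric] mult_exp_exp algebra_simps split: split_indicator)
  also have "\<dots> = (\<integral>\<^sup>+s. ennreal (1 / (1 + c)) * ennreal (exponential_density (1 + c) s) \<partial>lborel)"
    using assms by (intro nn_integral_cong)
      (auto simp: exponential_density_def ennreal_mult[symmetric] mult_ac split: split_indicator)
  also have "\<dots> = ennreal (1 / (1 + c)) * (\<integral>\<^sup>+s. ennreal (exponential_density (1 + c) s) \<partial>lborel)"
    by (rule nn_integral_cmult) auto
  also have "(\<integral>\<^sup>+s. ennreal (exponential_density (1 + c) s) \<partial>lborel) = 1"
  proof -
    have "prob_space (density lborel (exponential_density (1 + c)))"
      using assms by (intro prob_space_exponential_density) simp
    from prob_space.emeasure_space_1[OF this] show ?thesis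
      by (simp add: emeasure_density)
  qed
  finally show ?thesis by simp
qed

text \<open>The antiderivative vanishes at infinity. Convergence without an exponential weight is
  what spares the case of several antennas the logarithm.\<close>

lemma nn_integral_inverse_sq:
  assumes a: "a > 0"
  shows "(\<integral>\<^sup>+s. ennreal ((1 / (1 / 2 + a * s))\<^sup>2) * indicator {0..} s \<partial>lborel) = ennreal (2 / a)"
proof -
  let ?F = "\<lambda>s. - (1 / (a * (1 / 2 + a * s)))"
  have pos: "1 / 2 + a * s > 0" if "s \<ge> 0" for s
    using a that by (simp add: add_pos_nonneg)
  have "(\<integral>\<^sup>+s. ennreal ((1 / (1 / 2 + a * s))\<^sup>2) * indicator {0..} s \<partial>lborel) = ennreal (0 - ?F 0)"
  proof (rule nn_integral_FTC_atLeast)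
    show "DERIV ?F s :> (1 / (1 / 2 + a * s))\<^sup>2" if "0 \<le> s" for s
      using a pos[OF that] by (auto intro!: derivative_eq_intros simp: power2_eq_square divide_simps)
    have "filterlim (\<lambda>s. a * (1 / 2 + a * s)) at_top at_top"
      using a by (intro filterlim_tendsto_pos_mult_at_top[OF tendsto_const]
          filterlim_tendsto_add_at_top[OF tendsto_const] filterlim_ident)
    then have "((\<lambda>s. 1 / (a * (1 / 2 + a * s))) \<longlongrightarrow> 0) at_top"
      by (intro tendsto_divide_0[OF tendsto_const] filterlim_at_top_imp_at_infinity)
    from tendsto_minus[OF this] show "(?F \<longlongrightarrow> 0) at_top" by simp
  qed auto
  then show ?thesis by simp
qed

text \<open>Over the half-line this integral diverges logarithmically, so it is taken only up to
  1.\<close>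

lemma nn_integral_inverse_interval:
  assumes a: "a > 0"
  shows "(\<integral>\<^sup>+s. ennreal (1 / (1 / 2 + a * s)) * indicator {0..1} s \<partial>lborel) = ennreal (ln (1 + 2 * a) / a)"
proof -
  let ?F = "\<lambda>s. ln (1 + 2 * a * s) / a"
  have pos: "1 + 2 * a * s > 0" if "s \<ge> 0" for s
    using a that by (simp add: add_pos_nonneg)
  have "(\<integral>\<^sup>+s. ennreal (1 / (1 / 2 + a * s)) * indicator {0..1} s \<partial>lborel) = ennreal (?F 1 - ?F 0)"
  proof (rule nn_integral_FTC_Icc)
    show "DERIV ?F s :> 1 / (1 / 2 + a * s)" if "s \<in> {0..1}" for s
      using a pos[of s] that by (auto intro!: derivative_eq_intros simp: divide_simps)
    show "0 \<le> 1 / (1 / 2 + a * s)" if "s \<in> {0..1}" for s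
      using a that by simp
  qed auto
  then show ?thesis by simp
qed

text \<open>The integral is split at \<open>s = 1\<close>. Up to there the weight
  \<open>exp (- s)\<close> is bounded by 1, which gives the logarithm; beyond it the fraction is at
  most \<open>1 / a\<close> and the weight has total mass 1.\<close>

lemma outage_integral_single:
  assumes a: "a > 0"
  shows "(\<integral>\<^sup>+s. ennreal (1 / (1 / 2 + a * \<bar>s\<bar>)) \<partial>exp_dist) \<le> ennreal ((ln (1 + 2 * a) + 1) / a)"
proof -
  have "(\<integral>\<^sup>+s. ennreal (1 / (1 / 2 + a * \<bar>s\<bar>)) \<partial>exp_dist) =
      (\<integral>\<^sup>+s. ennreal (exp (- s)) * ennreal (1 / (1 / 2 + a * \<bar>s\<bar>)) * indicator {0..} s \<partial>lborel)"
    by (rule nn_integral_exp_dist) measurable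
  also have "\<dots> \<le> (\<integral>\<^sup>+s. ennreal (1 / (1 / 2 + a * s)) * indicator {0..1} s +
      ennreal (1 / a) * (ennreal (exp (- s)) * 1 * indicator {0..} s) \<partial>lborel)"
  proof (rule nn_integral_mono)
    fix s :: real
    consider "s < 0" | "0 \<le> s" "s \<le> 1" | "1 < s" by linarith
    then show "ennreal (exp (- s)) * ennreal (1 / (1 / 2 + a * \<bar>s\<bar>)) * indicator {0..} s \<le>
        ennreal (1 / (1 / 2 + a * s)) * indicator {0..1} s +
        ennreal (1 / a) * (ennreal (exp (- s)) * 1 * indicator {0..} s)"
    proof cases
      case 2
      then have "exp (- s) * (1 / (1 / 2 + a * s)) \<le> 1 * (1 / (1 / 2 + a * s))"
        using a by (intro mult_right_mono) auto
      then show ?thesis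
        using 2 a by (auto simp: ennreal_mult[symmetric] intro!: add_increasing2 ennreal_leI)
    next
      case 3
      have "a * 1 \<le> a * s" using 3 a by (intro mult_left_mono) auto
      then have "a \<le> 1 / 2 + a * s" by simp
      then have "1 / (1 / 2 + a * s) \<le> 1 / a"
        using a 3 by (intro divide_left_mono) (auto intro!: mult_pos_pos add_pos_pos)
      then have "exp (- s) * (1 / (1 / 2 + a * s)) \<le> 1 / a * exp (- s)"
        by (subst mult.commute) (intro mult_right_mono, auto)
      then show ?thesis
        using 3 a by (auto simp: ennreal_mult[symmetric] intro!: ennreal_leI)
    qed auto
  qed
  also have "\<dots> = ennreal (ln (1 + 2 * a) / a) + ennreal (1 / a) * (\<integral>\<^sup>+s. 1 \<partial>exp_dist)"
    by (subst nn_integral_add, measurable, subst nn_integral_cmult, measurable)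
      (simp only: nn_integral_inverse_interval[OF a] nn_integral_exp_dist[OF borel_measurable_const])
  also have "(\<integral>\<^sup>+s. 1 \<partial>exp_dist) = 1"
    using prob_space.emeasure_space_1[OF prob_space_exp_dist] by simp
  also have "ennreal (ln (1 + 2 * a) / a) + ennreal (1 / a) * 1 = ennreal ((ln (1 + 2 * a) + 1) / a)"
    using a by (simp add: ennreal_plus[symmetric] add_divide_distrib del: ennreal_plus)
  finally show ?thesis .
qed

text \<open>The fraction never exceeds 2, so \<open>d - 2\<close> of its powers cost a constant and
  the remaining square is integrable.\<close>

lemma outage_integral_multiple:
  assumes a: "a > 0" and d: "d \<ge> 2"
  shows "(\<integral>\<^sup>+s. ennreal ((1 / (1 / 2 + a * \<bar>s\<bar>)) ^ d) \<partial>exp_dist) \<le> ennreal (2 ^ (d - 1) / a)"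
proof -
  have "(\<integral>\<^sup>+s. ennreal ((1 / (1 / 2 + a * \<bar>s\<bar>)) ^ d) \<partial>exp_dist) =
      (\<integral>\<^sup>+s. ennreal (exp (- s)) * ennreal ((1 / (1 / 2 + a * \<bar>s\<bar>)) ^ d) * indicator {0..} s \<partial>lborel)"
    by (rule nn_integral_exp_dist) measurable
  also have "\<dots> \<le> (\<integral>\<^sup>+s. ennreal (2 ^ (d - 2)) * (ennreal ((1 / (1 / 2 + a * s))\<^sup>2) * indicator {0..} s) \<partial>lborel)"
  proof (rule nn_integral_mono)
    fix s :: real
    have "exp (- s) * (1 / (1 / 2 + a * s)) ^ d \<le> 2 ^ (d - 2) * (1 / (1 / 2 + a * s))\<^sup>2" if s: "s \<ge> 0"
    proof -
      let ?r = "1 / (1 / 2 + a * s)"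
      have r: "0 \<le> ?r" "?r \<le> 2"
        using a s by (auto simp: divide_simps add_pos_nonneg)
      have "exp (- s) * ?r ^ d \<le> 1 * ?r ^ d"
        using s r by (intro mult_right_mono) auto
      also have "\<dots> = ?r ^ (d - 2) * ?r\<^sup>2"
        by (simp only: mult_1 power_add[symmetric] le_add_diff_inverse2[OF d])
      also have "\<dots> \<le> 2 ^ (d - 2) * ?r\<^sup>2"
        using r by (intro mult_right_mono power_mono) auto
      finally show ?thesis .
    qed
    then show "ennreal (exp (- s)) * ennreal ((1 / (1 / 2 + a * \<bar>s\<bar>)) ^ d) * indicator {0..} s \<le>
        ennreal (2 ^ (d - 2)) * (ennreal ((1 / (1 / 2 + a * s))\<^sup>2) * indicator {0..} s)"
      using a by (auto simp: ennreal_mult[symmetric] intro!: ennreal_leI split: split_indicator)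
  qed
  also have "\<dots> = ennreal (2 ^ (d - 2)) * ennreal (2 / a)"
    by (subst nn_integral_cmult) (simp_all only: nn_integral_inverse_sq[OF a], measurable)
  also have "\<dots> = ennreal (2 ^ (d - 1) / a)"
  proof -
    have "(2::real) ^ (d - 1) = 2 ^ (d - 2) * 2"
      using d by (metis Suc_1 Suc_diff_le diff_Suc_Suc mult.commute power_Suc)
    then show ?thesis using a by (simp add: ennreal_mult[symmetric])
  qed
  finally show ?thesis .
qed

text \<open>Replacing the sum shared by all relays by a product separates them, so that the average
  over the independent rows of \<open>g\<close> can factorise.\<close>

lemma one_plus_sum_le_prod:
  assumes "finite A" "\<And>i. i \<in> A \<Longrightarrow> x i \<ge> (0::real)"
  shows "1 + sum x A \<le> (\<Prod>i\<in>A. 1 + x i)"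
  using assms
proof (induction A)
  case (insert i A)
  have "0 \<le> x i * sum x A"
    using insert.prems by (intro mult_nonneg_nonneg sum_nonneg) auto
  then have "1 + sum x (insert i A) \<le> (1 + x i) * (1 + sum x A)"
    using insert.hyps by (simp add: algebra_simps)
  also have "\<dots> \<le> (1 + x i) * (\<Prod>i\<in>A. 1 + x i)"
    using insert by (intro mult_left_mono insert.IH) auto
  finally show ?case using insert.hyps by simp
qed simp

text \<open>The constant comes from \<open>(1 + y) ^ N \<le> (2 * N) ^ N * exp (y / 2)\<close>.\<close>

lemma outage_factor_bound:
  fixes x :: "'n::finite \<Rightarrow> real"
  assumes a: "a \<ge> 0" and x: "\<And>j. x j \<ge> 0"
  defines "N \<equiv> CARD('n)"
  shows "(\<Prod>j\<in>UNIV. 1 / (1 + a * x j / (1 + sum x UNIV))) \<le>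
    ((2 * real N) ^ N) ^ N * (\<Prod>j\<in>UNIV. exp (x j / 2) * (1 / (1 + a * x j)))"
proof -
  let ?S = "1 + sum x UNIV"
  have N: "N > 0" by (simp add: N_def)
  have S: "?S \<ge> 1" using x by (simp add: sum_nonneg)
  have pos: "1 + a * x j > 0" for j using a x[of j] by (simp add: add_pos_nonneg)
  have "(\<Prod>j\<in>UNIV. 1 / (1 + a * x j / ?S)) \<le> (\<Prod>j\<in>UNIV. ?S * (1 / (1 + a * x j)))"
  proof (intro prod_mono conjI)
    fix j
    show "0 \<le> 1 / (1 + a * x j / ?S)"
      using a x[of j] S by simp
    have "1 / (1 + a * x j / ?S) = ?S / (?S + a * x j)"
      using S a x[of j] by (simp add: field_simps)
    also have "\<dots> \<le> ?S / (1 + a * x j)"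
      using S pos[of j] by (intro divide_left_mono) (auto intro!: mult_pos_pos)
    finally show "1 / (1 + a * x j / ?S) \<le> ?S * (1 / (1 + a * x j))" by simp
  qed
  also have "\<dots> = ?S ^ N * (\<Prod>j\<in>UNIV. 1 / (1 + a * x j))"
    by (simp only: prod.distrib prod_constant N_def)
  also have "\<dots> \<le> (\<Prod>j\<in>UNIV. 1 + x j) ^ N * (\<Prod>j\<in>UNIV. 1 / (1 + a * x j))"
    using one_plus_sum_le_prod[of UNIV x] x S pos
    by (intro mult_right_mono power_mono prod_nonneg) (auto simp: less_imp_le)
  also have "\<dots> \<le> ((2 * real N) ^ N) ^ N * (\<Prod>j\<in>UNIV. exp (x j / 2)) * (\<Prod>j\<in>UNIV. 1 / (1 + a * x j))"
  proof (rule mult_right_mono)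
    have "(\<Prod>j\<in>UNIV. 1 + x j) ^ N = (\<Prod>j\<in>UNIV. (1 + x j) ^ N)"
      by (simp add: prod_power_distrib)
    also have "\<dots> \<le> (\<Prod>j\<in>UNIV. (2 * real N) ^ N * exp (x j / 2))"
    proof (intro prod_mono conjI)
      fix j
      show "0 \<le> (1 + x j) ^ N" using x[of j] by simp
      \<comment> \<open>The scale \<open>2 * N\<close> is chosen so that the N-th power has exponent
        \<open>x j / 2\<close>, half the rate at which the exponential moment of a squared Gaussian
        modulus becomes infinite.\<close>
      have "1 + x j \<le> 2 * real N * (1 + x j / (2 * real N))"
        using N x[of j] by (simp add: algebra_simps)
      also have "\<dots> \<le> 2 * real N * exp (x j / (2 * real N))"
        by (intro mult_left_mono exp_ge_add_one_self) auto
      finally have "(1 + x j) ^ N \<le> (2 * real N * exp (x j / (2 * real N))) ^ N"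
        using x[of j] by (intro power_mono) auto
      also have "\<dots> = (2 * real N) ^ N * exp (real N * (x j / (2 * real N)))"
        by (simp only: power_mult_distrib exp_of_nat_mult)
      also have "real N * (x j / (2 * real N)) = x j / 2"
        using N by simp
      finally show "(1 + x j) ^ N \<le> (2 * real N) ^ N * exp (x j / 2)" by simp
    qed
    also have "\<dots> = ((2 * real N) ^ N) ^ N * (\<Prod>j\<in>UNIV. exp (x j / 2))"
      by (simp only: prod.distrib prod_constant N_def)
    finally show "(\<Prod>j\<in>UNIV. 1 + x j) ^ N \<le> ((2 * real N) ^ N) ^ N * (\<Prod>j\<in>UNIV. exp (x j / 2))" .
    show "0 \<le> (\<Prod>j\<in>UNIV. 1 / (1 + a * x j))"
      using pos by (intro prod_nonneg) (auto simp: less_imp_le)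
  qed
  finally show ?thesis by (simp only: prod.distrib mult.assoc)
qed

lemma borel_measurable_vecI:
  fixes F :: "'w \<Rightarrow> 'b::euclidean_space ^ 'i"
  assumes "\<And>i. (\<lambda>x. F x $ i) \<in> borel_measurable M"
  shows "F \<in> borel_measurable M"
proof (subst borel_measurable_euclidean_space, intro ballI)
  fix b :: "'b ^ 'i" assume "b \<in> Basis"
  then obtain i u where "b = axis i u" by (auto simp: Basis_vec_def)
  moreover have "(\<lambda>x. F x $ i \<bullet> u) \<in> borel_measurable M"
    using assms by measurable
  ultimately show "(\<lambda>x. F x \<bullet> b) \<in> borel_measurable M"
    by (simp add: inner_axis)
qed

section \<open>Averaging over the gains\<close>

lemma channel_model_measurable:
  assumes "channel_model M f g v w"
  shows "source_var f g v w s \<in> borel_measurable M"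
    "(\<lambda>\<omega>. f \<omega> $ j) \<in> borel_measurable M" "(\<lambda>\<omega>. g \<omega> $ j $ l) \<in> borel_measurable M"
proof -
  interpret prob_space M using assms by (simp add: channel_model_def)
  have *: "source_var f g v w s \<in> borel_measurable M" for s
    using assms by (auto simp: channel_model_def indep_vars_def)
  show "source_var f g v w s \<in> borel_measurable M" by (rule *)
  show "(\<lambda>\<omega>. f \<omega> $ j) \<in> borel_measurable M" "(\<lambda>\<omega>. g \<omega> $ j $ l) \<in> borel_measurable M"
    using *[of "Source_Gain j"] *[of "Dest_Gain j l"] by simp_all
qed

lemma nn_integral_source_gains:
  fixes f :: "'w \<Rightarrow> complex ^ 'n::finite" and g :: "'w \<Rightarrow> complex ^ ('d::finite) ^ 'n"
    and v :: "'w \<Rightarrow> complex ^ 't1::finite ^ 'n" and w :: "'w \<Rightarrow> complex ^ 't2::finite ^ 'd"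
  assumes channel: "channel_model M f g v w" and b: "\<And>j. b j \<ge> 0"
  shows "(\<integral>\<^sup>+\<omega>. ennreal (exp (- (\<Sum>j\<in>UNIV. b j * (norm (f \<omega> $ j))\<^sup>2))) \<partial>M) =
    ennreal (\<Prod>j\<in>UNIV. 1 / (1 + b j))"
proof -
  interpret prob_space M using channel by (simp add: channel_model_def)
  have ind: "indep_vars (\<lambda>_. borel) (source_var f g v w) UNIV"
    and std: "\<And>s. std_complex_gaussian M (source_var f g v w s)"
    using channel by (auto simp: channel_model_def)
  \<comment> \<open>Sources other than the first-hop gains get weight 0 and contribute a factor
    1.\<close>
  let ?b = "\<lambda>s :: ('n, 'd, 't1, 't2) source. case s of Source_Gain j \<Rightarrow> b j | _ \<Rightarrow> 0"
  have "(\<integral>\<^sup>+\<omega>. ennreal (exp (- (\<Sum>j\<in>UNIV. b j * (norm (f \<omega> $ j))\<^sup>2))) \<partial>M) =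
      (\<integral>\<^sup>+\<omega>. ennreal (exp (\<Sum>s\<in>UNIV. 0 \<bullet> source_var f g v w s \<omega> - ?b s * (norm (source_var f g v w s \<omega>))\<^sup>2)) \<partial>M)"
    by (simp add: sum.over_source sum_negf)
  also have "\<dots> = ennreal (\<Prod>s\<in>UNIV. exp ((norm (0::complex))\<^sup>2 / (4 * (1 + ?b s))) / (1 + ?b s))"
    using b by (intro nn_integral_exp_gaussian_family finite_source ind std)
      (auto split: source.split intro: less_le_trans[of "-1" 0])
  also have "\<dots> = ennreal (\<Prod>j\<in>UNIV. 1 / (1 + b j))"
    by (simp add: prod.over_source)
  finally show ?thesis .
qed

lemma nn_integral_dest_gains:
  fixes f :: "'w \<Rightarrow> complex ^ 'n::finite" and g :: "'w \<Rightarrow> complex ^ ('d::finite) ^ 'n"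
    and v :: "'w \<Rightarrow> complex ^ 't1::finite ^ 'n" and w :: "'w \<Rightarrow> complex ^ 't2::finite ^ 'd"
  assumes channel: "channel_model M f g v w" and b: "\<And>j. b j > -1"
  shows "(\<integral>\<^sup>+\<omega>. ennreal (exp (- (\<Sum>j\<in>UNIV. b j * (norm (g \<omega> $ j))\<^sup>2))) \<partial>M) =
    ennreal (\<Prod>j\<in>UNIV. (1 / (1 + b j)) ^ CARD('d))"
proof -
  interpret prob_space M using channel by (simp add: channel_model_def)
  have ind: "indep_vars (\<lambda>_. borel) (source_var f g v w) UNIV"
    and std: "\<And>s. std_complex_gaussian M (source_var f g v w s)"
    using channel by (auto simp: channel_model_def)
  let ?b = "\<lambda>s :: ('n, 'd, 't1, 't2) source. case s of Dest_Gain j l \<Rightarrow> b j | _ \<Rightarrow> 0"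
  have "(norm (g \<omega> $ j))\<^sup>2 = (\<Sum>l\<in>UNIV. (norm (g \<omega> $ j $ l))\<^sup>2)" for \<omega> j
    by (simp add: norm_vec_def L2_set_def sum_nonneg)
  then have "(\<integral>\<^sup>+\<omega>. ennreal (exp (- (\<Sum>j\<in>UNIV. b j * (norm (g \<omega> $ j))\<^sup>2))) \<partial>M) =
      (\<integral>\<^sup>+\<omega>. ennreal (exp (\<Sum>s\<in>UNIV. 0 \<bullet> source_var f g v w s \<omega> - ?b s * (norm (source_var f g v w s \<omega>))\<^sup>2)) \<partial>M)"
    by (simp add: sum.over_source sum_negf sum_distrib_left)
  also have "\<dots> = ennreal (\<Prod>s\<in>UNIV. exp ((norm (0::complex))\<^sup>2 / (4 * (1 + ?b s))) / (1 + ?b s))"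
    using b by (intro nn_integral_exp_gaussian_family finite_source ind std) (auto split: source.split)
  also have "\<dots> = ennreal (\<Prod>j\<in>UNIV. (1 / (1 + b j)) ^ CARD('d))"
    by (simp add: prod.over_source)
  finally show ?thesis .
qed

lemma nn_integral_outage_product:
  fixes g :: "'w \<Rightarrow> complex ^ ('d::finite) ^ ('n::finite)"
  assumes channel: "channel_model M f g v w" and a: "a > 0"
  shows "(\<integral>\<^sup>+\<omega>. ennreal (\<Prod>j\<in>UNIV. exp ((norm (g \<omega> $ j))\<^sup>2 / 2) * (1 / (1 + a * (norm (g \<omega> $ j))\<^sup>2))) \<partial>M) =
    (\<integral>\<^sup>+s. ennreal ((1 / (1 / 2 + a * \<bar>s\<bar>)) ^ CARD('d)) \<partial>exp_dist) ^ CARD('n)"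
proof -
  interpret prob_space M using channel by (simp add: channel_model_def)
  interpret E: prob_space exp_dist by (rule prob_space_exp_dist)
  interpret P: product_prob_space "\<lambda>_::'n. exp_dist" UNIV ..
  interpret Q: pair_sigma_finite M "PiM UNIV (\<lambda>_::'n. exp_dist)" ..
  note [measurable] = channel_model_measurable(3)[OF channel]
  define \<gamma> where "\<gamma> = (\<lambda>j \<omega>. (norm (g \<omega> $ j))\<^sup>2)"
  have [measurable]: "\<gamma> j \<in> borel_measurable M" for j
  proof -
    have "\<gamma> j = (\<lambda>\<omega>. \<Sum>l\<in>UNIV. (norm (g \<omega> $ j $ l))\<^sup>2)"
      by (simp add: \<gamma>_def norm_vec_def L2_set_def sum_nonneg)
    then show ?thesis by simp
  qed
  have \<gamma>: "\<gamma> j \<omega> \<ge> 0" for j \<omega> by (simp add: \<gamma>_def)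
  let ?e = "\<lambda>j \<omega> s. ennreal (exp (\<gamma> j \<omega> / 2)) * ennreal (exp (- (a * \<gamma> j \<omega> * \<bar>s\<bar>)))"
  have "ennreal (\<Prod>j\<in>UNIV. exp (\<gamma> j \<omega> / 2) * (1 / (1 + a * \<gamma> j \<omega>))) =
      (\<integral>\<^sup>+S. (\<Prod>j\<in>UNIV. ?e j \<omega> (S j)) \<partial>PiM UNIV (\<lambda>_::'n. exp_dist))" for \<omega>
  proof -
    have "(\<integral>\<^sup>+s. ?e j \<omega> s \<partial>exp_dist) = ennreal (exp (\<gamma> j \<omega> / 2) * (1 / (1 + a * \<gamma> j \<omega>)))" for j
      using a \<gamma>[of j \<omega>] by (subst nn_integral_cmult, measurable, subst laplace_exp_dist)
        (auto simp: ennreal_mult[symmetric])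
    then have "(\<Prod>j\<in>UNIV. \<integral>\<^sup>+s. ?e j \<omega> s \<partial>exp_dist) = ennreal (\<Prod>j\<in>UNIV. exp (\<gamma> j \<omega> / 2) * (1 / (1 + a * \<gamma> j \<omega>)))"
      using a \<gamma> by (simp add: prod_ennreal)
    then show ?thesis
      by (subst P.product_nn_integral_prod) auto
  qed
  then have "(\<integral>\<^sup>+\<omega>. ennreal (\<Prod>j\<in>UNIV. exp (\<gamma> j \<omega> / 2) * (1 / (1 + a * \<gamma> j \<omega>))) \<partial>M) =
      (\<integral>\<^sup>+\<omega>. (\<integral>\<^sup>+S. (\<Prod>j\<in>UNIV. ?e j \<omega> (S j)) \<partial>PiM UNIV (\<lambda>_::'n. exp_dist)) \<partial>M)"
    by simp
  \<comment> \<open>Tonelli: the auxiliary exponential variables become the outer ones, and for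
    fixed \<open>S\<close> the integrand is the exponential of a quadratic form in
    \<open>g\<close>.\<close>
  also have "\<dots> = (\<integral>\<^sup>+S. (\<integral>\<^sup>+\<omega>. (\<Prod>j\<in>UNIV. ?e j \<omega> (S j)) \<partial>M) \<partial>PiM UNIV (\<lambda>_::'n. exp_dist))"
    by (rule Q.Fubini'[symmetric]) measurable
  also have "\<dots> = (\<integral>\<^sup>+S. (\<Prod>j\<in>UNIV. ennreal ((1 / (1 / 2 + a * \<bar>S j\<bar>)) ^ CARD('d))) \<partial>PiM UNIV (\<lambda>_::'n. exp_dist))"
  proof (rule nn_integral_cong)
    fix S :: "'n \<Rightarrow> real"
    have nn: "a * \<bar>S j\<bar> \<ge> 0" for j using a by simp
    \<comment> \<open>The two exponentials combine to weight
      \<open>a * \<bar>S j\<bar> - 1 / 2\<close>; adding the 1 of the Gaussian integral yields the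
      denominator \<open>1 / 2 + a * \<bar>S j\<bar>\<close>.\<close>
    have "(\<Prod>j\<in>UNIV. ?e j \<omega> (S j)) = ennreal (exp (- (\<Sum>j\<in>UNIV. (a * \<bar>S j\<bar> - 1 / 2) * \<gamma> j \<omega>)))" for \<omega>
      by (simp add: ennreal_mult[symmetric] prod_ennreal mult_exp_exp exp_sum[symmetric] sum_negf[symmetric]
          algebra_simps)
    then have "(\<integral>\<^sup>+\<omega>. (\<Prod>j\<in>UNIV. ?e j \<omega> (S j)) \<partial>M) =
        ennreal (\<Prod>j\<in>UNIV. (1 / (1 + (a * \<bar>S j\<bar> - 1 / 2))) ^ CARD('d))"
      unfolding \<gamma>_def using nn by (simp only:, intro nn_integral_dest_gains[OF channel])
        (auto intro: less_le_trans[of _ "-1/2"])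
    also have "\<dots> = (\<Prod>j\<in>UNIV. ennreal ((1 / (1 / 2 + a * \<bar>S j\<bar>)) ^ CARD('d)))"
      using a by (subst prod_ennreal) (auto simp: algebra_simps)
    finally show "(\<integral>\<^sup>+\<omega>. (\<Prod>j\<in>UNIV. ?e j \<omega> (S j)) \<partial>M) = (\<Prod>j\<in>UNIV. ennreal ((1 / (1 / 2 + a * \<bar>S j\<bar>)) ^ CARD('d)))" .
  qed
  \<comment> \<open>The coordinates of \<open>S\<close> are independent and identically distributed,
    so the integral is a power of a single one.\<close>
  also have "\<dots> = (\<integral>\<^sup>+s. ennreal ((1 / (1 / 2 + a * \<bar>s\<bar>)) ^ CARD('d)) \<partial>exp_dist) ^ CARD('n)"
    by (subst P.product_nn_integral_prod) auto
  finally show ?thesis unfolding \<gamma>_def .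
qed

text \<open>Once the second hop is frozen, the exponent is a weighted sum of squared moduli of the
  first-hop gains and integrates exactly. Averaging in the opposite order would leave the
  denominator \<open>1 + (norm g)\<^sup>2\<close> inside the exponential.\<close>

lemma expected_conditional_error:
  fixes f :: "'w \<Rightarrow> complex ^ 'n::finite" and g :: "'w \<Rightarrow> complex ^ ('d::finite) ^ 'n"
    and v :: "'w \<Rightarrow> complex ^ 't1::finite ^ 'n" and w :: "'w \<Rightarrow> complex ^ 't2::finite ^ 'd"
  assumes channel: "channel_model M f g v w" and a: "a > 0"
  shows "(\<integral>\<^sup>+\<omega>. ennreal (exp (- (a * (\<Sum>j\<in>UNIV. (norm (f \<omega> $ j))\<^sup>2 * (norm (g \<omega> $ j))\<^sup>2) / (1 + (norm (g \<omega>))\<^sup>2)))) \<partial>M)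
    \<le> ennreal (((2 * real CARD('n)) ^ CARD('n)) ^ CARD('n)) *
      (\<integral>\<^sup>+s. ennreal ((1 / (1 / 2 + a * \<bar>s\<bar>)) ^ CARD('d)) \<partial>exp_dist) ^ CARD('n)"
proof -
  interpret prob_space M using channel by (simp add: channel_model_def)
  have ind: "indep_vars (\<lambda>_. borel) (source_var f g v w) UNIV"
    using channel by (auto simp: channel_model_def)
  let ?C = "((2 * real CARD('n)) ^ CARD('n)) ^ CARD('n)"
  have norm_row: "(norm (y $ j))\<^sup>2 = (\<Sum>l\<in>UNIV. (norm (y $ j $ l))\<^sup>2)" for y :: "complex ^ 'd ^ 'n" and j
    by (simp add: norm_vec_def L2_set_def sum_nonneg)
  have norm_sq: "(norm y)\<^sup>2 = (\<Sum>j\<in>UNIV. (norm (y $ j))\<^sup>2)" for y :: "complex ^ 'd ^ 'n"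
    by (simp add: norm_vec_def L2_set_def sum_nonneg)
  \<comment> \<open>The integrand is rewritten as a function of the scalar sources, so that it is
    visibly measurable on the product space and can be resampled.\<close>
  define F where "F = (\<lambda>h :: ('n, 'd, 't1, 't2) source \<Rightarrow> complex. ennreal (exp (- (a * (\<Sum>j\<in>UNIV. (norm (h (Source_Gain j)))\<^sup>2 *
      (\<Sum>l\<in>UNIV. (norm (h (Dest_Gain j l)))\<^sup>2)) / (1 + (\<Sum>j\<in>UNIV. \<Sum>l\<in>UNIV. (norm (h (Dest_Gain j l)))\<^sup>2))))))"
  have F: "F \<in> borel_measurable (PiM UNIV (\<lambda>_. borel))"
    unfolding F_def by measurable
  \<comment> \<open>Only the second-hop gains are frozen.\<close>
  let ?A = "{s :: ('n, 'd, 't1, 't2) source. \<exists>j l. s = Dest_Gain j l}"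
  have "(\<integral>\<^sup>+\<omega>. ennreal (exp (- (a * (\<Sum>j\<in>UNIV. (norm (f \<omega> $ j))\<^sup>2 * (norm (g \<omega> $ j))\<^sup>2) / (1 + (norm (g \<omega>))\<^sup>2)))) \<partial>M) =
      (\<integral>\<^sup>+\<omega>. F (\<lambda>s. source_var f g v w s \<omega>) \<partial>M)"
    by (simp add: F_def norm_sq norm_row)
  also have "\<dots> = (\<integral>\<^sup>+\<omega>. (\<integral>\<^sup>+\<omega>'. F (\<lambda>s. if s \<in> ?A then source_var f g v w s \<omega> else source_var f g v w s \<omega>') \<partial>M) \<partial>M)"
    by (rule nn_integral_resample[OF ind F])
  also have "\<dots> = (\<integral>\<^sup>+\<omega>. (\<integral>\<^sup>+\<omega>'. ennreal (exp (- (\<Sum>j\<in>UNIV. (a * (norm (g \<omega> $ j))\<^sup>2 /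
      (1 + (\<Sum>j\<in>UNIV. (norm (g \<omega> $ j))\<^sup>2))) * (norm (f \<omega>' $ j))\<^sup>2))) \<partial>M) \<partial>M)"
  proof (intro nn_integral_cong)
    fix \<omega> \<omega>'
    let ?S = "1 + (\<Sum>j\<in>UNIV. (norm (g \<omega> $ j))\<^sup>2)"
    have "F (\<lambda>s. if s \<in> ?A then source_var f g v w s \<omega> else source_var f g v w s \<omega>') =
        ennreal (exp (- (a * (\<Sum>j\<in>UNIV. (norm (f \<omega>' $ j))\<^sup>2 * (norm (g \<omega> $ j))\<^sup>2) / ?S)))"
      by (simp add: F_def norm_row)
    also have "a * (\<Sum>j\<in>UNIV. (norm (f \<omega>' $ j))\<^sup>2 * (norm (g \<omega> $ j))\<^sup>2) / ?S =
        (\<Sum>j\<in>UNIV. a * (norm (g \<omega> $ j))\<^sup>2 / ?S * (norm (f \<omega>' $ j))\<^sup>2)"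
      by (simp add: sum_distrib_left sum_divide_distrib mult_ac)
    finally show "F (\<lambda>s. if s \<in> ?A then source_var f g v w s \<omega> else source_var f g v w s \<omega>') =
      ennreal (exp (- (\<Sum>j\<in>UNIV. a * (norm (g \<omega> $ j))\<^sup>2 / ?S * (norm (f \<omega>' $ j))\<^sup>2)))" .
  qed
  also have "\<dots> = (\<integral>\<^sup>+\<omega>. ennreal (\<Prod>j\<in>UNIV. 1 / (1 + a * (norm (g \<omega> $ j))\<^sup>2 /
      (1 + (\<Sum>j\<in>UNIV. (norm (g \<omega> $ j))\<^sup>2)))) \<partial>M)"
    using a by (intro nn_integral_cong nn_integral_source_gains[OF channel])
      (auto intro!: divide_nonneg_nonneg add_nonneg_nonneg sum_nonneg)
  also have "\<dots> \<le> (\<integral>\<^sup>+\<omega>. ennreal (?C * (\<Prod>j\<in>UNIV. exp ((norm (g \<omega> $ j))\<^sup>2 / 2) * (1 / (1 + a * (norm (g \<omega> $ j))\<^sup>2)))) \<partial>M)"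
    using a by (intro nn_integral_mono ennreal_leI outage_factor_bound) auto
  also have "\<dots> = (\<integral>\<^sup>+\<omega>. ennreal ?C * ennreal (\<Prod>j\<in>UNIV. exp ((norm (g \<omega> $ j))\<^sup>2 / 2) * (1 / (1 + a * (norm (g \<omega> $ j))\<^sup>2))) \<partial>M)"
    using a by (intro nn_integral_cong ennreal_mult) (auto intro!: prod_nonneg divide_nonneg_nonneg add_nonneg_nonneg)
  also have "\<dots> = ennreal ?C * (\<integral>\<^sup>+\<omega>. ennreal (\<Prod>j\<in>UNIV. exp ((norm (g \<omega> $ j))\<^sup>2 / 2) * (1 / (1 + a * (norm (g \<omega> $ j))\<^sup>2))) \<partial>M)"
  proof (rule nn_integral_cmult)
    note [measurable] = channel_model_measurable(3)[OF channel]
    show "(\<lambda>\<omega>. ennreal (\<Prod>j\<in>UNIV. exp ((norm (g \<omega> $ j))\<^sup>2 / 2) * (1 / (1 + a * (norm (g \<omega> $ j))\<^sup>2)))) \<in> borel_measurable M"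
      unfolding norm_row by measurable
  qed
  also note nn_integral_outage_product[OF channel a]
  finally show ?thesis .
qed

section \<open>Diversity\<close>

text \<open>A bound valid for each fixed pair of gains is integrated over the gains. Measurability
  of the decoder is what makes the error event a measurable set of source values, on which gains and
  noises can be separated.\<close>

lemma error_prob_le:
  fixes net :: "('k::finite, 'n::finite, 't1::finite, 't2::finite) af_network"
    and f :: "'w \<Rightarrow> complex ^ 'n" and g :: "'w \<Rightarrow> complex ^ ('d::finite) ^ 'n"
    and v :: "'w \<Rightarrow> complex ^ 't1 ^ 'n" and w :: "'w \<Rightarrow> complex ^ 't2 ^ 'd"
    and dec :: "('k, 'n, 'd, 't2) decoder"
  assumes channel: "channel_model M f g v w" and dec: "measurable_decoder dec" and P: "P > 0"
    and cond: "\<And>f g. emeasure M {\<omega> \<in> space M. dec P f g (received net P f g (v \<omega>) (w \<omega>) x) \<noteq> x} \<le> \<psi> f g"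
  shows "ennreal (error_prob net M f g v w dec P x) \<le> (\<integral>\<^sup>+\<omega>. \<psi> (f \<omega>) (g \<omega>) \<partial>M)"
proof -
  interpret prob_space M using channel by (simp add: channel_model_def)
  have ind: "indep_vars (\<lambda>_. borel) (source_var f g v w) UNIV"
    using channel by (auto simp: channel_model_def)
  have [measurable]: "source_var f g v w s \<in> borel_measurable M" for s
    by (rule channel_model_measurable[OF channel])
  let ?PM = "PiM (UNIV :: ('n, 'd, 't1, 't2) source set) (\<lambda>_. borel :: complex measure)"
  \<comment> \<open>\<open>F\<close>, \<open>G\<close>, \<open>V\<close> and \<open>W\<close>
    reassemble the gain and noise arrays from the family of scalar sources.\<close>
  define F where "F = (\<lambda>h :: ('n, 'd, 't1, 't2) source \<Rightarrow> complex. \<chi> j. h (Source_Gain j))"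
  define G where "G = (\<lambda>h :: ('n, 'd, 't1, 't2) source \<Rightarrow> complex. \<chi> j l. h (Dest_Gain j l))"
  define V where "V = (\<lambda>h :: ('n, 'd, 't1, 't2) source \<Rightarrow> complex. \<chi> j t. h (Relay_Noise j t))"
  define W where "W = (\<lambda>h :: ('n, 'd, 't1, 't2) source \<Rightarrow> complex. \<chi> l t. h (Dest_Noise l t))"
  define err where "err = {h \<in> space ?PM. dec P (F h) (G h) (received net P (F h) (G h) (V h) (W h) x) \<noteq> x}"
  have [measurable]: "F \<in> borel_measurable ?PM" "G \<in> borel_measurable ?PM"
    unfolding F_def G_def by (intro borel_measurable_vecI; simp)+
  have kap: "(\<lambda>h. kap net j (H h)) \<in> borel_measurable ?PM" if "H \<in> borel_measurable ?PM" for H j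
  proof -
    have "cnj \<in> borel_measurable borel"
      by (intro borel_measurable_continuous_onI continuous_intros)
    from measurable_compose[OF that this] show ?thesis
      using that by (simp add: kap_def)
  qed
  have [measurable]: "(\<lambda>h. received net P (F h) (G h) (V h) (W h) x) \<in> borel_measurable ?PM"
  proof (intro borel_measurable_vecI)
    fix t l
    have "(\<lambda>h. relay_received net P (F h) (V h) x j $ s) \<in> borel_measurable ?PM" for j s
      by (simp add: relay_received_def F_def V_def)
    then have "(\<lambda>h. kap net j ((relay_mat net j *v relay_received net P (F h) (V h) x j) $ t))
        \<in> borel_measurable ?PM" for j
      by (intro kap) (simp add: matrix_vector_mult_def)
    then have "(\<lambda>h. relay_sent net P (F h) (V h) x j $ t) \<in> borel_measurable ?PM" for j
      by (simp add: relay_sent_def kap_vec_def)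
    then show "(\<lambda>h. received net P (F h) (G h) (V h) (W h) x $ t $ l) \<in> borel_measurable ?PM"
      by (simp add: received_def G_def W_def)
  qed
  have "(\<lambda>h. (F h, G h, received net P (F h) (G h) (V h) (W h) x)) \<in> measurable ?PM (borel \<Otimes>\<^sub>M (borel \<Otimes>\<^sub>M borel))"
    by measurable
  then have "(\<lambda>h. (F h, G h, received net P (F h) (G h) (V h) (W h) x)) \<in> measurable ?PM borel"
    by (simp add: borel_prod)
  from measurable_compose[OF this, of "\<lambda>(f, g, Y). dec P f g Y" borel]
  have [measurable]: "(\<lambda>h. dec P (F h) (G h) (received net P (F h) (G h) (V h) (W h) x)) \<in> borel_measurable ?PM"
    using dec P by (simp add: measurable_decoder_def)
  have err [measurable]: "err \<in> sets ?PM"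
    unfolding err_def by measurable
  have indicator_err: "(\<integral>\<^sup>+\<omega>. indicator err (T \<omega>) \<partial>M) = emeasure M (T -` err \<inter> space M)"
    if "T \<in> measurable M ?PM" for T
  proof -
    have "(\<integral>\<^sup>+\<omega>. indicator err (T \<omega>) \<partial>M) = (\<integral>\<^sup>+\<omega>. indicator (T -` err \<inter> space M) \<omega> \<partial>M)"
      by (intro nn_integral_cong) (simp add: indicator_def)
    then show ?thesis
      using measurable_sets[OF that err] by simp
  qed
  \<comment> \<open>Here the gains of both hops are frozen and only the noises are drawn
    afresh.\<close>
  let ?A = "{s :: ('n, 'd, 't1, 't2) source. (\<exists>j. s = Source_Gain j) \<or> (\<exists>j l. s = Dest_Gain j l)}"
  let ?X = "source_var f g v w"
  have proj: "F (\<lambda>s. ?X s \<omega>) = f \<omega>" "G (\<lambda>s. ?X s \<omega>) = g \<omega>" "V (\<lambda>s. ?X s \<omega>) = v \<omega>" "W (\<lambda>s. ?X s \<omega>) = w \<omega>"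
    "F (\<lambda>s. if s \<in> ?A then ?X s \<omega> else ?X s \<omega>') = f \<omega>"
    "G (\<lambda>s. if s \<in> ?A then ?X s \<omega> else ?X s \<omega>') = g \<omega>"
    "V (\<lambda>s. if s \<in> ?A then ?X s \<omega> else ?X s \<omega>') = v \<omega>'"
    "W (\<lambda>s. if s \<in> ?A then ?X s \<omega> else ?X s \<omega>') = w \<omega>'" for \<omega> \<omega>'
    by (simp_all add: F_def G_def V_def W_def vec_eq_iff)
  have "ennreal (error_prob net M f g v w dec P x) = emeasure M ((\<lambda>\<omega> s. ?X s \<omega>) -` err \<inter> space M)"
    unfolding error_prob_def emeasure_eq_measure
    by (intro arg_cong[of _ _ "\<lambda>A. ennreal (measure M A)"]) (auto simp: err_def proj space_PiM)
  also have "\<dots> = (\<integral>\<^sup>+\<omega>. indicator err (\<lambda>s. ?X s \<omega>) \<partial>M)"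
    by (intro indicator_err[symmetric] measurable_PiM_single') (auto simp: PiE_def)
  also have "\<dots> = (\<integral>\<^sup>+\<omega>. (\<integral>\<^sup>+\<omega>'. indicator err (\<lambda>s. if s \<in> ?A then ?X s \<omega> else ?X s \<omega>') \<partial>M) \<partial>M)"
    by (rule nn_integral_resample[OF ind]) measurable
  also have "\<dots> \<le> (\<integral>\<^sup>+\<omega>. \<psi> (f \<omega>) (g \<omega>) \<partial>M)"
  proof (rule nn_integral_mono)
    fix \<omega>
    let ?T = "\<lambda>\<omega>' s. if s \<in> ?A then ?X s \<omega> else ?X s \<omega>'"
    have "(\<integral>\<^sup>+\<omega>'. indicator err (?T \<omega>') \<partial>M) = emeasure M (?T -` err \<inter> space M)"
      by (intro indicator_err measurable_PiM_single') (auto simp: PiE_def)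
    also have "?T -` err \<inter> space M = {\<omega>' \<in> space M. dec P (f \<omega>) (g \<omega>) (received net P (f \<omega>) (g \<omega>) (v \<omega>') (w \<omega>') x) \<noteq> x}"
      unfolding err_def using proj(5-8) by (auto simp: space_PiM)
    also have "emeasure M \<dots> \<le> \<psi> (f \<omega>) (g \<omega>)"
      by (rule cond)
    finally show "(\<integral>\<^sup>+\<omega>'. indicator err (?T \<omega>') \<partial>M) \<le> \<psi> (f \<omega>) (g \<omega>)" .
  qed
  finally show ?thesis .
qed

text \<open>The scalar integral is left behind an arbitrary bound \<open>J\<close>, so the two
  antenna cases differ only in the estimate of this integral. The N-th power of \<open>J\<close>
  reflects one factor per relay.\<close>

lemma diversity_bound:
  fixes net :: "('k::finite, 'n::finite, 't1::finite, 't2::finite) af_network"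
    and f :: "'w \<Rightarrow> complex ^ 'n" and g :: "'w \<Rightarrow> complex ^ ('d::finite) ^ 'n"
    and v :: "'w \<Rightarrow> complex ^ 't1 ^ 'n" and w :: "'w \<Rightarrow> complex ^ 't2 ^ 'd"
    and dec :: "('k, 'n, 'd, 't2) decoder"
  assumes net: "valid_network net px" and channel: "channel_model M f g v w"
    and full_rank: "\<forall>u :: real ^ 'k. u \<noteq> 0 \<longrightarrow>
           rank (\<Sum>i\<in>UNIV. u $ i *\<^sub>R weight_mat net i) = CARD('n)"
    and out: "noise_directed (alphabet net) out" and meas: "measurable_decoder dec"
    and dec: "\<And>P f g Y. P > 0 \<Longrightarrow>
      out (eq_channel net M v w P f g) (eq_received net M v w P g Y) (dec P f g Y)"
  obtains \<kappa> C where "\<kappa> > 0" "C > 0"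
    "\<And>P x J. P \<ge> 1 \<Longrightarrow> x \<in> signal_set net \<Longrightarrow> J \<ge> 0 \<Longrightarrow>
      (\<integral>\<^sup>+s. ennreal ((1 / (1 / 2 + \<kappa> * P * \<bar>s\<bar>)) ^ CARD('d)) \<partial>exp_dist) \<le> ennreal J \<Longrightarrow>
      error_prob net M f g v w dec P x \<le> C * J ^ CARD('n)"
proof -
  interpret prob_space M using channel by (simp add: channel_model_def)
  have pi: "pi1 net > 0" "pi2 net > 0" and fin: "\<And>i. finite (alphabet net i)"
    using net by (auto simp: valid_network_def)
  obtain \<kappa> where \<kappa>: "\<kappa> > 0" "\<And>P f g x. P \<ge> 1 \<Longrightarrow> x \<in> signal_set net \<Longrightarrow>
      emeasure M {\<omega> \<in> space M. dec P f g (received net P f g (v \<omega>) (w \<omega>) x) \<noteq> x} \<le>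
        ennreal (2 * CARD('k) * exp (- (\<kappa> * P * (\<Sum>j\<in>UNIV. (norm (f $ j))\<^sup>2 * (norm (g $ j))\<^sup>2) / (1 + (norm g)\<^sup>2))))"
    using conditional_error[OF pi fin channel full_rank out dec] by blast
  \<comment> \<open>\<open>?CN\<close> is the price of separating the relays; the other factor of
    \<open>?C\<close> comes from the two tails and the union over the symbols.\<close>
  let ?CN = "((2 * real CARD('n)) ^ CARD('n)) ^ CARD('n)"
  let ?C = "2 * CARD('k) * ?CN"
  have "error_prob net M f g v w dec P x \<le> ?C * J ^ CARD('n)"
    if P: "P \<ge> 1" and x: "x \<in> signal_set net" and "J \<ge> 0"
      and J: "(\<integral>\<^sup>+s. ennreal ((1 / (1 / 2 + \<kappa> * P * \<bar>s\<bar>)) ^ CARD('d)) \<partial>exp_dist) \<le> ennreal J" for P x J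
  proof -
    let ?e = "\<lambda>\<omega>. ennreal (exp (- (\<kappa> * P * (\<Sum>j\<in>UNIV. (norm (f \<omega> $ j))\<^sup>2 * (norm (g \<omega> $ j))\<^sup>2) / (1 + (norm (g \<omega>))\<^sup>2))))"
    have "f \<in> borel_measurable M" "g \<in> borel_measurable M"
      using channel_model_measurable(2,3)[OF channel] by (auto intro!: borel_measurable_vecI)
    note [measurable] = this channel_model_measurable(2,3)[OF channel]
    have row: "(\<lambda>\<omega>. g \<omega> $ j) \<in> borel_measurable M" for j
      by (intro borel_measurable_vecI) measurable
    have "P > 0" using P by simp
    have "ennreal (error_prob net M f g v w dec P x) \<le> (\<integral>\<^sup>+\<omega>. ennreal (2 * CARD('k) * exp (- (\<kappa> * P *
        (\<Sum>j\<in>UNIV. (norm (f \<omega> $ j))\<^sup>2 * (norm (g \<omega> $ j))\<^sup>2) / (1 + (norm (g \<omega>))\<^sup>2)))) \<partial>M)"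
      by (rule error_prob_le[OF channel meas \<open>P > 0\<close> \<kappa>(2)[OF P x]])
    also have "\<dots> = (\<integral>\<^sup>+\<omega>. ennreal (2 * CARD('k)) * ?e \<omega> \<partial>M)"
      by (intro nn_integral_cong ennreal_mult) auto
    also have "\<dots> = ennreal (2 * CARD('k)) * (\<integral>\<^sup>+\<omega>. ?e \<omega> \<partial>M)"
      by (rule nn_integral_cmult) (use row in measurable)
    also have "\<dots> \<le> ennreal (2 * CARD('k)) * (ennreal ?CN * ennreal J ^ CARD('n))"
    proof (intro mult_left_mono order_trans[OF expected_conditional_error[OF channel, of "\<kappa> * P"]])
      show "\<kappa> * P > 0" using \<kappa>(1) P by simp
    qed (auto intro: power_mono J)
    also have "\<dots> = ennreal (?C * J ^ CARD('n))"
      using \<open>J \<ge> 0\<close> by (simp add: ennreal_power ennreal_mult[symmetric] mult_ac)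
    finally show ?thesis
      using \<open>J \<ge> 0\<close> by (subst (asm) ennreal_le_iff) auto
  qed
  moreover have "?C > 0" by simp
  ultimately show ?thesis using that \<kappa>(1) by blast
qed

lemma achieves_diversity_noise_directed:
  fixes net :: "('k::finite, 'n::finite, 't1::finite, 't2::finite) af_network"
    and f :: "'w \<Rightarrow> complex ^ 'n" and g :: "'w \<Rightarrow> complex ^ ('d::finite) ^ 'n"
    and v :: "'w \<Rightarrow> complex ^ 't1 ^ 'n" and w :: "'w \<Rightarrow> complex ^ 't2 ^ 'd"
    and dec :: "('k, 'n, 'd, 't2) decoder"
  assumes net: "valid_network net px" and channel: "channel_model M f g v w"
    and full_rank: "\<forall>u :: real ^ 'k. u \<noteq> 0 \<longrightarrow>
           rank (\<Sum>i\<in>UNIV. u $ i *\<^sub>R weight_mat net i) = CARD('n)"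
    and out: "noise_directed (alphabet net) out" and meas: "measurable_decoder dec"
    and dec: "\<And>P f g Y. P > 0 \<Longrightarrow>
      out (eq_channel net M v w P f g) (eq_received net M v w P g Y) (dec P f g Y)"
  shows "CARD('d) = 1 \<Longrightarrow>
      achieves_diversity net M f g v w dec (\<lambda>P. real CARD('n) * (1 - ln (ln P) / ln P))"
    and "CARD('d) > 1 \<Longrightarrow> achieves_diversity net M f g v w dec (\<lambda>P. real CARD('n))"
proof -
  obtain \<kappa> C where \<kappa>: "\<kappa> > 0" and C: "C > 0" and bound: "\<And>P x J. P \<ge> 1 \<Longrightarrow> x \<in> signal_set net \<Longrightarrow> J \<ge> 0 \<Longrightarrow>
      (\<integral>\<^sup>+s. ennreal ((1 / (1 / 2 + \<kappa> * P * \<bar>s\<bar>)) ^ CARD('d)) \<partial>exp_dist) \<le> ennreal J \<Longrightarrow>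
      error_prob net M f g v w dec P x \<le> C * J ^ CARD('n)"
    using diversity_bound[OF net channel full_rank out meas dec] by blast
  let ?N = "CARD('n)"
  show "achieves_diversity net M f g v w dec (\<lambda>P. real ?N * (1 - ln (ln P) / ln P))" if d: "CARD('d) = 1"
    unfolding achieves_diversity_def
  proof (intro exI conjI)
    \<comment> \<open>For \<open>ln P \<ge> 1\<close> the numerator
      \<open>ln (1 + 2 * (\<kappa> * P)) + 1\<close> is at most
      \<open>ln (1 + 2 * \<kappa>) + ln P + 1\<close>, and each of these terms is at most its
      coefficient in \<open>ln (1 + 2 * \<kappa>) + 2\<close> times \<open>ln P\<close>.\<close>
    let ?c = "(ln (1 + 2 * \<kappa>) + 2) / \<kappa>"
    have lnpos: "ln (1 + 2 * \<kappa>) > 0" using \<kappa> by simp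
    show "C * ?c ^ ?N > 0" using C \<kappa> lnpos by (intro mult_pos_pos zero_less_power divide_pos_pos add_pos_pos) auto
    show "\<forall>\<^sub>F P in at_top. \<forall>x\<in>signal_set net. error_prob net M f g v w dec P x \<le>
        C * ?c ^ ?N * P powr (- (real ?N * (1 - ln (ln P) / ln P)))"
      \<comment> \<open>From this point on \<open>ln P \<ge> 1\<close>, so additive constants can be
        absorbed into multiples of \<open>ln P\<close>.\<close>
      using eventually_ge_at_top[of "exp 1"]
    proof eventually_elim
      case (elim P)
      have P: "P \<ge> 1" using elim exp_ge_add_one_self[of 1] by simp
      have L: "ln P \<ge> 1" using elim P by (simp add: ln_ge_iff)
      \<comment> \<open>Multiplying the exponent by \<open>ln P\<close> cancels the division,
        because raising \<open>P\<close> to \<open>ln (ln P) / ln P\<close> gives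
        \<open>ln P\<close>.\<close>
      have pw: "P powr (- (real ?N * (1 - ln (ln P) / ln P))) = (ln P / P) ^ ?N"
      proof -
        have "P powr (- (real ?N * (1 - ln (ln P) / ln P))) = exp (real ?N * (ln (ln P) - ln P))"
          using P L by (simp add: powr_def field_simps)
        also have "\<dots> = (ln P / P) ^ ?N"
          using P L less_le_trans[OF zero_less_one L] by (simp add: exp_of_nat_mult exp_diff)
        finally show ?thesis .
      qed
      show ?case
      proof
        fix x assume x: "x \<in> signal_set net"
        let ?J = "(ln (1 + 2 * (\<kappa> * P)) + 1) / (\<kappa> * P)"
        have \<kappa>P: "\<kappa> * P > 0" using \<kappa> P by simp
        have J0: "?J \<ge> 0" using \<kappa>P by simp
        have "error_prob net M f g v w dec P x \<le> C * ?J ^ ?N"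
          using outage_integral_single[OF \<kappa>P] by (intro bound[OF P x J0]) (simp add: d)
        also have "\<dots> \<le> C * (?c * (ln P / P)) ^ ?N"
        proof (intro mult_left_mono power_mono)
          have "1 + 2 * (\<kappa> * P) \<le> (1 + 2 * \<kappa>) * P"
            using P by (simp add: algebra_simps)
          then have "ln (1 + 2 * (\<kappa> * P)) \<le> ln ((1 + 2 * \<kappa>) * P)"
            using \<kappa>P \<kappa> P by (subst ln_le_cancel_iff) (auto intro!: add_pos_pos mult_pos_pos)
          also have "\<dots> = ln (1 + 2 * \<kappa>) + ln P"
            using \<kappa> P by (subst ln_mult) auto
          finally have "ln (1 + 2 * (\<kappa> * P)) + 1 \<le> ln (1 + 2 * \<kappa>) * 1 + ln P + 1" by simp
          also have "\<dots> \<le> ln (1 + 2 * \<kappa>) * ln P + ln P + ln P"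
            using L lnpos by (intro add_mono mult_left_mono) auto
          finally have "ln (1 + 2 * (\<kappa> * P)) + 1 \<le> (ln (1 + 2 * \<kappa>) + 2) * ln P"
            by (simp add: algebra_simps)
          then have "?J \<le> (ln (1 + 2 * \<kappa>) + 2) * ln P / (\<kappa> * P)"
            using \<kappa>P by (intro divide_right_mono) auto
          then show "?J \<le> ?c * (ln P / P)" by simp
        qed (use C J0 in auto)
        also have "\<dots> = C * ?c ^ ?N * P powr (- (real ?N * (1 - ln (ln P) / ln P)))"
          unfolding pw power_mult_distrib by (simp only: mult.assoc)
        finally show "error_prob net M f g v w dec P x \<le>
            C * ?c ^ ?N * P powr (- (real ?N * (1 - ln (ln P) / ln P)))" .
      qed
    qed
  qed
  show "achieves_diversity net M f g v w dec (\<lambda>P. real ?N)" if d: "CARD('d) > 1"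
    unfolding achieves_diversity_def
  proof (intro exI conjI)
    \<comment> \<open>This is the coefficient of \<open>1 / P\<close> in the scalar integral, so its
      N-th power accompanies \<open>P powr (- N)\<close>.\<close>
    let ?c = "2 ^ (CARD('d) - 1) / \<kappa>"
    show "C * ?c ^ ?N > 0" using C \<kappa> by simp
    show "\<forall>\<^sub>F P in at_top. \<forall>x\<in>signal_set net. error_prob net M f g v w dec P x \<le>
        C * ?c ^ ?N * P powr (- real ?N)"
      using eventually_ge_at_top[of 1]
    proof eventually_elim
      case (elim P)
      show ?case
      proof
        fix x assume x: "x \<in> signal_set net"
        have \<kappa>P: "\<kappa> * P > 0" using \<kappa> elim by simp
        have "error_prob net M f g v w dec P x \<le> C * (2 ^ (CARD('d) - 1) / (\<kappa> * P)) ^ ?N"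
          using outage_integral_multiple[OF \<kappa>P, of "CARD('d)"] d \<kappa>P by (intro bound[OF elim x]) auto
        also have "\<dots> = C * ?c ^ ?N * (1 / P ^ ?N)"
          by (simp add: power_divide power_mult_distrib)
        also have "1 / P ^ ?N = P powr (- real ?N)"
          using elim by (simp add: powr_minus powr_realpow divide_inverse)
        finally show "error_prob net M f g v w dec P x \<le> C * ?c ^ ?N * P powr (- real ?N)" .
      qed
    qed
  qed
qed

theorem corollary1:
  fixes net :: "('k::finite, 'n::finite, 't1::finite, 't2::finite) af_network"
    and px :: "(real ^ 'k) pmf"
    and M :: "'w measure"
    and f :: "'w \<Rightarrow> complex ^ 'n" and g :: "'w \<Rightarrow> complex ^ ('d::finite) ^ 'n"
    and v :: "'w \<Rightarrow> complex ^ 't1 ^ 'n" and w :: "'w \<Rightarrow> complex ^ 't2 ^ 'd"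
  assumes net: "valid_network net px"
    and channel: "channel_model M f g v w"
    and full_rank: "\<forall>u :: real ^ 'k. u \<noteq> 0 \<longrightarrow>
           rank (\<Sum>i\<in>UNIV. u $ i *\<^sub>R weight_mat net i) = CARD('n)"
  shows "(CARD('d) = 1 \<longrightarrow>
            zf_diversity net M f g v w (\<lambda>P. real CARD('n) * (1 - ln (ln P) / ln P)) \<and>
            (\<forall>\<sigma>. bij_betw \<sigma> {..<CARD('k)} UNIV \<longrightarrow>
               zf_sic_diversity net M f g v w \<sigma> (\<lambda>P. real CARD('n) * (1 - ln (ln P) / ln P)))) \<and>
         (CARD('d) > 1 \<longrightarrow>
            zf_diversity net M f g v w (\<lambda>P. real CARD('n)) \<and>
            (\<forall>\<sigma>. bij_betw \<sigma> {..<CARD('k)} UNIV \<longrightarrow>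
               zf_sic_diversity net M f g v w \<sigma> (\<lambda>P. real CARD('n))))"
proof -
  have zf: "achieves_diversity net M f g v w dec (\<lambda>P. real CARD('n) * (1 - ln (ln P) / ln P))"
    if "CARD('d) = 1" "zf_decoder net M v w dec" for dec
    using that unfolding zf_decoder_def
    by (intro achieves_diversity_noise_directed(1)[OF net channel full_rank noise_directed_zf]) auto
  have zf': "achieves_diversity net M f g v w dec (\<lambda>P. real CARD('n))"
    if "CARD('d) > 1" "zf_decoder net M v w dec" for dec
    using that unfolding zf_decoder_def
    by (intro achieves_diversity_noise_directed(2)[OF net channel full_rank noise_directed_zf]) auto
  have sic: "achieves_diversity net M f g v w dec (\<lambda>P. real CARD('n) * (1 - ln (ln P) / ln P))"
    if "CARD('d) = 1" "bij_betw \<sigma> {..<CARD('k)} UNIV" "zf_sic_decoder net M v w \<sigma> dec" for \<sigma> dec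
    using that unfolding zf_sic_decoder_def
    by (intro achieves_diversity_noise_directed(1)[OF net channel full_rank noise_directed_zf_sic]) auto
  have sic': "achieves_diversity net M f g v w dec (\<lambda>P. real CARD('n))"
    if "CARD('d) > 1" "bij_betw \<sigma> {..<CARD('k)} UNIV" "zf_sic_decoder net M v w \<sigma> dec" for \<sigma> dec
    using that unfolding zf_sic_decoder_def
    by (intro achieves_diversity_noise_directed(2)[OF net channel full_rank noise_directed_zf_sic]) auto
  show ?thesis
    unfolding zf_diversity_def zf_sic_diversity_def using zf zf' sic sic' by blast
qed

end
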